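(* Let $0<\beta<\alpha<1$ and $y>0$. The EPPF of the Gibbs partition of $[n]$ generated by $\mathrm{PD}_{\alpha|\beta}(\alpha|y)$ can be expressed as $$p_{\alpha|\beta}(n_1,\ldots,n_k|y)=\left[\sum_{j=1}^k \mathbb{P}^{(k)}_{\frac{\beta}{\alpha},0}(j)\,\frac{f^{(n-j\beta)}_{\beta,j\beta}(y)}{f_\beta(y)}\right]p_\alpha(n_1,\ldots,n_k),$$ for positive integers $n_1,\dots,n_k$ with $\sum_i n_i=n$, where $\mathbb{P}^{(k)}_{\frac{\beta}{\alpha},0}(j)$ is the probability that a $\mathrm{PD}(\beta/\alpha,0)$ partition of $[k]$ has $j$ blocks. Moreover $\sum_{j=1}^k\mathbb{P}^{(k)}_{\frac{\beta}{\alpha},0}(j)f^{(n-j\beta)}_{\beta,j\beta}(\cdot)$ is the conditional density of $T_\beta$ given $K^{[\alpha]}_n=k$, where $K_n^{[\alpha]}$ is the number of blocks of a $\mathrm{PD}(\alpha,0)$ partition of $[n]$ and $T_\beta:=T_\alpha(T_{\beta/\alpha}(1))\overset{d}{=}T_\alpha\times T_{\beta/\alpha}^{1/\alpha}$ is equivalent to the inverse local time at $1$ of $V_\beta\sim\mathrm{PD}(\beta,0)$.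
   Context: $\mathcal P_\infty=\{(s_1,s_2,\ldots): s_1\ge s_2\ge\cdots\ge 0,\ \sum_k s_k=1\}$. For $\gamma\in(0,1)$ let $J_1>J_2>\cdots$ be the ranked points of a Poisson process on $(0,\infty)$ with intensity $\frac{\gamma}{\Gamma(1-\gamma)}x^{-\gamma-1}dx$ and $T_\gamma=\sum_i J_i$, a positive $\gamma$-stable variable with $\mathbb{E}[e^{-\lambda T_\gamma}]=e^{-\lambda^\gamma}$ and density $f_\gamma$. $\mathrm{PD}(\gamma,0)$ is the law of $(J_i/T_\gamma)_i$ on $\mathcal P_\infty$, $\mathrm{PD}(\gamma|t)$ is its regular conditional law given $T_\gamma=t$, and $T_\gamma$ is called the inverse local time at $1$ of $(J_i/T_\gamma)_i$. Partitions: a random $P\in\mathcal P_\infty$ generates an exchangeable partition of $[n]=\{1,\dots,n\}$ by sampling, given $P$, iid indices $I_1,\dots,I_n$ with $\mathbb{P}(I_m=i|P)=P_i$, and putting $m,m'$ in the same block iff $I_m=I_{m'}$. Its EPPF $p(n_1,\dots,n_k)$ is the probability that it equals a given partition $\{A_1,\dots,A_k\}$ of $[n]$ with $|A_i|=n_i$. For a law on $\mathcal P_\infty$, a partition of $[n]$ of that law means one generated by $P$ with that law. The EPPF for $\mathrm{PD}(\alpha,0)$ is $$p_\alpha(n_1,\dots,n_k)=\frac{\alpha^{k-1}\Gamma(k)}{\Gamma(n)}\prod_{j=1}^k(1-\alpha)_{n_j-1},\qquad (x)_m=\Gamma(x+m)/\Gamma(x).$$ $\mathrm{PD}_{\alpha|\beta}(\alpha|y):=\int_0^\infty\mathrm{PD}(\alpha|s)\,\omega^{(y)}_{\frac{\beta}{\alpha},\beta}(s)f_\alpha(s)\,ds$,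 with $\omega^{(y)}_{\frac{\beta}{\alpha},\beta}(s)=\dfrac{\alpha y^{\alpha-1}f_{\beta/\alpha}((y/s)^\alpha)}{s^\alpha f_\beta(y)}$. For $1\le j\le n$, $f^{(n-j\beta)}_{\beta,j\beta}$ is the density of $Y^{(n-j\beta)}_{\beta,j\beta}=T_{\beta,j\beta}/B_{j\beta,n-j\beta}$, with independent numerator and denominator, where $T_{\beta,\theta}$ has density $t^{-\theta}f_\beta(t)/\mathbb{E}[T_\beta^{-\theta}]$ and $B_{a,b}\sim\mathrm{Beta}(a,b)$. Joint law of $(T_\beta,K_n^{[\alpha]})$: $V_\alpha\sim\mathrm{PD}(\alpha,0)$ has inverse local time $T_\alpha$; $K_n^{[\alpha]}$ is the number of blocks of the partition of $[n]$ generated by $V_\alpha$; $T_{\beta/\alpha}$ is the inverse local time of $Q_{\beta/\alpha}\sim \mathrm{PD}(\beta/\alpha,0)$ which is independent of $V_\alpha$ and of the partition it generates; and $T_\beta=T_\alpha T_{\beta/\alpha}^{1/\alpha}$. *)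

theory Defs
  imports "HOL-Probability.Probability"
begin

section \<open>Mass partitions and the partitions they generate\<close>

text \<open>Sequences are indexed from \<open>0\<close>, so the mathematical \<open>s\<^sub>1, s\<^sub>2, \<dots>\<close> is \<open>s 0, s 1, \<dots>\<close>;
  the sets \<open>[n] = {1..n}\<close> that are being partitioned are indexed from \<open>1\<close>.\<close>

abbreviation seq_space :: "(nat \<Rightarrow> real) measure" where
  "seq_space \<equiv> \<Pi>\<^sub>M i\<in>UNIV. borel"

definition P_infty :: "(nat \<Rightarrow> real) set" where
  "P_infty = {s. decseq s \<and> (\<forall>i. 0 \<le> s i) \<and> s sums 1}"

text \<open>Laws on \<open>P_infty\<close> are represented as measures on \<open>seq_space\<close> that are carried by \<open>P_infty\<close>,
  so the choice made outside \<open>P_infty\<close> is irrelevant.\<close>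

definition index_pmf :: "(nat \<Rightarrow> real) \<Rightarrow> nat pmf" where
  "index_pmf P = (if P \<in> P_infty then embed_pmf P else return_pmf 0)"

definition index_partition :: "nat \<Rightarrow> (nat \<Rightarrow> nat) \<Rightarrow> nat set set" where
  "index_partition n i = (\<lambda>m. {m' \<in> {1..n}. i m' = i m}) ` {1..n}"

definition partition_pmf :: "nat \<Rightarrow> (nat \<Rightarrow> real) \<Rightarrow> nat set set pmf" where
  "partition_pmf n P = map_pmf (index_partition n) (Pi_pmf {1..n} 0 (\<lambda>_. index_pmf P))"

definition partition_law :: "(nat \<Rightarrow> real) measure \<Rightarrow> nat \<Rightarrow> nat set set measure" where
  "partition_law \<mu> n = \<mu> \<bind> (\<lambda>P. measure_pmf (partition_pmf n P))"

definition is_EPPF :: "(nat \<Rightarrow> real) measure \<Rightarrow> (nat list \<Rightarrow> real) \<Rightarrow> bool" where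
  "is_EPPF \<mu> p \<longleftrightarrow>
     (\<forall>n\<ge>1. \<forall>As. distinct As \<longrightarrow> partition_on {1..n} (set As) \<longrightarrow>
        measure (partition_law \<mu> n) {set As} = p (map card As))"

definition blocks_prob :: "(nat \<Rightarrow> real) measure \<Rightarrow> nat \<Rightarrow> nat \<Rightarrow> real" where
  "blocks_prob \<mu> k j = measure (partition_law \<mu> k) {\<pi>. card \<pi> = j}"

text \<open>The same sampling scheme realised by random variables: given \<open>P\<close>, the indices
  \<open>I 1, I 2, \<dots>\<close> are iid with \<open>\<bbbP>(I m = i | P) = P i\<close>. Testing against the events \<open>P \<in> A\<close>
  spells out the conditional probability.\<close>

definition iid_indices_given ::
    "'a measure \<Rightarrow> ('a \<Rightarrow> nat \<Rightarrow> real) \<Rightarrow> (nat \<Rightarrow> 'a \<Rightarrow> nat) \<Rightarrow> bool" where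
  "iid_indices_given M P I \<longleftrightarrow>
     (\<forall>m. I m \<in> M \<rightarrow>\<^sub>M count_space UNIV) \<and>
     (\<forall>n. \<forall>i :: nat \<Rightarrow> nat. \<forall>A \<in> sets seq_space.
        emeasure M {\<omega> \<in> space M. P \<omega> \<in> A \<and> (\<forall>m\<in>{1..n}. I m \<omega> = i m)} =
        (\<integral>\<^sup>+\<omega>. indicator A (P \<omega>) * ennreal (\<Prod>m\<in>{1..n}. P \<omega> (i m)) \<partial>M))"

text \<open>Independence of random variables of possibly different types (\<open>indep_var\<close> needs equal types).\<close>

definition independent_rvs ::
    "'a measure \<Rightarrow> 'b measure \<Rightarrow> ('a \<Rightarrow> 'b) \<Rightarrow> 'c measure \<Rightarrow> ('a \<Rightarrow> 'c) \<Rightarrow> bool" where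
  "independent_rvs M S X S' X' \<longleftrightarrow>
     X \<in> M \<rightarrow>\<^sub>M S \<and> X' \<in> M \<rightarrow>\<^sub>M S' \<and>
     prob_space.indep_set M {X -` A \<inter> space M | A. A \<in> sets S}
                            {X' -` A \<inter> space M | A. A \<in> sets S'}"

section \<open>Poisson points and Poisson-Dirichlet laws\<close>

definition num_points :: "(nat \<Rightarrow> 'a \<Rightarrow> real) \<Rightarrow> real set \<Rightarrow> 'a \<Rightarrow> ennreal" where
  "num_points J A \<omega> = (\<Sum>i. indicator A (J i \<omega>))"

text \<open>\<open>J 0, J 1, \<dots>\<close> enumerates the points of a Poisson process with intensity measure \<open>\<Lambda>\<close>.\<close>

definition poisson_points :: "'a measure \<Rightarrow> real measure \<Rightarrow> (nat \<Rightarrow> 'a \<Rightarrow> real) \<Rightarrow> bool" where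
  "poisson_points M \<Lambda> J \<longleftrightarrow>
     (\<forall>i. J i \<in> borel_measurable M) \<and>
     (\<forall>A \<in> sets borel. emeasure \<Lambda> A < \<infinity> \<longrightarrow>
        (\<forall>m. measure M {\<omega> \<in> space M. num_points J A \<omega> = of_nat m} =
             exp (- measure \<Lambda> A) * measure \<Lambda> A ^ m / fact m)) \<and>
     (\<forall>A \<in> sets borel. emeasure \<Lambda> A = \<infinity> \<longrightarrow> (AE \<omega> in M. num_points J A \<omega> = \<infinity>)) \<and>
     (\<forall>(r :: nat) A. (\<forall>l<r. A l \<in> sets borel) \<longrightarrow> disjoint_family_on A {..<r} \<longrightarrow>
        prob_space.indep_vars M (\<lambda>_. borel) (\<lambda>l. num_points J (A l)) {..<r})"

definition stable_intensity :: "real \<Rightarrow> real measure" where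
  "stable_intensity \<gamma> =
     density lborel (\<lambda>x. ennreal (indicator {0<..} x * (\<gamma> / Gamma (1 - \<gamma>) * x powr (- \<gamma> - 1))))"

definition ranked_stable_points :: "real \<Rightarrow> 'a measure \<Rightarrow> (nat \<Rightarrow> 'a \<Rightarrow> real) \<Rightarrow> bool" where
  "ranked_stable_points \<gamma> M J \<longleftrightarrow>
     prob_space M \<and> poisson_points M (stable_intensity \<gamma>) J \<and>
     (AE \<omega> in M. \<forall>i. 0 < J i \<omega> \<and> J (Suc i) \<omega> < J i \<omega>)"

definition inv_local_time :: "(nat \<Rightarrow> 'a \<Rightarrow> real) \<Rightarrow> 'a \<Rightarrow> real" where
  "inv_local_time J \<omega> = (\<Sum>i. J i \<omega>)"

definition normalized :: "(nat \<Rightarrow> 'a \<Rightarrow> real) \<Rightarrow> 'a \<Rightarrow> nat \<Rightarrow> real" where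
  "normalized J \<omega> = (\<lambda>i. J i \<omega> / inv_local_time J \<omega>)"

text \<open>If \<open>J\<close> and \<open>J'\<close> are the ranked points of index \<open>\<alpha>\<close> and \<open>\<beta>/\<alpha>\<close>, this is the variable
  \<open>T\<^sub>\<beta> = T\<^sub>\<alpha> T\<^bsub>\<beta>/\<alpha>\<^esub> powr (1/\<alpha>)\<close>.\<close>

definition composed_time ::
    "real \<Rightarrow> (nat \<Rightarrow> 'a \<Rightarrow> real) \<Rightarrow> (nat \<Rightarrow> 'a \<Rightarrow> real) \<Rightarrow> 'a \<Rightarrow> real" where
  "composed_time \<alpha> J J' \<omega> = inv_local_time J \<omega> * inv_local_time J' \<omega> powr (1 / \<alpha>)"

text \<open>If \<open>ranked_stable_points \<gamma> M J\<close>, this is \<open>PD(\<gamma>,0)\<close>.\<close>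

definition PD_law :: "'a measure \<Rightarrow> (nat \<Rightarrow> 'a \<Rightarrow> real) \<Rightarrow> (nat \<Rightarrow> real) measure" where
  "PD_law M J = distr M seq_space (normalized J)"

definition regular_cond_law ::
    "'a measure \<Rightarrow> 'b measure \<Rightarrow> ('a \<Rightarrow> 'b) \<Rightarrow> ('a \<Rightarrow> real) \<Rightarrow> (real \<Rightarrow> 'b measure) \<Rightarrow> bool" where
  "regular_cond_law M S X T \<kappa> \<longleftrightarrow>
     \<kappa> \<in> borel \<rightarrow>\<^sub>M prob_algebra S \<and>
     (\<forall>A \<in> sets S. \<forall>B \<in> sets borel.
        emeasure M {\<omega> \<in> space M. X \<omega> \<in> A \<and> T \<omega> \<in> B} =
        (\<integral>\<^sup>+t. indicator B t * emeasure (\<kappa> t) A \<partial>distr M borel T))"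

text \<open>The EPPF of \<open>PD(\<alpha>,0)\<close>; \<open>pochhammer\<close> is the rising factorial.\<close>

definition p_PD :: "real \<Rightarrow> nat list \<Rightarrow> real" where
  "p_PD \<alpha> ns = (let k = length ns; n = sum_list ns in
     \<alpha> ^ (k - 1) * Gamma (real k) / Gamma (real n) *
     (\<Prod>j<k. pochhammer (1 - \<alpha>) (ns ! j - 1)))"

section \<open>Densities\<close>

text \<open>Densities are evaluated pointwise, so versions have to be fixed: on \<open>(0,\<infinity>)\<close> the continuous
  version, which is unique, and \<open>0\<close> elsewhere.\<close>

definition pos_density :: "(real \<Rightarrow> real) \<Rightarrow> bool" where
  "pos_density f \<longleftrightarrow> continuous_on {0<..} f \<and> (\<forall>x>0. 0 \<le> f x) \<and> (\<forall>x\<le>0. f x = 0)"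

definition stable_density :: "real \<Rightarrow> (real \<Rightarrow> real) \<Rightarrow> bool" where
  "stable_density \<gamma> f \<longleftrightarrow> pos_density f \<and>
     (\<forall>l\<ge>0. (\<integral>\<^sup>+x. ennreal (exp (- l * x) * f x) \<partial>lborel) = ennreal (exp (- (l powr \<gamma>))))"

text \<open>The density of \<open>T\<^bsub>\<beta>,\<theta>\<^esub>\<close>, for \<open>f\<close> the density of \<open>T\<^sub>\<beta>\<close>; the denominator is
  \<open>\<bbbE>[T\<^sub>\<beta> powr (-\<theta>)]\<close>.\<close>

definition tilted_density :: "(real \<Rightarrow> real) \<Rightarrow> real \<Rightarrow> real \<Rightarrow> real" where
  "tilted_density f \<theta> t = indicator {0<..} t * t powr (- \<theta>) * f t /
     (LINT u:{0<..}|lborel. u powr (- \<theta>) * f u)"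

definition beta_density :: "real \<Rightarrow> real \<Rightarrow> real \<Rightarrow> real" where
  "beta_density a b x =
     indicator {0<..<1} x * x powr (a - 1) * (1 - x) powr (b - 1) / Beta a b"

text \<open>\<open>g\<close> is the density of \<open>T / B\<close> for independent \<open>T\<close> distributed as \<open>T\<^bsub>\<beta>,j\<beta>\<^esub>\<close> and
  \<open>B \<sim> Beta(j\<beta>, n - j\<beta>)\<close>.\<close>

definition Y_density ::
    "(real \<Rightarrow> real) \<Rightarrow> real \<Rightarrow> nat \<Rightarrow> nat \<Rightarrow> (real \<Rightarrow> real) \<Rightarrow> bool" where
  "Y_density f \<beta> n j g \<longleftrightarrow> pos_density g \<and>
     distributed
       (density lborel (\<lambda>t. ennreal (tilted_density f (real j * \<beta>) t)) \<Otimes>\<^sub>M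
        density lborel (\<lambda>b. ennreal (beta_density (real j * \<beta>) (real n - real j * \<beta>) b)))
       lborel (\<lambda>(t, b). t / b) (\<lambda>x. ennreal (g x))"

section \<open>The laws \<open>PD\<^bsub>\<alpha>|\<beta>\<^esub>(\<alpha>|y)\<close>\<close>

text \<open>Here \<open>f \<gamma>\<close> is the density of \<open>T\<^sub>\<gamma>\<close> and \<open>\<kappa> s\<close> is \<open>PD(\<alpha>|s)\<close>.\<close>

definition omega :: "(real \<Rightarrow> real \<Rightarrow> real) \<Rightarrow> real \<Rightarrow> real \<Rightarrow> real \<Rightarrow> real \<Rightarrow> real" where
  "omega f \<alpha> \<beta> y s =
     \<alpha> * y powr (\<alpha> - 1) * f (\<beta> / \<alpha>) ((y / s) powr \<alpha>) / (s powr \<alpha> * f \<beta> y)"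

definition PD_mix ::
    "(real \<Rightarrow> real \<Rightarrow> real) \<Rightarrow> (real \<Rightarrow> (nat \<Rightarrow> real) measure) \<Rightarrow>
     real \<Rightarrow> real \<Rightarrow> real \<Rightarrow> (nat \<Rightarrow> real) measure" where
  "PD_mix f \<kappa> \<alpha> \<beta> y =
     density lborel (\<lambda>s. ennreal (indicator {0<..} s * omega f \<alpha> \<beta> y s * f \<alpha> s)) \<bind> \<kappa>"

section \<open>Stable subordinators\<close>

definition stable_subordinator :: "real \<Rightarrow> 'a measure \<Rightarrow> (real \<Rightarrow> 'a \<Rightarrow> real) \<Rightarrow> bool" where
  "stable_subordinator \<gamma> M X \<longleftrightarrow>
     prob_space M \<and> (\<forall>t\<ge>0. X t \<in> borel_measurable M) \<and>
     (\<forall>\<omega>\<in>space M. X 0 \<omega> = 0 \<and> mono_on {0..} (\<lambda>t. X t \<omega>) \<and>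
        (\<forall>t\<ge>0. continuous (at_right t) (\<lambda>t. X t \<omega>))) \<and>
     (\<forall>s t l. 0 \<le> s \<longrightarrow> s \<le> t \<longrightarrow> 0 \<le> l \<longrightarrow>
        (\<integral>\<omega>. exp (- l * (X t \<omega> - X s \<omega>)) \<partial>M) = exp (- (t - s) * l powr \<gamma>)) \<and>
     (\<forall>ts. sorted ts \<longrightarrow> set ts \<subseteq> {0..} \<longrightarrow>
        prob_space.indep_vars M (\<lambda>_. borel)
          (\<lambda>i \<omega>. X (ts ! Suc i) \<omega> - X (ts ! i) \<omega>) {..<length ts - 1})"

end

(* Let J be the ranked points of the Poisson process of index alpha, T = sum J_i, and let pi be a
   partition of [n] into k blocks. The event that the sample of size n produces pi turns
   T^n P(pi | J) into a sum of products of powers of the J_i over k distinct points. Its expectation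
   under the weight exp(-l T) follows from the Laplace functional by differentiation and equals
   alpha^k prod_i (1-alpha)_{n_i - 1} l^(k alpha - n) exp(-l^alpha).
   Replacing l by l u^(1/alpha) and integrating over the law of u = T_{beta/alpha} leaves
   E[u^k exp(-l^alpha u)], which the same formula for the index beta/alpha expands over the partitions
   of [k]. Since the Laplace transform of y^n f^{(n-j beta)}_{beta, j beta}(y) is
   beta Gamma(n)/Gamma(j) l^(j beta - n) exp(-l^beta), uniqueness of Laplace transforms identifies the
   joint law of T_beta and the partition. To use the independence of the two normalized sequences, T is
   recovered from the normalized points: J_i i^(1/alpha) converges almost surely along squares. *)

theory Submission
  imports Defs
begin

text \<open>The power \<open>T ^ n\<close> has two jobs. It cancels the normalization of the n
  sampled masses, and on the other side it makes the law of the quotient by a beta variable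
  explicit, because the exponents of the tilt and of the beta weight add up to n. The weighted
  measures have infinite mass, so uniqueness of transforms is needed beyond probability measures.
  The main obstacle is that the formula is claimed at one given y, whereas transforms identify
  densities only almost everywhere. The mixture side is an integral over s that must be shown
  continuous in y, and this needs a uniform bound on u f(u) for the stable density f of index
  beta/alpha. Such a density is given only as a continuous function with the right transform. The
  bound comes from the partition expansion itself: it exhibits u^n f(u) as a finite combination of
  fractional integrals of f, whose kernels are bounded on compact intervals once n is large.\<close>

section \<open>Uniqueness of measures from moments and from Laplace transforms\<close>

lemma finite_measure_eqI_moments:
  fixes M N :: "real measure"
  assumes fin: "finite_measure M" "finite_measure N"
    and sets: "sets M = sets borel" "sets N = sets borel"
    and supp: "AE x in M. x \<in> {0..1}" "AE x in N. x \<in> {0..1}"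
    and moments: "\<And>n. (LINT x|M. x ^ n) = (LINT x|N. x ^ n)"
  shows "M = N"
proof -
  interpret M: finite_measure M by fact
  interpret N: finite_measure N by fact
  note [measurable_cong] = sets
  have space: "space M = UNIV" "space N = UNIV"
    using sets_eq_imp_space_eq[OF sets(1)] sets_eq_imp_space_eq[OF sets(2)] by simp_all
  have integrable_bdd: "integrable L h"
    if "finite_measure L" "sets L = sets borel" "AE x in L. x \<in> {0..1}" "h \<in> borel_measurable borel"
      "\<And>x. x \<in> {0..1} \<Longrightarrow> \<bar>h x\<bar> \<le> B" for L :: "real measure" and h :: "real \<Rightarrow> real" and B
  proof (rule finite_measure.integrable_const_bound[OF that(1), of _ B])
    show "AE x in L. norm (h x) \<le> B"
      using that(3) by eventually_elim (simp add: that(5))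
    show "h \<in> borel_measurable L"
      using that(4) by (simp add: measurable_cong_sets[OF that(2) refl])
  qed
  \<comment> \<open>Expanding \<open>(1 - x) ^ (n - k)\<close> writes a Bernstein polynomial as a
    finite combination of monomials, so equal moments give equal integrals.\<close>
  have bern: "(LINT x|M. Bernstein n k x) = (LINT x|N. Bernstein n k x)" for n k
  proof -
    have eq: "Bernstein n k x = (\<Sum>i\<le>n - k. real (n choose k) * (real (n - k choose i) * (-1) ^ i) * x ^ (k + i))"
      for x
    proof -
      have "(1 - x) ^ (n - k) = (\<Sum>i\<le>n - k. real (n - k choose i) * (- x) ^ i)"
        using binomial_ring[of "- x" 1 "n - k"] by simp
      also have "\<dots> = (\<Sum>i\<le>n - k. real (n - k choose i) * ((-1) ^ i * x ^ i))"
        by (subst power_minus) simp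
      finally show ?thesis
        unfolding Bernstein_def by (simp add: sum_distrib_left power_add mult_ac)
    qed
    have pow: "integrable M (\<lambda>x. x ^ m)" "integrable N (\<lambda>x. x ^ m)" for m
      by (rule integrable_bdd[of _ _ 1]; use fin sets supp in \<open>simp add: power_le_one\<close>)+
    show ?thesis
      unfolding eq using pow moments by simp
  qed
  \<comment> \<open>Bernstein polynomials approximate \<open>h\<close> uniformly only on
    \<open>{0..1}\<close>. The error integrates to at most \<open>e\<close> times the mass because
    both measures are carried by that interval.\<close>
  have cont: "(LINT x|M. h x) = (LINT x|N. h x)" if h: "continuous_on UNIV h" for h :: "real \<Rightarrow> real"
  proof -
    have hm: "h \<in> borel_measurable borel" using h by (rule borel_measurable_continuous_onI)
    obtain B where B: "\<And>x. x \<in> {0..1} \<Longrightarrow> \<bar>h x\<bar> \<le> B"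
      using compact_imp_bounded[OF compact_continuous_image[OF continuous_on_subset[OF h, of "{0..1}"]]]
      unfolding bounded_iff by fastforce
    have ih: "integrable M h" "integrable N h"
      using integrable_bdd[OF _ _ _ hm B] fin sets supp by auto
    have near: "\<bar>(LINT x|M. h x) - (LINT x|N. h x)\<bar> \<le> e * (measure M UNIV + measure N UNIV)" if "e > 0" for e
    proof -
      obtain n where n: "\<And>x. x \<in> {0..1} \<Longrightarrow> \<bar>h x - (\<Sum>k\<le>n. h (k / n) * Bernstein n k x)\<bar> < e"
        using Bernstein_Weierstrass[OF continuous_on_subset[OF h, of "{0..1}"] \<open>e > 0\<close>] by auto
      define p where "p x = (\<Sum>k\<le>n. h (k / n) * Bernstein n k x)" for x
      have bm: "continuous_on UNIV (Bernstein n k)" for k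
        unfolding Bernstein_def by (intro continuous_intros)
      have bi: "integrable M (Bernstein n k)" "integrable N (Bernstein n k)" for k
      proof -
        have "\<bar>Bernstein n k x\<bar> \<le> real (n choose k) * 1 * 1" if "x \<in> {0..1}" for x
          unfolding Bernstein_def abs_mult using that
          by (intro mult_mono) (auto simp: power_le_one power_abs)
        then show "integrable M (Bernstein n k)" "integrable N (Bernstein n k)"
          using integrable_bdd[OF _ _ _ borel_measurable_continuous_onI[OF bm]] fin sets supp by blast+
      qed
      have pi: "integrable M p" "integrable N p"
        unfolding p_def by (auto intro!: bi)
      have pe: "(LINT x|M. p x) = (LINT x|N. p x)"
        unfolding p_def using bi bern by simp
      have bnd: "\<bar>(LINT x|L. h x) - (LINT x|L. p x)\<bar> \<le> e * measure L UNIV"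
        if L: "finite_measure L" "integrable L h" "integrable L p" "AE x in L. x \<in> {0..1}" "space L = UNIV" for L
      proof -
        have "\<bar>(LINT x|L. h x) - (LINT x|L. p x)\<bar> = \<bar>LINT x|L. h x - p x\<bar>"
          using L by simp
        also have "\<dots> \<le> (LINT x|L. \<bar>h x - p x\<bar>)" by (rule integral_abs_bound)
        also have "\<dots> \<le> (LINT x|L. e)"
        proof (rule integral_mono_AE)
          show "AE x in L. \<bar>h x - p x\<bar> \<le> e"
            using L(4) by eventually_elim (use n in \<open>auto simp: p_def intro: less_imp_le\<close>)
        qed (use L in \<open>auto simp: finite_measure.integrable_const\<close>)
        also have "\<dots> = e * measure L UNIV" using L by simp
        finally show ?thesis .
      qed
      show ?thesis
        using bnd[OF fin(1) ih(1) pi(1) supp(1) space(1)] bnd[OF fin(2) ih(2) pi(2) supp(2) space(2)] pe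
        by (simp add: algebra_simps)
    qed
    have "\<bar>(LINT x|M. h x) - (LINT x|N. h x)\<bar> \<le> 0"
    proof (rule field_le_epsilon)
      fix e :: real assume "e > 0"
      define m where "m = measure M UNIV + measure N UNIV"
      have m: "0 \<le> m" by (simp add: m_def)
      \<comment> \<open>Dividing by \<open>m + 1\<close> instead of \<open>m\<close> covers the case
        that both measures vanish.\<close>
      have "\<bar>(LINT x|M. h x) - (LINT x|N. h x)\<bar> \<le> e / (m + 1) * m"
        using near[of "e / (m + 1)"] \<open>e > 0\<close> m unfolding m_def[symmetric] by simp
      also have "\<dots> \<le> e / (m + 1) * (m + 1)" using \<open>e > 0\<close> m by (intro mult_left_mono) auto
      also have "\<dots> = e" using m by simp
      finally show "\<bar>(LINT x|M. h x) - (LINT x|N. h x)\<bar> \<le> 0 + e" by simp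
    qed
    then show ?thesis by simp
  qed
  \<comment> \<open>The continuous steps decrease to the indicator of \<open>{..c}\<close>, so
    integrals of continuous functions determine the distribution function.\<close>
  have lim: "(\<lambda>m. LINT x|L. cts_step c (c + inverse (Suc m)) x) \<longlonglongrightarrow> measure L {..c}"
    if L: "finite_measure L" "sets L = sets borel" for L :: "real measure" and c
  proof -
    interpret finite_measure L by fact
    note [measurable_cong] = L(2)
    have cm: "cts_step c (c + inverse (Suc m)) \<in> borel_measurable borel" for m
      by (auto simp: cts_step_def[abs_def])
    have "(\<lambda>m. LINT x|L. cts_step c (c + inverse (Suc m)) x) \<longlonglongrightarrow> (LINT x|L. indicator {..c} x)"
    proof (rule integral_dominated_convergence[where w = "\<lambda>_. 1"])
      show "AE x in L. (\<lambda>m. cts_step c (c + inverse (Suc m)) x) \<longlonglongrightarrow> indicator {..c} x"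
      proof (intro AE_I2)
        fix x
        show "(\<lambda>m. cts_step c (c + inverse (Suc m)) x) \<longlonglongrightarrow> indicator {..c} x"
        proof (cases "x \<le> c")
          case False
          then have "\<forall>\<^sub>F m in sequentially. inverse (real (Suc m)) < x - c"
            using LIMSEQ_inverse_real_of_nat by (intro order_tendstoD) auto
          then have "\<forall>\<^sub>F m in sequentially. cts_step c (c + inverse (Suc m)) x = 0"
            by eventually_elim (use False in \<open>auto simp: cts_step_def\<close>)
          then show ?thesis using False by (simp add: tendsto_eventually)
        qed (simp add: cts_step_def)
      qed
      show "AE x in L. norm (cts_step c (c + inverse (Suc m)) x) \<le> 1" for m
        by (auto simp: cts_step_def divide_le_eq)
    qed (use cm L in auto)
    then show ?thesis using L by (simp add: sets_eq_imp_space_eq[OF L(2)])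
  qed
  show ?thesis
  proof (rule cdf_unique')
    show "finite_borel_measure M" "finite_borel_measure N"
      using fin sets by (auto simp: finite_borel_measure_def finite_borel_measure_axioms_def)
    show "cdf M = cdf N"
    proof
      fix c
      have "(LINT x|M. cts_step c (c + inverse (Suc m)) x) = (LINT x|N. cts_step c (c + inverse (Suc m)) x)" for m
        by (intro cont uniformly_continuous_imp_continuous cts_step_uniformly_continuous) simp
      from lim[OF fin(1) sets(1), of c, unfolded this] lim[OF fin(2) sets(2), of c]
      show "cdf M c = cdf N c"
        unfolding cdf_def by (rule LIMSEQ_unique)
    qed
  qed
qed

text \<open>Weighting by \<open>exp (- x)\<close> and substituting \<open>v = exp (- x)\<close>
  turns the transform at \<open>n + 1\<close> into the \<open>n\<close>-th moment of a measure on
  the unit interval. The weight makes this measure finite although \<open>M\<close> and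
  \<open>N\<close> may have infinite mass, as happens later for stable densities multiplied by a
  power.\<close>

lemma laplace_unique:
  fixes M N :: "real measure"
  assumes sets: "sets M = sets borel" "sets N = sets borel"
    and supp: "AE x in M. 0 < x" "AE x in N. 0 < x"
    and fin: "\<And>n. (\<integral>\<^sup>+x. ennreal (exp (- real (Suc n) * x)) \<partial>M) < \<infinity>"
    and eq: "\<And>n. (\<integral>\<^sup>+x. ennreal (exp (- real (Suc n) * x)) \<partial>M) = (\<integral>\<^sup>+x. ennreal (exp (- real (Suc n) * x)) \<partial>N)"
  shows "M = N"
proof -
  note [measurable_cong] = sets
  define push where "push L = distr (density L (\<lambda>x. ennreal (exp (- x)))) borel (\<lambda>x. exp (- x :: real))" for L
  have AEp: "AE v in push L. v \<in> {0..1}" if "sets L = sets borel" "AE x in L. 0 < x" for L :: "real measure"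
  proof -
    note [measurable_cong] = that(1)
    have "AE x in density L (\<lambda>x. ennreal (exp (- x))). exp (- x) \<in> {0..1}"
      by (subst AE_density) (use that(2) in auto)
    then show ?thesis unfolding push_def by (subst AE_distr_iff) auto
  qed
  have nnp: "(\<integral>\<^sup>+v. h v \<partial>push L) = (\<integral>\<^sup>+x. ennreal (exp (- x)) * h (exp (- x)) \<partial>L)"
    if "sets L = sets borel" "h \<in> borel_measurable borel" for L and h :: "real \<Rightarrow> ennreal"
  proof -
    note [measurable_cong] = that(1) note [measurable] = that(2)
    show ?thesis unfolding push_def by (simp add: nn_integral_distr nn_integral_density)
  qed
  have mom: "(\<integral>\<^sup>+v. ennreal (v ^ n) \<partial>push L) = (\<integral>\<^sup>+x. ennreal (exp (- real (Suc n) * x)) \<partial>L)"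
    if "sets L = sets borel" for L n
    by (subst nnp[OF that])
      (auto simp: ennreal_mult[symmetric] exp_of_nat_mult[symmetric] exp_add[symmetric] algebra_simps
        intro!: nn_integral_cong)
  have fp: "finite_measure (push L)"
    if "sets L = sets borel" "(\<integral>\<^sup>+x. ennreal (exp (- real (Suc 0) * x)) \<partial>L) < \<infinity>" for L
    using mom[OF that(1), of 0] that(2)
    by (intro finite_measureI) auto
  have "push M = push N"
  proof (rule finite_measure_eqI_moments)
    show "finite_measure (push M)" "finite_measure (push N)"
      using fin[of 0] eq[of 0] sets by (auto intro!: fp)
    show "sets (push M) = sets borel" "sets (push N) = sets borel"
      by (auto simp: push_def)
    show pM: "AE v in push M. v \<in> {0..1}" and pN: "AE v in push N. v \<in> {0..1}"
      using AEp sets supp by auto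
    fix n
    have nn: "AE v in push M. 0 \<le> v ^ n" "AE v in push N. 0 \<le> v ^ n"
      using pM pN by (auto elim!: eventually_mono)
    have ms: "(\<lambda>v. v ^ n) \<in> borel_measurable (push M)" "(\<lambda>v. v ^ n) \<in> borel_measurable (push N)"
      unfolding push_def by auto
    show "(LINT v|push M. v ^ n) = (LINT v|push N. v ^ n)"
      by (simp add: integral_eq_nn_integral[OF ms(1) nn(1)] integral_eq_nn_integral[OF ms(2) nn(2)]
        mom sets eq[simplified mult_minus_left] del: of_nat_Suc)
  qed
  \<comment> \<open>The factor \<open>inverse v\<close> cancels the weight and \<open>- ln v\<close>
    inverts the substitution, so \<open>push L\<close> determines \<open>L\<close>.\<close>
  have recover: "emeasure L B = (\<integral>\<^sup>+v. ennreal (inverse v) * indicator B (- ln v) \<partial>push L)"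
    if "sets L = sets borel" "B \<in> sets borel" for L B
    using that
    by (subst nnp[OF that(1)])
      (auto simp: mult.assoc[symmetric] exp_minus ln_inverse simp flip: nn_integral_indicator ennreal_mult)
  show ?thesis
    by (rule measure_eqI) (use sets recover \<open>push M = push N\<close> in auto)
qed

section \<open>Substitutions on the half-line and Gamma integrals\<close>

text \<open>The substitution rule for compact intervals is applied on \<open>{l n..r n}\<close>.
  These intervals exhaust the open half-line, their images exhaust \<open>S\<close>, and monotone
  convergence passes to the limit.\<close>

lemma nn_integral_subst_increasing:
  fixes \<phi> \<phi>' :: "real \<Rightarrow> real" and G :: "real \<Rightarrow> ennreal"
  assumes deriv: "\<And>u. 0 < u \<Longrightarrow> (\<phi> has_real_derivative \<phi>' u) (at u)"
    and cont: "continuous_on {0<..} \<phi>'" and nonneg: "\<And>u. 0 < u \<Longrightarrow> 0 \<le> \<phi>' u"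
    and mono: "\<And>u v. 0 < u \<Longrightarrow> u < v \<Longrightarrow> \<phi> u < \<phi> v"
    and image: "\<phi> ` {0<..} = S"
    and [measurable]: "\<phi> \<in> borel_measurable borel" "\<phi>' \<in> borel_measurable borel" "S \<in> sets borel" "G \<in> borel_measurable borel"
  shows "(\<integral>\<^sup>+x. indicator S x * G x \<partial>lborel) = (\<integral>\<^sup>+u. indicator {0<..} u * ennreal (\<phi>' u) * G (\<phi> u) \<partial>lborel)"
proof -
  define l r where "l n = inverse (real (Suc n))" and "r n = real (Suc n)" for n
  have le_iff: "\<phi> u \<le> \<phi> v \<longleftrightarrow> u \<le> v" if "0 < u" "0 < v" for u v
    using mono[of u v] mono[of v u] that by (cases u v rule: linorder_cases) auto
  have lr: "0 < l n" "l n \<le> r n" "0 < r n" for n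
  proof -
    have "inverse (real (Suc n)) \<le> 1 / 1" unfolding inverse_eq_divide by (intro divide_left_mono) auto
    then show "0 < l n" "l n \<le> r n" "0 < r n" by (simp_all add: l_def r_def)
  qed
  define C where "C n = {l n..r n}" for n
  define D where "D n = {\<phi> (l n)..\<phi> (r n)}" for n
  have [measurable]: "C n \<in> sets borel" "D n \<in> sets borel" for n by (simp_all add: C_def D_def)
  have Cinc: "C m \<subseteq> C n" if "m \<le> n" for m n
  proof -
    have "l n \<le> l m" unfolding l_def using that by (intro le_imp_inverse_le) auto
    moreover have "r m \<le> r n" unfolding r_def using that by simp
    ultimately show ?thesis unfolding C_def by auto
  qed
  have Cex: "\<exists>n. u \<in> C n" if "0 < u" for u
  proof -
    obtain m where m: "inverse (real (Suc m)) < u" using reals_Archimedean[OF \<open>0 < u\<close>] by auto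
    obtain k where k: "u < real k" using reals_Archimedean2 by auto
    have "inverse (real (Suc (max m k))) \<le> inverse (real (Suc m))" by (intro le_imp_inverse_le) auto
    then have "inverse (real (Suc (max m k))) \<le> u" "u \<le> real (Suc (max m k))" using m k by linarith+
    then show ?thesis unfolding C_def l_def r_def by (intro exI[of _ "max m k"]) simp
  qed
  have iff: "u \<in> C n \<longleftrightarrow> \<phi> u \<in> D n" if "0 < u" for u n
    using le_iff[of "l n" u] le_iff[of u "r n"] lr that by (simp add: C_def D_def)
  \<comment> \<open>By the intermediate value theorem every point of \<open>D n\<close> is attained,
    so these intervals stay inside the image.\<close>
  have DS: "D n \<subseteq> S" for n
  proof
    fix x assume "x \<in> D n"
    then obtain u where "l n \<le> u" "\<phi> u = x"
      using IVT'[of \<phi> "l n" x "r n"] lr(2)[of n] lr(1)[of n]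
      by (force simp: D_def intro!: DERIV_isCont continuous_at_imp_continuous_on deriv)
    then show "x \<in> S" unfolding image[symmetric] using lr(1)[of n] by (intro image_eqI[of _ _ u]) auto
  qed
  have D_iff: "indicator (D n) (\<phi> u) = (indicator (C n) u :: ennreal)" if "0 < u" for u n
    using iff[OF that] by (simp add: indicator_def)
  have Cmono: "indicator (C m) u \<le> (indicator (C n) u :: ennreal)" if "m \<le> n" for m n u
    using Cinc[OF that] by (auto simp: indicator_def)
  have CU: "(SUP n. indicator (C n) u) = (1 :: ennreal)" if u: "0 < u" for u
  proof -
    obtain n where "u \<in> C n" using Cex[OF u] by blast
    then show ?thesis by (intro antisym SUP_least SUP_upper2[of n]) (auto simp: indicator_def)
  qed
  have Dmono: "indicator (D m) x \<le> (indicator (D n) x :: ennreal)" if "m \<le> n" for m n x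
  proof (cases "x \<in> D m")
    case True
    then obtain u where u: "0 < u" "x = \<phi> u" using DS[of m] image by auto
    then show ?thesis using Cmono[OF that] D_iff by simp
  qed simp
  have DU: "(SUP n. indicator (D n) x) = (indicator S x :: ennreal)" for x
  proof (cases "x \<in> S")
    case True
    then obtain u where u: "0 < u" "x = \<phi> u" using image by auto
    then show ?thesis using True CU[OF u(1)] D_iff[OF u(1)] by simp
  next
    case False
    then have "x \<notin> D n" for n using DS by blast
    then show ?thesis using False by simp
  qed
  have base: "(\<integral>\<^sup>+x. indicator S x * indicator A x \<partial>lborel) =
      (\<integral>\<^sup>+u. indicator {0<..} u * ennreal (\<phi>' u) * indicator A (\<phi> u) \<partial>lborel)"
    if [measurable]: "A \<in> sets borel" for A :: "real set"
  proof -
    have sub: "(\<integral>\<^sup>+x. indicator A x * indicator (D n) x \<partial>lborel) =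
      (\<integral>\<^sup>+u. indicator {0<..} u * ennreal (\<phi>' u) * indicator A (\<phi> u) * indicator (C n) u \<partial>lborel)" for n
    proof -
      have "(\<integral>\<^sup>+x. indicator A x * indicator (D n) x \<partial>lborel)
          = (\<integral>\<^sup>+x. ennreal (indicator A x * indicator {\<phi> (l n)..\<phi> (r n)} x) \<partial>lborel)"
        by (intro nn_integral_cong) (simp add: D_def indicator_def)
      also have "\<dots> = (\<integral>\<^sup>+u. ennreal (indicator A (\<phi> u) * \<phi>' u * indicator {l n..r n} u) \<partial>lborel)"
      proof (rule nn_integral_substitution[OF _ _ _ _ lr(2)])
        show "set_borel_measurable borel {\<phi> (l n)..\<phi> (r n)} (indicator A :: real \<Rightarrow> real)"
          by (simp add: set_borel_measurable_def)
        show "(\<phi> has_real_derivative \<phi>' x) (at x)" if "x \<in> {l n..r n}" for x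
          using that lr(1)[of n] by (intro deriv) auto
        show "continuous_on {l n..r n} \<phi>'"
          by (rule continuous_on_subset[OF cont]) (use lr(1)[of n] in auto)
        show "0 \<le> \<phi>' x" if "x \<in> {l n..r n}" for x
          using that lr(1)[of n] by (intro nonneg) auto
      qed
      also have "\<dots> = (\<integral>\<^sup>+u. indicator {0<..} u * ennreal (\<phi>' u) * indicator A (\<phi> u) * indicator (C n) u \<partial>lborel)"
      proof (intro nn_integral_cong)
        fix u :: real
        show "ennreal (indicator A (\<phi> u) * \<phi>' u * indicator {l n..r n} u) =
          indicator {0<..} u * ennreal (\<phi>' u) * indicator A (\<phi> u) * indicator (C n) u"
          using lr(1)[of n] by (cases "u \<in> C n") (auto simp: indicator_def C_def)
      qed
      finally show ?thesis .
    qed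
    have "(\<integral>\<^sup>+x. indicator S x * indicator A x \<partial>lborel) = (\<integral>\<^sup>+x. (SUP n. indicator A x * indicator (D n) x) \<partial>lborel)"
      by (intro nn_integral_cong) (simp only: SUP_mult_left_ennreal[symmetric] DU mult.commute)
    also have "\<dots> = (SUP n. \<integral>\<^sup>+x. indicator A x * indicator (D n) x \<partial>lborel)"
    proof (rule nn_integral_monotone_convergence_SUP)
      show "incseq (\<lambda>n x. indicator A x * indicator (D n) x :: ennreal)"
        by (auto simp: incseq_def le_fun_def intro!: mult_left_mono Dmono)
    qed simp
    also have "\<dots> = (SUP n. \<integral>\<^sup>+u. indicator {0<..} u * ennreal (\<phi>' u) * indicator A (\<phi> u) * indicator (C n) u \<partial>lborel)"
      by (simp only: sub)
    also have "\<dots> = (\<integral>\<^sup>+u. (SUP n. indicator {0<..} u * ennreal (\<phi>' u) * indicator A (\<phi> u) * indicator (C n) u) \<partial>lborel)"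
    proof (rule nn_integral_monotone_convergence_SUP[symmetric])
      show "incseq (\<lambda>n u. indicator {0<..} u * ennreal (\<phi>' u) * indicator A (\<phi> u) * indicator (C n) u)"
        by (auto simp: incseq_def le_fun_def intro!: mult_left_mono Cmono)
    qed simp
    also have "\<dots> = (\<integral>\<^sup>+u. indicator {0<..} u * ennreal (\<phi>' u) * indicator A (\<phi> u) \<partial>lborel)"
    proof (intro nn_integral_cong)
      fix u :: real
      show "(SUP n. indicator {0<..} u * ennreal (\<phi>' u) * indicator A (\<phi> u) * indicator (C n) u) =
        indicator {0<..} u * ennreal (\<phi>' u) * indicator A (\<phi> u)"
        unfolding SUP_mult_left_ennreal[symmetric] using CU[of u] by (cases "0 < u") simp_all
    qed
    finally show ?thesis .
  qed
  \<comment> \<open>So far only indicators have been integrated. Read as an equality of measures,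
    the result extends to every \<open>ennreal\<close>-valued \<open>G\<close>.\<close>
  have "density lborel (indicator S) = distr (density lborel (\<lambda>u. indicator {0<..} u * ennreal (\<phi>' u))) borel \<phi>" (is "?M = ?N")
  proof (rule measure_eqI)
    fix A assume "A \<in> sets ?M"
    then have A[measurable]: "A \<in> sets borel" by simp
    show "emeasure ?M A = emeasure ?N A"
      using base[OF A]
      by (simp add: nn_integral_indicator[symmetric] nn_integral_density nn_integral_distr del: nn_integral_indicator)
  qed simp
  then have "(\<integral>\<^sup>+x. G x \<partial>?M) = (\<integral>\<^sup>+x. G x \<partial>?N)" by simp
  then show ?thesis by (simp add: nn_integral_density nn_integral_distr)
qed

lemma nn_integral_powr_subst:
  fixes G :: "real \<Rightarrow> ennreal"
  assumes a: "0 < a" and G: "G \<in> borel_measurable borel"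
  shows "(\<integral>\<^sup>+x. indicator {0<..} x * G x \<partial>lborel) =
    (\<integral>\<^sup>+u. indicator {0<..} u * ennreal (a * u powr (a - 1)) * G (u powr a) \<partial>lborel)"
proof (rule nn_integral_subst_increasing[OF _ _ _ _ _ _ _ _ G])
  show "continuous_on {0<..} (\<lambda>u. a * u powr (a - 1))" by (intro continuous_intros) auto
  show "(\<lambda>u. u powr a) ` {0<..} = {0<..}"
  proof (intro equalityI subsetI)
    fix x :: real assume "x \<in> {0<..}"
    then have "x = (x powr (1 / a)) powr a" "0 < x powr (1 / a)" using a by (simp_all add: powr_powr)
    then show "x \<in> (\<lambda>u. u powr a) ` {0<..}" by blast
  qed auto
qed (use a in \<open>auto intro!: has_real_derivative_powr powr_less_mono2\<close>)

text \<open>The map \<open>1 / u\<close> is decreasing. A reflection is therefore applied first,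
  after which \<open>- 1 / u\<close> is an increasing map of the half-line onto the negative
  reals.\<close>

lemma nn_integral_inverse_subst:
  fixes G :: "real \<Rightarrow> ennreal"
  assumes G [measurable]: "G \<in> borel_measurable borel"
  shows "(\<integral>\<^sup>+x. indicator {0<..} x * G x \<partial>lborel) =
    (\<integral>\<^sup>+u. indicator {0<..} u * ennreal (1 / u ^ 2) * G (1 / u) \<partial>lborel)"
proof -
  have "(\<integral>\<^sup>+x. indicator {0<..} x * G x \<partial>lborel) = (\<integral>\<^sup>+x. indicator {..<0} x * G (- x) \<partial>lborel)"
    by (subst nn_integral_real_affine[of _ "-1" 0]) (auto intro!: nn_integral_cong simp: indicator_def)
  also have "\<dots> = (\<integral>\<^sup>+u. indicator {0<..} u * ennreal (1 / u ^ 2) * G (- (- 1 / u)) \<partial>lborel)"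
  proof (rule nn_integral_subst_increasing)
    show "continuous_on {0<..} (\<lambda>u. 1 / u ^ 2 :: real)" by (intro continuous_intros) auto
    show "((\<lambda>u. - 1 / u) has_real_derivative 1 / u ^ 2) (at u)" if "0 < u" for u :: real
      using that by (auto intro!: derivative_eq_intros simp: power2_eq_square)
    show "(\<lambda>u. - 1 / u) ` {0<..} = {..<0 :: real}"
    proof (intro equalityI subsetI)
      fix x :: real assume "x \<in> {..<0}"
      then have "x = - 1 / (- 1 / x)" "0 < - 1 / x" by (auto simp: zero_less_divide_iff)
      then show "x \<in> (\<lambda>u. - 1 / u) ` {0<..}" by blast
    qed auto
    show "- 1 / u < - 1 / v" if "0 < u" "u < v" for u v :: real
      using that by (auto simp: field_simps)
  qed auto
  finally show ?thesis by simp
qed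

lemma nn_integral_gamma:
  assumes "0 < s" "0 < l"
  shows "(\<integral>\<^sup>+x. indicator {0<..} x * ennreal (x powr (s - 1) * exp (- l * x)) \<partial>lborel) = ennreal (Gamma s * l powr (- s))"
proof -
  have "ennreal (Gamma s) = (\<integral>\<^sup>+t. ennreal (indicator {0..} t * t powr (s - 1) / exp t) \<partial>lborel)"
    using Gamma_conv_nn_integral_real[OF \<open>0 < s\<close>] .
  also have "\<dots> = ennreal \<bar>l\<bar> * (\<integral>\<^sup>+t. ennreal (indicator {0..} (0 + l * t) * (0 + l * t) powr (s - 1) / exp (0 + l * t)) \<partial>lborel)"
    using \<open>0 < l\<close> by (intro nn_integral_real_affine) auto
  also have "\<dots> = ennreal \<bar>l\<bar> * (\<integral>\<^sup>+t. ennreal (l powr (s - 1)) * (indicator {0<..} t * ennreal (t powr (s - 1) * exp (- l * t))) \<partial>lborel)"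
    using \<open>0 < l\<close>
    by (auto intro!: arg_cong2[where f = "(*)"] nn_integral_cong
      simp: indicator_def powr_mult exp_minus field_simps zero_le_mult_iff simp flip: ennreal_mult)
  also have "\<dots> = ennreal (l powr s) * (\<integral>\<^sup>+t. indicator {0<..} t * ennreal (t powr (s - 1) * exp (- l * t)) \<partial>lborel)"
    using \<open>0 < l\<close>
    by (subst nn_integral_cmult) (auto simp: mult.assoc[symmetric] powr_mult_base simp flip: ennreal_mult)
  \<comment> \<open>Multiplying both sides by \<open>l powr (- s)\<close> replaces a cancellation in
    \<open>ennreal\<close>. The same device recurs below with \<open>1 / g\<close> and with
    reciprocals of Gamma values.\<close>
  finally have "ennreal (l powr (- s)) * ennreal (Gamma s) = ennreal (l powr (- s)) *
      (ennreal (l powr s) * (\<integral>\<^sup>+t. indicator {0<..} t * ennreal (t powr (s - 1) * exp (- l * t)) \<partial>lborel))"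
    by simp
  then show ?thesis using \<open>0 < l\<close> Gamma_real_pos[OF \<open>0 < s\<close>]
    by (simp add: mult.assoc[symmetric] powr_add[symmetric] mult.commute flip: ennreal_mult)
qed

text \<open>The Gamma integral after substituting \<open>x = l powr g\<close>. With the exponent
  written as \<open>s * g - 1\<close> the result is a Gamma value at \<open>s\<close>; taking for
  \<open>s\<close> the number of blocks produces the Gamma factor in the numerator of
  \<open>p_PD\<close>.\<close>

lemma nn_integral_gamma_powr:
  assumes "0 < s" "0 < g"
  shows "(\<integral>\<^sup>+l. indicator {0<..} l * ennreal (l powr (s * g - 1) * exp (- (l powr g))) \<partial>lborel) = ennreal (Gamma s / g)"
proof -
  have "ennreal (Gamma s) = (\<integral>\<^sup>+x. indicator {0<..} x * ennreal (x powr (s - 1) * exp (- 1 * x)) \<partial>lborel)"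
    by (subst nn_integral_gamma) (use assms in auto)
  also have "\<dots> = (\<integral>\<^sup>+u. indicator {0<..} u * ennreal (g * u powr (g - 1)) * ennreal ((u powr g) powr (s - 1) * exp (- 1 * u powr g)) \<partial>lborel)"
    by (rule nn_integral_powr_subst) (use assms in auto)
  also have "\<dots> = (\<integral>\<^sup>+u. ennreal g * (indicator {0<..} u * ennreal (u powr (s * g - 1) * exp (- (u powr g)))) \<partial>lborel)"
    using assms
    by (intro nn_integral_cong)
      (auto simp: indicator_def powr_powr mult_ac powr_add[symmetric] algebra_simps simp flip: ennreal_mult)
  also have "\<dots> = ennreal g * (\<integral>\<^sup>+u. indicator {0<..} u * ennreal (u powr (s * g - 1) * exp (- (u powr g))) \<partial>lborel)"
    by (rule nn_integral_cmult) auto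
  finally have "ennreal (1 / g) * ennreal (Gamma s) = ennreal (1 / g) *
      (ennreal g * (\<integral>\<^sup>+u. indicator {0<..} u * ennreal (u powr (s * g - 1) * exp (- (u powr g))) \<partial>lborel))"
    by simp
  then show ?thesis using assms Gamma_real_pos[OF \<open>0 < s\<close>]
    by (simp add: mult.assoc[symmetric] flip: ennreal_mult)
qed

section \<open>Integrals against the stable intensity\<close>

lemma sets_stable_intensity[measurable_cong, simp]: "sets (stable_intensity g) = sets borel"
  by (simp add: stable_intensity_def)

lemma space_stable_intensity[simp]: "space (stable_intensity g) = UNIV"
  by (simp add: stable_intensity_def)

lemma nn_integral_stable_intensity:
  assumes "F \<in> borel_measurable borel" "0 < g" "g < 1"
  shows "(\<integral>\<^sup>+x. F x \<partial>stable_intensity g) =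
    (\<integral>\<^sup>+x. indicator {0<..} x * (ennreal (g / Gamma (1 - g) * x powr (- g - 1)) * F x) \<partial>lborel)"
  using assms unfolding stable_intensity_def
  by (subst nn_integral_density) (auto intro!: nn_integral_cong simp: indicator_def)

lemma AE_stable_intensity_pos: "AE x in stable_intensity g. 0 < x"
  unfolding stable_intensity_def by (subst AE_density) (auto simp: indicator_def)

text \<open>Multiplied by \<open>x ^ m\<close>, the intensity becomes a Gamma integrand of shape
  \<open>m - g\<close>, which is positive because \<open>m\<close> is at least 1 and
  \<open>g\<close> is below 1. The quotient \<open>Gamma (m - g) / Gamma (1 - g)\<close> is the
  source of the rising factorials in \<open>p_PD\<close>.\<close>

lemma nn_integral_stable_moment:
  assumes "0 < g" "g < 1" "0 < m" "0 < l"
  shows "(\<integral>\<^sup>+x. ennreal (x ^ m * exp (- l * x)) \<partial>stable_intensity g) =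
    ennreal (g * pochhammer (1 - g) (m - 1) * l powr (g - real m))"
proof -
  have G: "0 < Gamma (1 - g)" using assms by (intro Gamma_real_pos) auto
  have "(\<integral>\<^sup>+x. ennreal (x ^ m * exp (- l * x)) \<partial>stable_intensity g) =
     (\<integral>\<^sup>+x. ennreal (g / Gamma (1 - g)) * (indicator {0<..} x * ennreal (x powr (real m - g - 1) * exp (- l * x))) \<partial>lborel)"
  proof (subst nn_integral_stable_intensity; (intro nn_integral_cong)?)
    fix x :: real
    have "x powr (- g - 1) * x ^ m = x powr (real m - g - 1)" if "0 < x"
      using that by (simp add: powr_realpow[symmetric] powr_add[symmetric] algebra_simps)
    then show "indicator {0<..} x * (ennreal (g / Gamma (1 - g) * x powr (- g - 1)) * ennreal (x ^ m * exp (- l * x))) =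
      ennreal (g / Gamma (1 - g)) * (indicator {0<..} x * ennreal (x powr (real m - g - 1) * exp (- l * x)))"
      using G assms by (cases "0 < x") (auto simp: indicator_def mult.assoc[symmetric] simp flip: ennreal_mult)
  qed (use assms in auto)
  also have "\<dots> = ennreal (g / Gamma (1 - g)) * ennreal (Gamma (real m - g) * l powr (- (real m - g)))"
    by (subst nn_integral_cmult, simp, subst nn_integral_gamma) (use assms in auto)
  also have "\<dots> = ennreal (g / Gamma (1 - g) * (Gamma (real m - g) * l powr (g - real m)))"
    using assms G by (subst ennreal_mult) (auto intro: less_imp_le[OF Gamma_real_pos])
  also have "pochhammer (1 - g) (m - 1) = Gamma (real m - g) / Gamma (1 - g)"
    using assms by (subst pochhammer_Gamma) (auto simp: of_nat_diff algebra_simps dest!: nonpos_Ints_nonpos)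
  then have "g / Gamma (1 - g) * (Gamma (real m - g) * l powr (g - real m)) = g * pochhammer (1 - g) (m - 1) * l powr (g - real m)"
    by simp
  finally show ?thesis .
qed

text \<open>The Levy exponent of the stable law. Writing \<open>1 - exp (- l * x)\<close> as the
  integral of \<open>x * exp (- u * x)\<close> over \<open>u\<close> in \<open>{0..l}\<close> and
  exchanging the integrals reduces it to the first tilted moment
  \<open>g * u powr (g - 1)\<close>.\<close>

lemma nn_integral_stable_exponent:
  assumes "0 < g" "g < 1" "0 \<le> l"
  shows "(\<integral>\<^sup>+x. ennreal (1 - exp (- l * x)) \<partial>stable_intensity g) = ennreal (l powr g)"
proof -
  have FTC: "(\<integral>\<^sup>+u. ennreal (x * exp (- u * x)) * indicator {0..l} u \<partial>lborel) = ennreal (1 - exp (- l * x))" if "0 < x" for x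
  proof -
    have "(\<integral>\<^sup>+u. ennreal (x * exp (- u * x)) * indicator {0..l} u \<partial>lborel) = ennreal (- exp (- l * x) - (- exp (- 0 * x)))"
    proof (rule nn_integral_FTC_Icc)
      show "((\<lambda>u. - exp (- u * x)) has_real_derivative x * exp (- u * x)) (at u)" for u
        by (auto intro!: derivative_eq_intros)
    qed (use that assms in auto)
    then show ?thesis by simp
  qed
  have "(\<integral>\<^sup>+x. ennreal (1 - exp (- l * x)) \<partial>stable_intensity g) =
    (\<integral>\<^sup>+x. (\<integral>\<^sup>+u. indicator {0..l} u * (indicator {0<..} x * (ennreal (g / Gamma (1 - g) * x powr (- g - 1)) * ennreal (x * exp (- u * x)))) \<partial>lborel) \<partial>lborel)"
  proof (subst nn_integral_stable_intensity; (intro nn_integral_cong)?)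
    fix x :: real
    have "(\<integral>\<^sup>+u. indicator {0..l} u * (indicator {0<..} x * (ennreal (g / Gamma (1 - g) * x powr (- g - 1)) * ennreal (x * exp (- u * x)))) \<partial>lborel)
      = (\<integral>\<^sup>+u. (indicator {0<..} x * ennreal (g / Gamma (1 - g) * x powr (- g - 1))) * (ennreal (x * exp (- u * x)) * indicator {0..l} u) \<partial>lborel)"
      by (simp only: mult_ac)
    also have "\<dots> = (indicator {0<..} x * ennreal (g / Gamma (1 - g) * x powr (- g - 1))) * (\<integral>\<^sup>+u. ennreal (x * exp (- u * x)) * indicator {0..l} u \<partial>lborel)"
      by (rule nn_integral_cmult) simp
    finally show "indicator {0<..} x * (ennreal (g / Gamma (1 - g) * x powr (- g - 1)) * ennreal (1 - exp (- l * x))) =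
        (\<integral>\<^sup>+u. indicator {0..l} u * (indicator {0<..} x * (ennreal (g / Gamma (1 - g) * x powr (- g - 1)) * ennreal (x * exp (- u * x)))) \<partial>lborel)"
      using FTC[of x] by (cases "0 < x") (simp_all add: mult.assoc)
  qed (use assms in auto)
  also have "\<dots> = (\<integral>\<^sup>+u. (\<integral>\<^sup>+x. indicator {0..l} u * (indicator {0<..} x * (ennreal (g / Gamma (1 - g) * x powr (- g - 1)) * ennreal (x * exp (- u * x)))) \<partial>lborel) \<partial>lborel)"
    by (rule lborel_pair.Fubini'[symmetric]) measurable
  also have "\<dots> = (\<integral>\<^sup>+u. indicator {0..l} u * (\<integral>\<^sup>+x. ennreal (x ^ 1 * exp (- u * x)) \<partial>stable_intensity g) \<partial>lborel)"
    by (subst nn_integral_stable_intensity) (use assms in \<open>auto simp: nn_integral_cmult intro!: nn_integral_cong\<close>)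
  \<comment> \<open>The condition \<open>u \<le> l\<close> is rewritten through
    \<open>u powr g\<close>, so that the power substitution leaves the length of an interval. The
    point \<open>u = 0\<close> is discarded as a null set.\<close>
  also have "\<dots> = (\<integral>\<^sup>+u. indicator {0<..} u * ennreal (g * u powr (g - 1)) * indicator {..l powr g} (u powr g) \<partial>lborel)"
  proof (rule nn_integral_cong_AE)
    have "u \<le> l \<longleftrightarrow> u powr g \<le> l powr g" if "0 < u" for u
      using powr_mono2[of g u l] powr_less_mono2[of g l u] assms that by linarith
    then show "AE u in lborel. indicator {0..l} u * (\<integral>\<^sup>+x. ennreal (x ^ 1 * exp (- u * x)) \<partial>stable_intensity g) =
        indicator {0<..} u * ennreal (g * u powr (g - 1)) * indicator {..l powr g} (u powr g)"
      using AE_lborel_singleton[of 0] nn_integral_stable_moment[of g 1] assms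
      by (auto simp: indicator_def elim!: eventually_mono)
  qed
  also have "\<dots> = (\<integral>\<^sup>+x. indicator {0<..} x * indicator {..l powr g} x \<partial>lborel)"
    by (rule nn_integral_powr_subst[symmetric]) (use assms in auto)
  also have "\<dots> = (\<integral>\<^sup>+x. indicator {0<..l powr g} x \<partial>lborel)"
    by (intro nn_integral_cong) (auto simp: indicator_def)
  also have "\<dots> = ennreal (l powr g)" by simp
  finally show ?thesis .
qed

text \<open>Differentiation under the integral, from the right because the tilt is controlled only
  for \<open>t \<ge> 0\<close>. Only the sum of \<open>k\<close> and \<open>h\<close> is assumed
  integrable: for \<open>1 - exp (- \<phi> x)\<close> under an intensity of infinite mass neither
  term is integrable by itself.\<close>

lemma has_right_derivative_exp_tilt:
  fixes h k s :: "'a \<Rightarrow> real"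
  assumes [measurable]: "h \<in> borel_measurable M" "k \<in> borel_measurable M" "s \<in> borel_measurable M"
    and s: "AE x in M. 0 \<le> s x"
    and int: "integrable M (\<lambda>x. k x + h x)" "integrable M (\<lambda>x. h x * s x)"
  shows "((\<lambda>t. LINT x|M. k x + h x * exp (- t * s x)) has_real_derivative - (LINT x|M. h x * s x)) (at 0 within {0..})"
proof -
  \<comment> \<open>Uniform in \<open>t\<close>, so the absolute value of \<open>h x * s x\<close>
    dominates all difference quotients at once.\<close>
  have bound: "\<bar>(exp (- t * u) - 1) / t\<bar> \<le> u" if "0 < t" "0 \<le> u" for t u :: real
  proof -
    have "1 - t * u \<le> exp (- t * u)" using exp_ge_add_one_self[of "- t * u"] by simp
    moreover have "exp (- t * u) \<le> 1" using that by simp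
    ultimately have "\<bar>exp (- t * u) - 1\<bar> \<le> t * u" by linarith
    then show ?thesis using that by (simp add: abs_divide field_simps)
  qed
  have it: "integrable M (\<lambda>x. k x + h x * exp (- t * s x))" if "0 < t" for t
  proof -
    have "integrable M (\<lambda>x. h x * (exp (- t * s x) - 1))"
    proof (rule Bochner_Integration.integrable_bound)
      show "integrable M (\<lambda>x. t * (h x * s x))" using int by simp
      show "AE x in M. norm (h x * (exp (- t * s x) - 1)) \<le> norm (t * (h x * s x))"
        using s
      proof eventually_elim
        case (elim x)
        have "\<bar>exp (- t * s x) - 1\<bar> \<le> t * s x" using bound[OF that elim] that by (simp add: abs_divide field_simps)
        then have "\<bar>h x\<bar> * \<bar>exp (- t * s x) - 1\<bar> \<le> \<bar>h x\<bar> * (t * s x)" by (rule mult_left_mono) simp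
        then show ?case using that elim by (simp add: abs_mult mult_ac)
      qed
    qed measurable
    from Bochner_Integration.integrable_add[OF int(1) this] show ?thesis by (simp add: algebra_simps)
  qed
  show ?thesis
    unfolding has_field_derivative_iff tendsto_at_iff_sequentially comp_def
  proof (intro allI impI)
    fix X :: "nat \<Rightarrow> real" assume X: "\<forall>i. X i \<in> {0..} - {0}" "X \<longlonglongrightarrow> 0"
    have Xpos: "0 < X i" for i using X(1) by (simp add: less_le)
    have lim: "(\<lambda>i. (exp (- X i * u) - 1) / X i) \<longlonglongrightarrow> - u" for u :: real
    proof -
      have "((\<lambda>t. exp (- t * u)) has_real_derivative - u) (at 0)"
        by (auto intro!: derivative_eq_intros)
      then have "((\<lambda>t. (exp (- t * u) - 1) / t) \<longlongrightarrow> - u) (at 0)"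
        by (simp add: has_field_derivative_iff)
      then show ?thesis
        unfolding tendsto_at_iff_sequentially comp_def using X Xpos by (auto simp: less_imp_neq[symmetric])
    qed
    have quot: "((LINT x|M. k x + h x * exp (- X i * s x)) - (LINT x|M. k x + h x * exp (- 0 * s x))) / (X i - 0)
        = (LINT x|M. h x * ((exp (- X i * s x) - 1) / X i))" for i
    proof -
      have "(LINT x|M. k x + h x * exp (- X i * s x)) - (LINT x|M. k x + h x)
          = (LINT x|M. (k x + h x * exp (- X i * s x)) - (k x + h x))"
        by (rule Bochner_Integration.integral_diff[OF it[OF Xpos] int(1), symmetric])
      also have "\<dots> = (LINT x|M. X i * (h x * ((exp (- X i * s x) - 1) / X i)))"
        by (intro Bochner_Integration.integral_cong refl) (use Xpos[of i] in \<open>simp add: field_simps\<close>)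
      also have "\<dots> = X i * (LINT x|M. h x * ((exp (- X i * s x) - 1) / X i))"
        by (rule integral_mult_right_zero)
      finally show ?thesis using Xpos[of i] by simp
    qed
    have "(\<lambda>i. LINT x|M. h x * ((exp (- X i * s x) - 1) / X i)) \<longlonglongrightarrow> (LINT x|M. h x * (- s x))"
    proof (rule integral_dominated_convergence[where w = "\<lambda>x. \<bar>h x * s x\<bar>"])
      show "AE x in M. (\<lambda>i. h x * ((exp (- X i * s x) - 1) / X i)) \<longlonglongrightarrow> h x * (- s x)"
        by (intro AE_I2 tendsto_mult_left lim)
      show "AE x in M. norm (h x * ((exp (- X i * s x) - 1) / X i)) \<le> \<bar>h x * s x\<bar>" for i
        using s
      proof eventually_elim
        case (elim x)
        show ?case using mult_left_mono[OF bound[OF Xpos[of i] elim], of "\<bar>h x\<bar>"] elim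
          by (simp add: abs_mult)
      qed
    qed (use int in auto)
    then show "(\<lambda>i. ((LINT x|M. k x + h x * exp (- X i * s x)) - (LINT x|M. k x + h x * exp (- 0 * s x))) / (X i - 0))
        \<longlonglongrightarrow> - (LINT x|M. h x * s x)"
      unfolding quot by simp
  qed
qed

section \<open>The Laplace functional of Poisson points\<close>

text \<open>The function \<open>exp (- x)\<close> continued by 0 at infinity. It lets the Laplace
  functional be stated before the sum over the points is known to be finite; finiteness is in fact
  deduced from it in \<open>AE_summable\<close>.\<close>

definition lexp :: "ennreal \<Rightarrow> real" where
  "lexp x = (if x = \<infinity> then 0 else exp (- enn2real x))"

lemma lexp_ennreal: "0 \<le> c \<Longrightarrow> lexp (ennreal c) = exp (- c)"
  by (simp add: lexp_def)

lemma lexp_bounds: "0 \<le> lexp x" "lexp x \<le> 1"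
  by (auto simp: lexp_def)

lemma lexp_0 [simp]: "lexp 0 = 1"
  by (simp add: lexp_def)

lemma lexp_top [simp]: "lexp top = 0"
  by (simp add: lexp_def)

lemma lexp_measurable [measurable]: "lexp \<in> borel_measurable borel"
  unfolding lexp_def by measurable

lemma lexp_add: "lexp (x + y) = lexp x * lexp y"
  by (cases x; cases y) (auto simp: lexp_ennreal exp_add[symmetric] simp flip: ennreal_plus)

lemma lexp_sum: "finite A \<Longrightarrow> lexp (\<Sum>i\<in>A. g i) = (\<Prod>i\<in>A. lexp (g i))"
  by (induction A rule: finite_induct) (auto simp: lexp_add)

lemma lexp_antimono: "x \<le> y \<Longrightarrow> lexp y \<le> lexp x"
  by (cases x; cases y) (auto simp: lexp_ennreal lexp_bounds top_unique)

lemma tendsto_lexp: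
  assumes "(u \<longlongrightarrow> x) F"
  shows "((\<lambda>i. lexp (u i)) \<longlongrightarrow> lexp x) F"
proof (cases x)
  case (real r)
  then have "\<forall>\<^sub>F i in F. u i < top" using assms by (intro order_tendstoD) auto
  then have ev: "\<forall>\<^sub>F i in F. lexp (u i) = exp (- enn2real (u i))"
    by eventually_elim (simp add: lexp_def)
  have "((\<lambda>i. exp (- enn2real (u i))) \<longlongrightarrow> exp (- r)) F"
    using assms real by (intro tendsto_intros) auto
  then show ?thesis
    using real by (simp add: tendsto_cong[OF ev] lexp_ennreal)
next
  case top
  show ?thesis
  proof (rule tendstoI)
    fix e :: real assume "0 < e"
    \<comment> \<open>Chosen so that \<open>exp (- c)\<close> lies below \<open>e\<close>; the
      maximum with 0 keeps \<open>c\<close> faithful under \<open>ennreal\<close>.\<close>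
    define c where "c = max 0 (1 - ln e)"
    have "0 \<le> c" by (simp add: c_def)
    have "\<forall>\<^sub>F i in F. ennreal c < u i" using assms top by (intro order_tendstoD) auto
    then show "\<forall>\<^sub>F i in F. dist (lexp (u i)) (lexp x) < e"
    proof eventually_elim
      case (elim i)
      then have "lexp (u i) \<le> exp (- c)"
        using lexp_antimono[of "ennreal c" "u i"] lexp_ennreal[OF \<open>0 \<le> c\<close>] by simp
      also have "\<dots> < exp (ln e)" unfolding c_def by simp
      finally show ?case using \<open>0 < e\<close> top lexp_bounds[of "u i"] by simp
    qed
  qed
qed

text \<open>The Poisson masses add up to 1, so the events \<open>N = m\<close> cover the space up to
  a null set and an expectation becomes a series. Since \<open>N\<close> is
  \<open>ennreal\<close>-valued, its finiteness is part of the conclusion.\<close>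

lemma poisson_count:
  fixes N :: "'a \<Rightarrow> ennreal"
  assumes "prob_space M" and [measurable]: "N \<in> borel_measurable M" and "0 \<le> a"
    and N: "\<And>m. measure M {\<omega> \<in> space M. N \<omega> = of_nat m} = exp (- a) * a ^ m / fact m"
  shows "AE \<omega> in M. \<exists>m. N \<omega> = of_nat m"
    and "h \<in> borel_measurable borel \<Longrightarrow>
      (\<integral>\<^sup>+\<omega>. h (N \<omega>) \<partial>M) = (\<Sum>m. h (of_nat m) * ennreal (exp (- a) * a ^ m / fact m))"
proof -
  interpret prob_space M by fact
  define E where "E m = {\<omega> \<in> space M. N \<omega> = of_nat m}" for m
  have E [measurable]: "E m \<in> sets M" for m unfolding E_def by measurable
  have disj: "disjoint_family E" by (auto simp: disjoint_family_on_def E_def)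
  have emE: "emeasure M (E m) = ennreal (exp (- a) * a ^ m / fact m)" for m
    using N by (simp add: E_def emeasure_eq_measure)
  have "(\<lambda>m. exp (- a) * (a ^ m / fact m)) sums (exp (- a) * exp a)"
    using exp_converges[of a] by (intro sums_mult) (simp add: divide_inverse mult.commute)
  then have sums: "(\<lambda>m. exp (- a) * a ^ m / fact m) sums 1"
    by (simp add: exp_add[symmetric])
  have "emeasure M (\<Union>m. E m) = (\<Sum>m. emeasure M (E m))"
    by (rule suminf_emeasure[OF _ disj, symmetric]) (use E in auto)
  also have "\<dots> = ennreal 1"
    unfolding emE using \<open>0 \<le> a\<close> by (intro suminf_ennreal_eq sums) auto
  finally have "prob (\<Union>m. E m) = 1" by (simp add: measure_def)
  then have "AE \<omega> in M. \<omega> \<in> (\<Union>m. E m)"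
    by (subst prob_eq_1[symmetric]) auto
  then show ae: "AE \<omega> in M. \<exists>m. N \<omega> = of_nat m"
    by eventually_elim (auto simp: E_def)
  assume [measurable]: "h \<in> borel_measurable borel"
  have "(\<integral>\<^sup>+\<omega>. h (N \<omega>) \<partial>M) = (\<integral>\<^sup>+\<omega>. (\<Sum>m. h (of_nat m) * indicator (E m) \<omega>) \<partial>M)"
  proof (rule nn_integral_cong_AE, use ae AE_space in eventually_elim)
    case (elim \<omega>)
    then obtain m where m: "N \<omega> = of_nat m" by auto
    have "(\<Sum>l. h (of_nat l) * indicator (E l) \<omega>) = (\<Sum>l\<in>{m}. h (of_nat l) * indicator (E l) \<omega>)"
      using m elim by (intro suminf_finite) (auto simp: E_def indicator_def)
    then show ?case using m elim by (simp add: E_def)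
  qed
  also have "\<dots> = (\<Sum>m. h (of_nat m) * emeasure M (E m))"
    by (subst nn_integral_suminf) (auto simp: nn_integral_cmult)
  finally show "(\<integral>\<^sup>+\<omega>. h (N \<omega>) \<partial>M) = (\<Sum>m. h (of_nat m) * ennreal (exp (- a) * a ^ m / fact m))"
    by (simp add: emE)
qed

lemma poisson_count_lexp:
  fixes N :: "'a \<Rightarrow> ennreal"
  assumes "prob_space M" "N \<in> borel_measurable M" "0 \<le> a" "0 \<le> c"
    and N: "\<And>m. measure M {\<omega> \<in> space M. N \<omega> = of_nat m} = exp (- a) * a ^ m / fact m"
  shows "(\<integral>\<^sup>+\<omega>. ennreal (lexp (ennreal c * N \<omega>)) \<partial>M) = ennreal (exp (- (1 - exp (- c)) * a))"
proof -
  have "(\<integral>\<^sup>+\<omega>. ennreal (lexp (ennreal c * N \<omega>)) \<partial>M)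
     = (\<Sum>m. ennreal (lexp (ennreal c * of_nat m)) * ennreal (exp (- a) * a ^ m / fact m))"
    by (rule poisson_count(2)[OF assms(1-3) N]) measurable
  also have "\<dots> = (\<Sum>m. ennreal (exp (- a) * ((a * exp (- c)) ^ m / fact m)))"
  proof (rule arg_cong[where f = suminf], rule ext)
    fix m
    have "lexp (ennreal c * of_nat m) = exp (- c) ^ m"
      using \<open>0 \<le> c\<close> by (simp add: ennreal_of_nat_eq_real_of_nat lexp_ennreal exp_of_nat_mult[symmetric] mult.commute
        flip: ennreal_mult)
    then show "ennreal (lexp (ennreal c * of_nat m)) * ennreal (exp (- a) * a ^ m / fact m)
       = ennreal (exp (- a) * ((a * exp (- c)) ^ m / fact m))"
      using \<open>0 \<le> a\<close> by (simp add: power_mult_distrib mult_ac flip: ennreal_mult)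
  qed
  also have "\<dots> = ennreal (exp (- a) * exp (a * exp (- c)))"
    using \<open>0 \<le> a\<close> exp_converges[of "a * exp (- c)"]
    by (intro suminf_ennreal_eq sums_mult) (simp_all add: divide_inverse mult.commute)
  also have "exp (- a) * exp (a * exp (- c)) = exp (- (1 - exp (- c)) * a)"
    by (simp add: exp_add[symmetric] algebra_simps)
  finally show ?thesis .
qed

text \<open>For a simple function the sum over the points is a finite combination of the counts in
  its level sets. These sets are disjoint and of finite intensity, so the counts are independent
  Poisson variables and the expectation factorizes.\<close>

lemma laplace_functional_simple:
  assumes M: "prob_space M" and J: "poisson_points M \<Lambda> J" and sets: "sets \<Lambda> = sets borel"
    and F: "simple_function borel F" "\<And>x. F x < top" "emeasure \<Lambda> {x. F x \<noteq> 0} < \<infinity>"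
  shows "(\<integral>\<^sup>+\<omega>. ennreal (lexp (\<Sum>i. F (J i \<omega>))) \<partial>M) = ennreal (lexp (\<integral>\<^sup>+x. ennreal (1 - lexp (F x)) \<partial>\<Lambda>))"
proof -
  interpret prob_space M by fact
  note [measurable_cong] = sets
  have [measurable]: "F \<in> borel_measurable borel" using F(1) by (rule borel_measurable_simple_function)
  have [measurable]: "J i \<in> borel_measurable M" for i using J by (simp add: poisson_points_def)
  \<comment> \<open>The value 0 is removed because its level set may have infinite intensity, where
    the count has no Poisson law.\<close>
  define V where "V = range F - {0}"
  have "finite V" using F(1) by (auto simp: V_def simple_function_def)
  then obtain v where v: "bij_betw v {0..<card V} V" using ex_bij_betw_nat_finite by blast
  define r where "r = card V"
  have v: "bij_betw v {..<r} V" using v by (simp add: r_def lessThan_atLeast0)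
  define A where "A l = {x. F x = v l}" for l
  have A [measurable]: "A l \<in> sets borel" for l unfolding A_def by measurable
  have vV: "v l \<in> V" if "l < r" for l using v that by (auto simp: bij_betw_def)
  have vtop: "v l < top" "v l \<noteq> 0" if "l < r" for l using vV[OF that] F(2) by (auto simp: V_def)
  define c where "c l = enn2real (v l)" for l
  have c: "v l = ennreal (c l)" "0 \<le> c l" if "l < r" for l using vtop[OF that] by (simp_all add: c_def)
  have decomp: "F x = (\<Sum>l<r. v l * indicator (A l) x)" for x
  proof (cases "F x = 0")
    case True
    then show ?thesis using vtop by (auto simp: A_def indicator_def intro!: sum.neutral[symmetric])
  next
    case False
    then obtain l where l: "l < r" "v l = F x" using v by (auto simp: bij_betw_def V_def) (metis DiffI imageE lessThan_iff rangeI singletonD)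
    have "(\<Sum>k<r. v k * indicator (A k) x) = (\<Sum>k\<in>{l}. v k * indicator (A k) x)"
    proof (rule sum.mono_neutral_right)
      show "\<forall>k\<in>{..<r} - {l}. v k * indicator (A k) x = 0"
        using v l by (auto simp: A_def indicator_def bij_betw_def inj_on_def)
    qed (use l in auto)
    then show ?thesis using l by (simp add: A_def)
  qed
  have fin: "emeasure \<Lambda> (A l) < \<infinity>" if "l < r" for l
    using F(3) vtop[OF that] by (elim le_less_trans[rotated], intro emeasure_mono) (auto simp: A_def)
  define N where "N l = num_points J (A l)" for l
  have Nm [measurable]: "N l \<in> borel_measurable M" for l
    unfolding N_def num_points_def by measurable
  have "disjoint_family_on A {..<r}"
    using v by (auto simp: A_def bij_betw_def inj_on_def disjoint_family_on_def)
  then have "indep_vars (\<lambda>_. borel) N {..<r}"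
    using J A unfolding N_def poisson_points_def by blast
  then have ind: "indep_vars (\<lambda>_. borel) (\<lambda>l \<omega>. ennreal (lexp (v l * N l \<omega>))) {..<r}"
    by (rule indep_vars_compose2) measurable
  have "(\<Sum>i. F (J i \<omega>)) = (\<Sum>l<r. v l * N l \<omega>)" for \<omega>
  proof -
    have "(\<Sum>i. F (J i \<omega>)) = (\<Sum>i. \<Sum>l<r. v l * indicator (A l) (J i \<omega>))"
      by (subst decomp) simp
    also have "\<dots> = (\<Sum>l<r. \<Sum>i. v l * indicator (A l) (J i \<omega>))"
      by (rule suminf_sum) auto
    finally show ?thesis by (simp add: N_def num_points_def)
  qed
  then have "(\<integral>\<^sup>+\<omega>. ennreal (lexp (\<Sum>i. F (J i \<omega>))) \<partial>M) = (\<integral>\<^sup>+\<omega>. (\<Prod>l<r. ennreal (lexp (v l * N l \<omega>))) \<partial>M)"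
    by (simp add: lexp_sum prod_ennreal lexp_bounds)
  also have "\<dots> = (\<Prod>l<r. \<integral>\<^sup>+\<omega>. ennreal (lexp (v l * N l \<omega>)) \<partial>M)"
    by (rule indep_vars_nn_integral[OF _ ind]) auto
  also have "\<dots> = (\<Prod>l<r. ennreal (exp (- (1 - exp (- c l)) * measure \<Lambda> (A l))))"
  proof (rule prod.cong[OF refl])
    fix l assume "l \<in> {..<r}"
    then have l: "l < r" by simp
    show "(\<integral>\<^sup>+\<omega>. ennreal (lexp (v l * N l \<omega>)) \<partial>M) = ennreal (exp (- (1 - exp (- c l)) * measure \<Lambda> (A l)))"
      unfolding c(1)[OF l] using c(2)[OF l] J fin[OF l]
      by (intro poisson_count_lexp M Nm) (auto simp: poisson_points_def N_def)
  qed
  also have "\<dots> = ennreal (exp (- (\<Sum>l<r. (1 - exp (- c l)) * measure \<Lambda> (A l))))"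
  proof -
    have "- (\<Sum>l<r. (1 - exp (- c l)) * measure \<Lambda> (A l)) = (\<Sum>l<r. - (1 - exp (- c l)) * measure \<Lambda> (A l))"
      by (simp only: sum_negf[symmetric] mult_minus_left)
    then show ?thesis by (simp only: prod_ennreal exp_ge_zero exp_sum finite_lessThan)
  qed
  also have "\<dots> = ennreal (lexp (ennreal (\<Sum>l<r. (1 - exp (- c l)) * measure \<Lambda> (A l))))"
    using c(2) by (subst lexp_ennreal) (auto intro!: sum_nonneg)
  also have "ennreal (\<Sum>l<r. (1 - exp (- c l)) * measure \<Lambda> (A l)) = (\<Sum>l<r. ennreal (1 - exp (- c l)) * emeasure \<Lambda> (A l))"
    using c(2) fin by (subst sum_ennreal[symmetric]) (auto intro!: sum.cong simp: ennreal_mult emeasure_eq_ennreal_measure less_top)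
  also have "\<dots> = (\<integral>\<^sup>+x. (\<Sum>l<r. ennreal (1 - exp (- c l)) * indicator (A l) x) \<partial>\<Lambda>)"
    by (subst nn_integral_sum) (auto simp: nn_integral_cmult sets)
  also have "\<dots> = (\<integral>\<^sup>+x. ennreal (1 - lexp (F x)) \<partial>\<Lambda>)"
  proof (rule nn_integral_cong)
    fix x
    show "(\<Sum>l<r. ennreal (1 - exp (- c l)) * indicator (A l) x) = ennreal (1 - lexp (F x))"
    proof (cases "F x = 0")
      case True
      then show ?thesis using vtop by (auto simp: A_def indicator_def intro!: sum.neutral)
    next
      case False
      then have "F x \<in> v ` {..<r}" using v by (simp add: bij_betw_def V_def)
      then obtain l where l: "l < r" "F x = v l" by auto
      have "(\<Sum>k<r. ennreal (1 - exp (- c k)) * indicator (A k) x) = (\<Sum>k\<in>{l}. ennreal (1 - exp (- c k)) * indicator (A k) x)"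
      proof (rule sum.mono_neutral_right)
        show "\<forall>k\<in>{..<r} - {l}. ennreal (1 - exp (- c k)) * indicator (A k) x = 0"
          using v l by (auto simp: A_def indicator_def bij_betw_def inj_on_def)
      qed (use l in auto)
      then show ?thesis using l c[OF l(1)] by (simp add: A_def lexp_ennreal)
    qed
  qed
  finally show ?thesis .
qed

text \<open>Simple functions cut off to sets of finite intensity increase to \<open>F\<close>. The
  left side converges by domination by 1, and the exponent on the right by monotone convergence,
  since \<open>1 - lexp\<close> is increasing.\<close>

lemma laplace_functional:
  assumes M: "prob_space M" and J: "poisson_points M \<Lambda> J" and sets: "sets \<Lambda> = sets borel"
    and "sigma_finite_measure \<Lambda>" and F [measurable]: "F \<in> borel_measurable borel"
  shows "(\<integral>\<^sup>+\<omega>. ennreal (lexp (\<Sum>i. F (J i \<omega>))) \<partial>M) = ennreal (lexp (\<integral>\<^sup>+x. ennreal (1 - lexp (F x)) \<partial>\<Lambda>))"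
proof -
  interpret prob_space M by fact
  interpret \<Lambda>: sigma_finite_measure \<Lambda> by fact
  note [measurable_cong] = sets
  have space: "space \<Lambda> = UNIV" using sets_eq_imp_space_eq[OF sets] by simp
  have [measurable]: "J i \<in> borel_measurable M" for i using J by (simp add: poisson_points_def)
  obtain B :: "nat \<Rightarrow> real set" where B: "range B \<subseteq> sets \<Lambda>" "(\<Union>i. B i) = space \<Lambda>"
      "\<And>i. emeasure \<Lambda> (B i) \<noteq> \<infinity>" "incseq B"
    using \<Lambda>.sigma_finite_incseq by blast
  have Bm [measurable]: "B i \<in> sets borel" for i using B(1) sets by auto
  obtain f where f: "\<And>i. simple_function borel (f i)" "incseq f" "\<And>i x. f i x < top" "\<And>x. (SUP i. f i x) = F x"
    using borel_measurable_implies_simple_function_sequence'[OF F] by metis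
  define G where "G i x = f i x * indicator (B i) x" for i x
  have G: "simple_function borel (G i)" for i
    unfolding G_def by (intro simple_function_mult f simple_function_indicator) simp
  have Gm [measurable]: "G i \<in> borel_measurable borel" for i using G by (rule borel_measurable_simple_function)
  have Ginc: "G i x \<le> G j x" if "i \<le> j" for i j x
    unfolding G_def using incseqD[OF f(2) that] incseqD[OF B(4) that]
    by (auto simp: le_fun_def indicator_def)
  have Glim: "(\<lambda>i. G i x) \<longlonglongrightarrow> F x" for x
  proof -
    obtain i where i: "x \<in> B i" using B(2) space by auto
    have "\<forall>\<^sub>F j in sequentially. f j x = G j x"
      using eventually_ge_at_top[of i]
    proof eventually_elim
      case (elim j)
      then show ?case using incseqD[OF B(4) elim] i by (auto simp: G_def)
    qed
    moreover have "(\<lambda>j. f j x) \<longlonglongrightarrow> F x"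
      using LIMSEQ_SUP[of "\<lambda>j. f j x"] f(2) by (simp add: f(4) incseq_def le_fun_def)
    ultimately show ?thesis by (rule Lim_transform_eventually[rotated])
  qed
  have Gsup: "(SUP i. G i x) = F x" for x
    using LIMSEQ_SUP[of "\<lambda>j. G j x"] Glim[of x] Ginc by (intro LIMSEQ_unique) (auto simp: incseq_def)
  have sumlim: "(\<lambda>i. \<Sum>k. G i (J k \<omega>)) \<longlonglongrightarrow> (\<Sum>k. F (J k \<omega>))" for \<omega>
  proof -
    have "(\<Sum>k. F (J k \<omega>)) = (SUP i. \<Sum>k. G i (J k \<omega>))"
      unfolding Gsup[symmetric] by (rule ennreal_suminf_SUP_eq) (auto simp: incseq_def Ginc)
    then show ?thesis
      using LIMSEQ_SUP[of "\<lambda>i. \<Sum>k. G i (J k \<omega>)"] by (auto simp: incseq_def intro!: suminf_le Ginc)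
  qed
  have "(\<lambda>i. \<integral>\<^sup>+\<omega>. ennreal (lexp (\<Sum>k. G i (J k \<omega>))) \<partial>M) \<longlonglongrightarrow> (\<integral>\<^sup>+\<omega>. ennreal (lexp (\<Sum>k. F (J k \<omega>))) \<partial>M)"
  proof (rule nn_integral_dominated_convergence[where w = "\<lambda>_. 1"])
    show "AE \<omega> in M. (\<lambda>i. ennreal (lexp (\<Sum>k. G i (J k \<omega>)))) \<longlonglongrightarrow> ennreal (lexp (\<Sum>k. F (J k \<omega>)))"
      by (intro AE_I2 tendsto_ennrealI tendsto_lexp sumlim)
  qed (auto simp: lexp_bounds emeasure_space_1)
  moreover have "(\<lambda>i. ennreal (lexp (\<integral>\<^sup>+x. ennreal (1 - lexp (G i x)) \<partial>\<Lambda>))) \<longlonglongrightarrow> ennreal (lexp (\<integral>\<^sup>+x. ennreal (1 - lexp (F x)) \<partial>\<Lambda>))"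
  proof (rule tendsto_ennrealI, rule tendsto_lexp, rule nn_integral_LIMSEQ)
    show "incseq (\<lambda>i x. ennreal (1 - lexp (G i x)))"
      by (auto simp: incseq_def le_fun_def intro!: ennreal_leI lexp_antimono Ginc)
    show "(\<lambda>i. ennreal (1 - lexp (G i x))) \<longlonglongrightarrow> ennreal (1 - lexp (F x))" for x
      by (intro tendsto_ennrealI tendsto_diff tendsto_const tendsto_lexp Glim)
  qed measurable
  moreover have "(\<integral>\<^sup>+\<omega>. ennreal (lexp (\<Sum>k. G i (J k \<omega>))) \<partial>M) = ennreal (lexp (\<integral>\<^sup>+x. ennreal (1 - lexp (G i x)) \<partial>\<Lambda>))" for i
  proof (rule laplace_functional_simple[OF M J sets G])
    show "G i x < top" for x using f(3) by (auto simp: G_def indicator_def)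
    have "{x. G i x \<noteq> 0} \<subseteq> B i" by (auto simp: G_def indicator_def split: if_splits)
    then show "emeasure \<Lambda> {x. G i x \<noteq> 0} < \<infinity>"
      using B(3)[of i] emeasure_mono[of "{x. G i x \<noteq> 0}" "B i" \<Lambda>] sets by (auto simp: less_top[symmetric] top_unique)
  qed
  ultimately show ?thesis by (simp add: LIMSEQ_unique)
qed

lemma sigma_finite_stable_intensity: "sigma_finite_measure (stable_intensity g)"
  unfolding stable_intensity_def
  by (subst sigma_finite_measure.sigma_finite_iff_density_finite[OF sigma_finite_lborel]) auto

section \<open>Sums over distinct indices and the probabilities of sampled partitions\<close>

text \<open>Up to multiplicities a monomial symmetric function: a tuple of distinct indices assigns
  one index to each exponent. Taken as an integral over a counting measure with values in
  \<open>ennreal\<close>, it makes sense without any summability.\<close>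

definition dsum :: "nat list \<Rightarrow> (nat \<Rightarrow> real) \<Rightarrow> ennreal" where
  "dsum ns s = (\<integral>\<^sup>+js. (\<Prod>l<length ns. ennreal (s (js ! l)) ^ (ns ! l))
     \<partial>count_space {js. length js = length ns \<and> distinct js})"

lemma dsum_Nil [simp]: "dsum [] s = 1"
proof -
  have "{js :: nat list. length js = length ([] :: nat list) \<and> distinct js} = {[]}" by auto
  then show ?thesis by (simp add: dsum_def nn_integral_count_space_finite)
qed

text \<open>The sum over one more index splits according to whether that index repeats one already
  chosen. A repetition at position \<open>l\<close> merges \<open>n\<close> into the exponent there,
  and since the chosen indices are distinct the position is unique.\<close>

lemma dsum_Cons:
  "(\<Sum>i. ennreal (s i) ^ n) * dsum ns s = dsum (n # ns) s + (\<Sum>l<length ns. dsum (ns[l := ns ! l + n]) s)"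
proof -
  define A where "A = {js :: nat list. length js = length ns \<and> distinct js}"
  define w where "w js = (\<Prod>l<length ns. ennreal (s (js ! l)) ^ (ns ! l))" for js
  have upd: "ennreal (s (js ! l)) ^ n * w js = (\<Prod>k<length ns. ennreal (s (js ! k)) ^ (ns[l := ns ! l + n] ! k))"
    if "l < length ns" for js l
  proof -
    have "(\<Prod>k<length ns. ennreal (s (js ! k)) ^ (ns[l := ns ! l + n] ! k))
        = (\<Prod>k<length ns. (if k = l then ennreal (s (js ! k)) ^ n else 1) * ennreal (s (js ! k)) ^ (ns ! k))"
      using that by (intro prod.cong) (auto simp: nth_list_update power_add mult.commute)
    also have "\<dots> = (\<Prod>k<length ns. (if k = l then ennreal (s (js ! k)) ^ n else 1)) * w js"
      by (simp add: prod.distrib w_def)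
    finally show ?thesis using that by simp
  qed
  have split: "(\<Sum>i. ennreal (s i) ^ n) * w js =
      (\<integral>\<^sup>+i. ennreal (s i) ^ n * w js * indicator (- set js) i \<partial>count_space UNIV) +
      (\<Sum>l<length ns. ennreal (s (js ! l)) ^ n * w js)" if "js \<in> A" for js
  proof -
    have js: "length js = length ns" "distinct js" using that by (auto simp: A_def)
    have "(\<Sum>i. ennreal (s i) ^ n) * w js = (\<integral>\<^sup>+i. ennreal (s i) ^ n * w js \<partial>count_space UNIV)"
      by (simp add: nn_integral_count_space_nat)
    also have "\<dots> = (\<integral>\<^sup>+i. ennreal (s i) ^ n * w js * indicator (- set js) i
          + ennreal (s i) ^ n * w js * indicator (set js) i \<partial>count_space UNIV)"
      by (intro nn_integral_cong) (auto simp: indicator_def)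
    also have "\<dots> = (\<integral>\<^sup>+i. ennreal (s i) ^ n * w js * indicator (- set js) i \<partial>count_space UNIV)
        + (\<integral>\<^sup>+i. ennreal (s i) ^ n * w js * indicator (set js) i \<partial>count_space UNIV)"
      by (rule nn_integral_add) auto
    also have "(\<integral>\<^sup>+i. ennreal (s i) ^ n * w js * indicator (set js) i \<partial>count_space UNIV) = (\<Sum>i\<in>set js. ennreal (s i) ^ n * w js)"
      by (subst nn_integral_count_space'[of "set js"]) auto
    also have "\<dots> = (\<Sum>l<length ns. ennreal (s (js ! l)) ^ n * w js)"
      using js by (intro sum.reindex_bij_betw[symmetric] bij_betw_nth) auto
    finally show ?thesis .
  qed
  have "(\<Sum>i. ennreal (s i) ^ n) * dsum ns s = (\<integral>\<^sup>+js. (\<Sum>i. ennreal (s i) ^ n) * w js \<partial>count_space A)"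
    unfolding dsum_def A_def w_def by (subst nn_integral_cmult) auto
  also have "\<dots> = (\<integral>\<^sup>+js. (\<integral>\<^sup>+i. ennreal (s i) ^ n * w js * indicator (- set js) i \<partial>count_space UNIV) +
      (\<Sum>l<length ns. ennreal (s (js ! l)) ^ n * w js) \<partial>count_space A)"
    by (intro nn_integral_cong) (simp add: split)
  also have "\<dots> = (\<integral>\<^sup>+js. (\<integral>\<^sup>+i. ennreal (s i) ^ n * w js * indicator (- set js) i \<partial>count_space UNIV) \<partial>count_space A) +
      (\<Sum>l<length ns. \<integral>\<^sup>+js. ennreal (s (js ! l)) ^ n * w js \<partial>count_space A)"
    by (subst nn_integral_add) (auto simp: nn_integral_sum)
  also have "(\<Sum>l<length ns. \<integral>\<^sup>+js. ennreal (s (js ! l)) ^ n * w js \<partial>count_space A) = (\<Sum>l<length ns. dsum (ns[l := ns ! l + n]) s)"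
    unfolding dsum_def A_def by (intro sum.cong refl) (simp add: upd)
  also have "(\<integral>\<^sup>+js. (\<integral>\<^sup>+i. ennreal (s i) ^ n * w js * indicator (- set js) i \<partial>count_space UNIV) \<partial>count_space A) = dsum (n # ns) s"
  proof -
    \<comment> \<open>A distinct list together with a fresh index is the same as a distinct list
      with one more entry, the fresh index standing in front.\<close>
    define B where "B = {(js, i). js \<in> A \<and> i \<notin> set js}"
    have bij: "bij_betw (\<lambda>(js, i). i # js) B {js. length js = length (n # ns) \<and> distinct js}"
      by (rule bij_betw_byWitness[where f' = "\<lambda>js. (tl js, hd js)"])
        (auto simp: B_def A_def length_Suc_conv)
    have "(\<integral>\<^sup>+js. (\<integral>\<^sup>+i. ennreal (s i) ^ n * w js * indicator (- set js) i \<partial>count_space UNIV) \<partial>count_space A)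
        = (\<integral>\<^sup>+js. (\<integral>\<^sup>+i. ennreal (s i) ^ n * w js * indicator B (js, i) \<partial>count_space UNIV) \<partial>count_space UNIV)"
      by (subst nn_integral_count_space_indicator) 
        (auto intro!: nn_integral_cong simp: B_def indicator_def)
    also have "\<dots> = (\<integral>\<^sup>+p. (case p of (js, i) \<Rightarrow> ennreal (s i) ^ n * w js) * indicator B p \<partial>count_space UNIV)"
      by (subst nn_integral_fst_count_space[symmetric]) simp
    also have "\<dots> = (\<integral>\<^sup>+p. (case p of (js, i) \<Rightarrow> ennreal (s i) ^ n * w js) \<partial>count_space B)"
      by (subst (2) nn_integral_count_space_indicator) auto
    also have "\<dots> = (\<integral>\<^sup>+p. (\<lambda>js. \<Prod>l<length (n # ns). ennreal (s (js ! l)) ^ ((n # ns) ! l)) ((\<lambda>(js, i). i # js) p) \<partial>count_space B)"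
      by (rule nn_integral_cong) (simp add: w_def prod.lessThan_Suc_shift split_beta del: prod.lessThan_Suc)
    also have "\<dots> = dsum (n # ns) s"
      unfolding dsum_def by (rule nn_integral_bij_count_space[OF bij])
    finally show ?thesis .
  qed
  finally show ?thesis .
qed

lemma dsum_cmult:
  assumes "0 \<le> c" "\<And>i. 0 \<le> s i"
  shows "dsum ns (\<lambda>i. c * s i) = ennreal c ^ sum_list ns * dsum ns s"
proof -
  have "(\<Prod>l<length ns. ennreal (c * s (js ! l)) ^ (ns ! l)) = ennreal c ^ sum_list ns * (\<Prod>l<length ns. ennreal (s (js ! l)) ^ (ns ! l))" for js :: "nat list"
    using assms
    by (simp add: ennreal_mult power_mult_distrib prod.distrib power_sum[symmetric] sum_list_sum_nth lessThan_atLeast0)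
  then show ?thesis unfolding dsum_def by (simp add: nn_integral_cmult)
qed

lemma measurable_dsum [measurable]: "dsum ns \<in> borel_measurable seq_space"
proof -
  define A where "A = {js :: nat list. length js = length ns \<and> distinct js}"
  interpret A: sigma_finite_measure "count_space A"
    by (rule sigma_finite_measure_count_space_countable) auto
  have "(\<lambda>s. \<integral>\<^sup>+js. (\<Prod>l<length ns. ennreal (s (js ! l)) ^ (ns ! l)) \<partial>count_space A) \<in> borel_measurable seq_space"
  proof (rule A.borel_measurable_nn_integral)
    show "(\<lambda>(s, js). \<Prod>l<length ns. ennreal (s (js ! l)) ^ (ns ! l)) \<in> borel_measurable (seq_space \<Otimes>\<^sub>M count_space A)"
    proof -
      have *: "(\<lambda>(js, s). \<Prod>l<length ns. ennreal (s (js ! l)) ^ (ns ! l)) \<in> borel_measurable (count_space A \<Otimes>\<^sub>M seq_space)"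
        by (rule measurable_pair_measure_countable1) (auto simp: split_beta)
      show ?thesis
        using measurable_compose[OF measurable_pair_swap' *] by (simp add: split_beta)
    qed
  qed
  then show ?thesis unfolding dsum_def[abs_def] A_def .
qed

lemma sets_P_infty [measurable]: "P_infty \<in> sets seq_space"
proof -
  have comp: "(\<lambda>s. s i) \<in> borel_measurable seq_space" for i :: nat
    by (rule measurable_component_singleton) simp
  \<comment> \<open>For nonnegative sequences the convergence condition becomes an equation between
    \<open>ennreal\<close> series, whose measurability is immediate.\<close>
  have sums: "s sums 1 \<longleftrightarrow> (\<Sum>i. ennreal (s i)) = 1" if nn: "\<And>i. 0 \<le> s i" for s :: "nat \<Rightarrow> real"
  proof
    assume "s sums 1"
    then show "(\<Sum>i. ennreal (s i)) = 1" using suminf_ennreal_eq[OF nn] by fastforce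
  next
    assume *: "(\<Sum>i. ennreal (s i)) = 1"
    have sm: "summable s" by (rule summable_suminf_not_top[OF nn]) (simp add: *)
    have "ennreal (suminf s) = 1" using * suminf_ennreal2[OF nn sm] by (simp only:)
    then have "suminf s = 1" by (simp add: ennreal_eq_1)
    then show "s sums 1" using summable_sums[OF sm] by (simp only:)
  qed
  have eq: "P_infty = {s \<in> space seq_space. (\<forall>i. s (Suc i) \<le> s i) \<and> (\<forall>i. 0 \<le> s i) \<and> (\<Sum>i. ennreal (s i)) = 1}"
  proof (rule set_eqI)
    fix s :: "nat \<Rightarrow> real"
    have "s \<in> space seq_space" by (simp add: space_PiM)
    then show "s \<in> P_infty \<longleftrightarrow> s \<in> {s \<in> space seq_space. (\<forall>i. s (Suc i) \<le> s i) \<and> (\<forall>i. 0 \<le> s i) \<and> (\<Sum>i. ennreal (s i)) = 1}"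
      unfolding P_infty_def decseq_Suc_iff mem_Collect_eq using sums[of s] by blast
  qed
  have "(\<lambda>s. \<Sum>i. ennreal (s i)) \<in> borel_measurable seq_space"
    by (rule borel_measurable_suminf_order) (rule measurable_compose[OF comp measurable_ennreal])
  from measurable_sets[OF this, of "{1}"]
  have 1: "{s \<in> space seq_space. (\<Sum>i. ennreal (s i)) = 1} \<in> sets seq_space"
    by (simp add: vimage_def Int_def conj_commute)
  have 2: "{s \<in> space seq_space. \<forall>i. s (Suc i) \<le> s i} \<in> sets seq_space"
    by (intro sets.sets_Collect_countable_All borel_measurable_le comp)
  have 3: "{s \<in> space seq_space. \<forall>i. 0 \<le> s i} \<in> sets seq_space"
    by (intro sets.sets_Collect_countable_All borel_measurable_le comp borel_measurable_const)
  show ?thesis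
    unfolding eq using sets.sets_Collect_conj[OF sets.sets_Collect_conj[OF 1 3] 2] .
qed

lemma pmf_index_pmf:
  assumes "P \<in> P_infty"
  shows "pmf (index_pmf P) i = P i"
proof -
  have P: "0 \<le> P i" "P sums 1" for i using assms unfolding P_infty_def by blast+
  have "(\<integral>\<^sup>+i. ennreal (P i) \<partial>count_space UNIV) = 1"
    unfolding nn_integral_count_space_nat using suminf_ennreal_eq[OF P] by simp
  from pmf_embed_pmf[OF P(1) this] show ?thesis
    using assms by (simp only: index_pmf_def if_True)
qed

text \<open>The value 0 off \<open>{1..n}\<close> is the default of \<open>Pi_pmf\<close> in
  \<open>partition_pmf\<close>. It also makes this set countable, so that sums over index maps can
  be exchanged with expectations.\<close>

definition index_maps :: "nat \<Rightarrow> nat set set \<Rightarrow> (nat \<Rightarrow> nat) set" where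
  "index_maps n \<pi> = {i. index_partition n i = \<pi> \<and> (\<forall>m. m \<notin> {1..n} \<longrightarrow> i m = 0)}"

lemma pmf_partition_pmf:
  assumes "P \<in> P_infty"
  shows "ennreal (pmf (partition_pmf n P) \<pi>) =
    (\<integral>\<^sup>+i. (\<Prod>m\<in>{1..n}. ennreal (P (i m))) \<partial>count_space (index_maps n \<pi>))"
proof -
  have P: "0 \<le> P i" for i using assms unfolding P_infty_def by blast
  define q where "q = Pi_pmf {1..n} 0 (\<lambda>_. index_pmf P)"
  have "ennreal (pmf (partition_pmf n P) \<pi>) = emeasure q (index_partition n -` {\<pi>})"
    by (simp add: partition_pmf_def pmf_map q_def measure_pmf.emeasure_eq_measure)
  also have "\<dots> = (\<integral>\<^sup>+i. pmf q i \<partial>count_space (index_partition n -` {\<pi>}))"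
    by (simp add: nn_integral_pmf)
  also have "\<dots> = (\<integral>\<^sup>+i. pmf q i \<partial>count_space (index_maps n \<pi>))"
    by (rule nn_integral_count_space_eq) (auto simp: index_maps_def q_def pmf_Pi)
  also have "\<dots> = (\<integral>\<^sup>+i. (\<Prod>m\<in>{1..n}. ennreal (P (i m))) \<partial>count_space (index_maps n \<pi>))"
  proof (rule nn_integral_cong)
    fix i assume "i \<in> space (count_space (index_maps n \<pi>))"
    then have i: "i m = 0" if "m \<notin> {1..n}" for m using that unfolding index_maps_def by simp
    have "pmf q i = (\<Prod>m\<in>{1..n}. pmf (index_pmf P) (i m))"
      unfolding q_def by (rule pmf_Pi') (use i in \<open>simp_all only: finite_atLeastAtMost\<close>)
    then show "ennreal (pmf q i) = (\<Prod>m\<in>{1..n}. ennreal (P (i m)))"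
      unfolding pmf_index_pmf[OF assms] by (simp only: prod_ennreal P)
  qed
  finally show ?thesis .
qed

lemma index_partition_eq_iff:
  assumes "partition_on {1..n} \<pi>"
  shows "index_partition n i = \<pi> \<longleftrightarrow> (\<forall>A\<in>\<pi>. \<forall>m\<in>A. \<forall>m'\<in>{1..n}. i m = i m' \<longleftrightarrow> m' \<in> A)"
proof
  assume eq: "index_partition n i = \<pi>"
  show "\<forall>A\<in>\<pi>. \<forall>m\<in>A. \<forall>m'\<in>{1..n}. i m = i m' \<longleftrightarrow> m' \<in> A"
    using eq by (auto simp: index_partition_def)
next
  assume *: "\<forall>A\<in>\<pi>. \<forall>m\<in>A. \<forall>m'\<in>{1..n}. i m = i m' \<longleftrightarrow> m' \<in> A"
  have un: "\<Union>\<pi> = {1..n}" and ne: "{} \<notin> \<pi>" using assms by (auto simp: partition_on_def)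
  have cls: "{m' \<in> {1..n}. i m' = i m} = A" if "A \<in> \<pi>" "m \<in> A" for A m
  proof -
    have "A \<subseteq> {1..n}" using un that(1) by blast
    moreover have "i m = i m' \<longleftrightarrow> m' \<in> A" if "m' \<in> {1..n}" for m'
      using *[rule_format, OF \<open>A \<in> \<pi>\<close> \<open>m \<in> A\<close> that] .
    ultimately show ?thesis by (auto simp: eq_commute[of _ "i m"])
  qed
  show "index_partition n i = \<pi>"
  proof (intro equalityI subsetI)
    fix A assume "A \<in> index_partition n i"
    then obtain m where m: "m \<in> {1..n}" "A = {m' \<in> {1..n}. i m' = i m}" by (auto simp: index_partition_def)
    then have "m \<in> \<Union>\<pi>" unfolding un by blast
    then obtain B where "B \<in> \<pi>" "m \<in> B" by blast
    then show "A \<in> \<pi>" using cls m by simp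
  next
    fix A assume A: "A \<in> \<pi>"
    then obtain m where m: "m \<in> A" using ne by fastforce
    then have "m \<in> {1..n}" using A unfolding un[symmetric] by blast
    then show "A \<in> index_partition n i" unfolding index_partition_def cls[OF A m, symmetric] by blast
  qed
qed

text \<open>An index map produces the partition \<open>set As\<close> exactly if it is constant on
  every block and takes different values on different blocks. The order of \<open>As\<close> then
  identifies such maps with lists of distinct indices, and the product over \<open>{1..n}\<close>
  collects into one power per block.\<close>

lemma pmf_partition_pmf_dsum:
  assumes P: "P \<in> P_infty" and As: "distinct As" "partition_on {1..n} (set As)"
  shows "ennreal (pmf (partition_pmf n P) (set As)) = dsum (map card As) P"
proof -
  define k where "k = length As"
  have un: "(\<Union>l<k. As ! l) = {1..n}"
    using As(2) by (auto simp: partition_on_def k_def set_conv_nth)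
  have disj: "As ! l \<inter> As ! l' = {}" if "l < k" "l' < k" "l \<noteq> l'" for l l'
    using As that by (auto simp: partition_on_def disjoint_def k_def distinct_conv_nth)
  have mem: "As ! l \<in> set As" if "l < k" for l using that by (simp add: k_def)
  have "{} \<notin> set As" using As(2) unfolding partition_on_def by blast
  then have ne: "As ! l \<noteq> {}" if "l < k" for l using mem[OF that] by metis
  have sub: "As ! l \<subseteq> {1..n}" if "l < k" for l using un that by blast
  \<comment> \<open>The position of the block containing \<open>m\<close>; \<open>pick l\<close>
    below is a representative of block \<open>l\<close>. Spreading a list along \<open>blk\<close>
    gives \<open>h\<close>, and reading off the values at the representatives inverts it.\<close>
  define blk where "blk m = (THE l. l < k \<and> m \<in> As ! l)" for m
  have blk: "blk m = l" if "l < k" "m \<in> As ! l" for l m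
    unfolding blk_def using that disj by (intro the_equality) blast+
  have blk_lt: "blk m < k" "m \<in> As ! blk m" if m: "m \<in> {1..n}" for m
  proof -
    obtain l where l: "l < k" "m \<in> As ! l" using m unfolding un[symmetric] by blast
    show "blk m < k" "m \<in> As ! blk m" using blk[OF l] l by simp_all
  qed
  define pick where "pick l = (SOME m. m \<in> As ! l)" for l
  have pick: "pick l \<in> As ! l" if "l < k" for l unfolding pick_def using ne[OF that] by (simp add: some_in_eq)
  define h where "h js m = (if m \<in> {1..n} then js ! blk m else 0)" for js :: "nat list" and m
  have hl: "h js m = js ! l" if "l < k" "m \<in> As ! l" for js l m
    unfolding h_def using subsetD[OF sub[OF that(1)] that(2)] blk[OF that] by (simp only: if_True)
  have fin: "finite (As ! l)" if "l < k" for l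
    using finite_subset[OF sub[OF that]] by blast
  define L where "L = {js :: nat list. length js = k \<and> distinct js}"
  have im: "i \<in> index_maps n (set As) \<longleftrightarrow> (\<forall>l<k. \<forall>m\<in>As ! l. \<forall>m'\<in>{1..n}. i m = i m' \<longleftrightarrow> m' \<in> As ! l) \<and> (\<forall>m. m \<notin> {1..n} \<longrightarrow> i m = 0)" for i
    unfolding index_maps_def index_partition_eq_iff[OF As(2)] by (auto simp: set_conv_nth k_def)
  have bij: "bij_betw h L (index_maps n (set As))"
  proof (rule bij_betw_byWitness[where f' = "\<lambda>i. map (\<lambda>l. i (pick l)) [0..<k]"])
    show "\<forall>js\<in>L. map (\<lambda>l. h js (pick l)) [0..<k] = js"
      using hl pick by (auto simp: L_def list_eq_iff_nth_eq)
    show "\<forall>i\<in>index_maps n (set As). h (map (\<lambda>l. i (pick l)) [0..<k]) = i"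
    proof (intro ballI ext)
      fix i m assume i: "i \<in> index_maps n (set As)"
      show "h (map (\<lambda>l. i (pick l)) [0..<k]) m = i m"
      proof (cases "m \<in> {1..n}")
        case True
        then have "i (pick (blk m)) = i m" using i blk_lt[OF True] pick unfolding im by blast
        then show ?thesis using True blk_lt[OF True] by (simp add: h_def)
      next
        case False
        moreover have "i m = 0" using i False unfolding im by blast
        ultimately show ?thesis unfolding h_def by (simp only: if_False)
      qed
    qed
    show "h ` L \<subseteq> index_maps n (set As)"
    proof safe
      fix js assume js: "js \<in> L"
      have "h js m = h js m' \<longleftrightarrow> m' \<in> As ! l" if "l < k" "m \<in> As ! l" "m' \<in> {1..n}" for l m m'
      proof -
        have "m' \<in> As ! l \<longleftrightarrow> l = blk m'" using blk[OF that(1), of m'] blk_lt(2)[OF that(3)] by metis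
        moreover have "js ! l = js ! blk m' \<longleftrightarrow> l = blk m'"
          using js that(1) blk_lt(1)[OF that(3)] by (simp add: L_def nth_eq_iff_index_eq)
        ultimately show ?thesis
          using hl[OF that(1,2)] hl[OF blk_lt[OF that(3)]] by simp
      qed
      moreover have "h js m = 0" if "m \<notin> {1..n}" for m using that unfolding h_def by (simp only: if_False)
      ultimately show "h js \<in> index_maps n (set As)" unfolding im by blast
    qed
    show "(\<lambda>i. map (\<lambda>l. i (pick l)) [0..<k]) ` index_maps n (set As) \<subseteq> L"
    proof safe
      fix i assume i: "i \<in> index_maps n (set As)"
      have "inj_on (\<lambda>l. i (pick l)) {..<k}"
      proof (rule inj_onI)
        fix l l' assume l: "l \<in> {..<k}" "l' \<in> {..<k}" "i (pick l) = i (pick l')"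
        then have "pick l' \<in> As ! l" using i pick[of l] pick[of l'] sub[of l'] unfolding im by blast
        then show "l = l'" using disj[of l l'] pick[of l'] l by auto
      qed
      then show "map (\<lambda>l. i (pick l)) [0..<k] \<in> L"
        by (simp add: L_def distinct_map lessThan_atLeast0)
    qed
  qed
  have "dsum (map card As) P = (\<integral>\<^sup>+js. (\<Prod>m\<in>{1..n}. ennreal (P (h js m))) \<partial>count_space L)"
    unfolding dsum_def L_def length_map k_def[symmetric]
  proof (rule nn_integral_cong)
    fix js :: "nat list"
    have "(\<Prod>m\<in>{1..n}. ennreal (P (h js m))) = (\<Prod>l<k. \<Prod>m\<in>As ! l. ennreal (P (h js m)))"
      unfolding un[symmetric]
      by (rule prod.UNION_disjoint) (use disj fin in auto)
    also have "\<dots> = (\<Prod>l<k. ennreal (P (js ! l)) ^ card (As ! l))"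
    proof (rule prod.cong[OF refl])
      fix l assume "l \<in> {..<k}"
      then have "(\<Prod>m\<in>As ! l. ennreal (P (h js m))) = (\<Prod>m\<in>As ! l. ennreal (P (js ! l)))"
        using hl[of l] by (intro prod.cong) auto
      then show "(\<Prod>m\<in>As ! l. ennreal (P (h js m))) = ennreal (P (js ! l)) ^ card (As ! l)" by simp
    qed
    finally show "(\<Prod>l<k. ennreal (P (js ! l)) ^ (map card As ! l)) = (\<Prod>m\<in>{1..n}. ennreal (P (h js m)))"
      by (simp add: k_def)
  qed
  also have "\<dots> = ennreal (pmf (partition_pmf n P) (set As))"
    unfolding pmf_partition_pmf[OF P] by (rule nn_integral_bij_count_space[OF bij])
  finally show ?thesis ..
qed

section \<open>Stable points: finiteness of the total and sums over distinct points\<close>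

lemma power_times_exp_bounded:
  fixes l :: real
  assumes "0 < l"
  obtains C where "\<And>x. 0 \<le> x \<Longrightarrow> x ^ N * exp (- l * x) \<le> C"
proof (cases "N = 0")
  case True
  then show ?thesis using assms by (intro that[of 1]) auto
next
  case False
  show ?thesis
  proof (rule that)
    fix x :: real assume "0 \<le> x"
    \<comment> \<open>Scaling by \<open>N\<close> reduces the bound to the \<open>N\<close>-th power
      of \<open>y \<le> exp y\<close>.\<close>
    define y where "y = l * x / N"
    have y: "0 \<le> y" "x = real N / l * y" using \<open>0 \<le> x\<close> assms False by (auto simp: y_def)
    have "y ^ N \<le> exp y ^ N" using exp_ge_add_one_self[of y] y by (intro power_mono) linarith+
    also have "\<dots> = exp (l * x)" using False by (simp add: exp_of_nat_mult[symmetric] y_def)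
    finally have "y ^ N * exp (- l * x) \<le> 1" by (simp add: exp_minus field_simps)
    then have "(real N / l) ^ N * (y ^ N * exp (- l * x)) \<le> (real N / l) ^ N * 1"
      using assms by (intro mult_left_mono) auto
    then show "x ^ N * exp (- l * x) \<le> (real N / l) ^ N"
      by (subst (1) y(2)) (simp add: power_mult_distrib power_divide mult_ac)
  qed
qed

locale stable_points = prob_space M for M :: "'a measure" +
  fixes g :: real and J :: "nat \<Rightarrow> 'a \<Rightarrow> real"
  assumes g: "0 < g" "g < 1" and ranked: "ranked_stable_points g M J"
begin

abbreviation "T \<equiv> inv_local_time J"

lemma points: "poisson_points M (stable_intensity g) J"
  using ranked by (simp add: ranked_stable_points_def)

lemma J_measurable [measurable]: "J i \<in> borel_measurable M"
  using points by (simp add: poisson_points_def)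

lemma T_measurable [measurable]: "T \<in> borel_measurable M"
  unfolding inv_local_time_def[abs_def] by (intro borel_measurable_suminf J_measurable)

lemma AE_J_pos: "AE \<omega> in M. \<forall>i. 0 < J i \<omega>"
  using ranked unfolding ranked_stable_points_def by (auto elim: eventually_mono)

lemma laplace_functional':
  assumes "\<phi> \<in> borel_measurable borel" "\<And>x. 0 < x \<Longrightarrow> 0 \<le> \<phi> x"
  shows "(\<integral>\<^sup>+\<omega>. ennreal (lexp (\<Sum>i. ennreal (\<phi> (J i \<omega>)))) \<partial>M) = ennreal (lexp (\<integral>\<^sup>+x. ennreal (1 - exp (- \<phi> x)) \<partial>stable_intensity g))"
proof -
  have "(\<integral>\<^sup>+x. ennreal (1 - lexp (ennreal (\<phi> x))) \<partial>stable_intensity g) = (\<integral>\<^sup>+x. ennreal (1 - exp (- \<phi> x)) \<partial>stable_intensity g)"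
    by (rule nn_integral_cong_AE, use AE_stable_intensity_pos in eventually_elim) (simp add: assms lexp_ennreal)
  moreover have "(\<lambda>x. ennreal (\<phi> x)) \<in> borel_measurable borel" using assms(1) by measurable
  ultimately show ?thesis
    using laplace_functional[OF prob_space_axioms points sets_stable_intensity sigma_finite_stable_intensity, of "\<lambda>x. ennreal (\<phi> x)"]
    by simp
qed

text \<open>The Laplace transform of the possibly infinite sum is \<open>exp (- (c powr g))\<close>.
  As \<open>c\<close> tends to 0 it tends to 1, while the integrand tends to the indicator of the
  event that the sum is finite.\<close>

lemma AE_summable: "AE \<omega> in M. summable (\<lambda>i. J i \<omega>)"
proof -
  define S where "S \<omega> = (\<Sum>i. ennreal (J i \<omega>))" for \<omega>
  have [measurable]: "S \<in> borel_measurable M" unfolding S_def[abs_def] by measurable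
  define c where "c n = inverse (real (Suc n))" for n
  have c: "0 < c n" for n by (simp add: c_def)
  have eq: "(\<integral>\<^sup>+\<omega>. ennreal (lexp (ennreal (c n) * S \<omega>)) \<partial>M) = ennreal (exp (- (c n powr g)))" for n
  proof -
    have "(\<integral>\<^sup>+\<omega>. ennreal (lexp (ennreal (c n) * S \<omega>)) \<partial>M) = (\<integral>\<^sup>+\<omega>. ennreal (lexp (\<Sum>i. ennreal (c n * J i \<omega>))) \<partial>M)"
    proof (rule nn_integral_cong_AE, use AE_J_pos in eventually_elim)
      case (elim \<omega>)
      then have "(\<Sum>i. ennreal (c n * J i \<omega>)) = (\<Sum>i. ennreal (c n) * ennreal (J i \<omega>))"
        using c[of n] by (intro suminf_cong) (simp add: ennreal_mult less_imp_le)
      then show ?case by (simp add: S_def)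
    qed
    also have "\<dots> = ennreal (lexp (\<integral>\<^sup>+x. ennreal (1 - exp (- (c n * x))) \<partial>stable_intensity g))"
      using c[of n] by (intro laplace_functional') auto
    also have "\<dots> = ennreal (exp (- (c n powr g)))"
      using nn_integral_stable_exponent[OF g, of "c n"] c[of n] by (simp add: lexp_ennreal)
    finally show ?thesis .
  qed
  have lim0: "c \<longlonglongrightarrow> 0" unfolding c_def by (rule LIMSEQ_inverse_real_of_nat)
  have "(\<lambda>n. ennreal (exp (- (c n powr g)))) \<longlonglongrightarrow> ennreal (exp (- 0))"
    using tendsto_zero_powrI[OF lim0, of "\<lambda>_. g" g] g c
    by (intro tendsto_ennrealI tendsto_exp tendsto_minus) (auto simp: less_imp_le)
  moreover have "(\<lambda>n. \<integral>\<^sup>+\<omega>. ennreal (lexp (ennreal (c n) * S \<omega>)) \<partial>M) \<longlonglongrightarrow> (\<integral>\<^sup>+\<omega>. indicator {\<omega> \<in> space M. S \<omega> < \<infinity>} \<omega> \<partial>M)"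
  proof (rule nn_integral_dominated_convergence[where w = "\<lambda>_. 1"])
    show "AE \<omega> in M. (\<lambda>n. ennreal (lexp (ennreal (c n) * S \<omega>))) \<longlonglongrightarrow> indicator {\<omega> \<in> space M. S \<omega> < \<infinity>} \<omega>"
    proof (rule AE_I2)
      fix \<omega> assume sp: "\<omega> \<in> space M"
      show "(\<lambda>n. ennreal (lexp (ennreal (c n) * S \<omega>))) \<longlonglongrightarrow> indicator {\<omega> \<in> space M. S \<omega> < \<infinity>} \<omega>"
      proof (cases "S \<omega>")
        case (real r)
        have "lexp (ennreal (c n) * S \<omega>) = exp (- (c n * r))" for n
          using real c[of n] by (simp add: lexp_ennreal flip: ennreal_mult)
        moreover have "(\<lambda>n. ennreal (exp (- (c n * r)))) \<longlonglongrightarrow> ennreal (exp (- (0 * r)))"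
          by (intro tendsto_ennrealI tendsto_exp tendsto_minus tendsto_mult tendsto_const lim0)
        ultimately show ?thesis using sp real by simp
      next
        case top
        have "ennreal (c n) * S \<omega> = top" for n using c[of n] top by (simp add: ennreal_mult_top)
        then show ?thesis using top by simp
      qed
    qed
  qed (auto simp: lexp_bounds emeasure_space_1)
  ultimately have "(\<integral>\<^sup>+\<omega>. indicator {\<omega> \<in> space M. S \<omega> < \<infinity>} \<omega> \<partial>M) = 1"
    unfolding eq using LIMSEQ_unique by fastforce
  then have "emeasure M {\<omega> \<in> space M. S \<omega> < \<infinity>} = 1" by simp
  then have "AE \<omega> in M. S \<omega> < \<infinity>"
    using AE_prob_1[of "{\<omega> \<in> space M. S \<omega> < \<infinity>}"] by (simp add: measure_def)
  then show ?thesis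
    using AE_J_pos
  proof eventually_elim
    case (elim \<omega>)
    then show ?case unfolding S_def by (intro summable_suminf_not_top) (auto simp: less_imp_le less_top)
  qed
qed

text \<open>A single almost sure event on which the later pathwise estimates are
  deterministic.\<close>

definition good :: "'a \<Rightarrow> bool" where
  "good \<omega> \<longleftrightarrow> (\<forall>i. 0 < J i \<omega>) \<and> summable (\<lambda>i. J i \<omega>)"

lemma AE_good: "AE \<omega> in M. good \<omega>"
  using AE_J_pos AE_summable by eventually_elim (simp add: good_def)

lemma good_le_T: "good \<omega> \<Longrightarrow> J i \<omega> \<le> T \<omega>"
  unfolding good_def inv_local_time_def
  using sum_le_suminf[of "\<lambda>i. J i \<omega>" "{i}"] by (simp add: less_imp_le)

lemma good_T_pos: "good \<omega> \<Longrightarrow> 0 < T \<omega>"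
  using good_le_T[of \<omega> 0] by (force simp: good_def dest: less_le_trans)

definition power_sum :: "nat \<Rightarrow> 'a \<Rightarrow> real" where
  "power_sum n \<omega> = (\<Sum>i. J i \<omega> ^ n)"

lemma power_sum_measurable [measurable]: "power_sum n \<in> borel_measurable M"
  unfolding power_sum_def[abs_def] by (intro borel_measurable_suminf) measurable

lemma good_power_sum:
  assumes "good \<omega>" "1 \<le> n"
  shows "summable (\<lambda>i. J i \<omega> ^ n)" "0 \<le> power_sum n \<omega>" "power_sum n \<omega> \<le> T \<omega> ^ n"
    "(\<Sum>i. ennreal (J i \<omega>) ^ n) = ennreal (power_sum n \<omega>)"
proof -
  have J: "0 < J i \<omega>" "J i \<omega> \<le> T \<omega>" for i using assms(1) good_le_T by (auto simp: good_def)
  have le: "J i \<omega> ^ n \<le> T \<omega> ^ (n - 1) * J i \<omega>" for i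
  proof -
    have "J i \<omega> ^ n = J i \<omega> ^ (n - 1) * J i \<omega>" using assms(2) by (simp add: power_eq_if)
    also have "\<dots> \<le> T \<omega> ^ (n - 1) * J i \<omega>"
      using J[of i] by (intro mult_right_mono power_mono) auto
    finally show ?thesis .
  qed
  have smJ: "summable (\<lambda>i. T \<omega> ^ (n - 1) * J i \<omega>)"
    using assms(1) unfolding good_def by (intro summable_mult) auto
  show sm: "summable (\<lambda>i. J i \<omega> ^ n)"
    by (rule summable_comparison_test'[OF smJ]) (use le J in \<open>simp add: less_imp_le\<close>)
  show "0 \<le> power_sum n \<omega>" unfolding power_sum_def by (rule suminf_nonneg[OF sm]) (simp add: J less_imp_le)
  have "power_sum n \<omega> \<le> (\<Sum>i. T \<omega> ^ (n - 1) * J i \<omega>)"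
    unfolding power_sum_def by (rule suminf_le[OF le sm smJ])
  also have "\<dots> = T \<omega> ^ (n - 1) * T \<omega>"
    using assms(1) unfolding good_def inv_local_time_def by (intro suminf_mult) auto
  also have "\<dots> = T \<omega> ^ n" using assms(2) by (simp add: power_eq_if)
  finally show "power_sum n \<omega> \<le> T \<omega> ^ n" .
  show "(\<Sum>i. ennreal (J i \<omega>) ^ n) = ennreal (power_sum n \<omega>)"
    unfolding power_sum_def using J sm
    by (subst suminf_ennreal2[symmetric]) (auto simp: ennreal_power less_imp_le)
qed

text \<open>A real-valued version for the derivative calculus. On \<open>good\<close> paths with
  positive exponents \<open>dsum\<close> is finite, so the conversion loses nothing.\<close>

definition point_sum :: "nat list \<Rightarrow> 'a \<Rightarrow> real" where
  "point_sum ns \<omega> = enn2real (dsum ns (\<lambda>i. J i \<omega>))"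

lemma points_measurable [measurable]: "(\<lambda>\<omega> i. J i \<omega>) \<in> M \<rightarrow>\<^sub>M seq_space"
  by (rule measurable_PiM_single') (auto simp: space_PiM)

lemma dsum_points_measurable [measurable]: "(\<lambda>\<omega>. dsum ns (\<lambda>i. J i \<omega>)) \<in> borel_measurable M"
  by (rule measurable_compose[OF points_measurable measurable_dsum])

lemma point_sum_measurable [measurable]: "point_sum ns \<in> borel_measurable M"
  unfolding point_sum_def[abs_def] by measurable

text \<open>Dropping the merged terms in \<open>dsum_Cons\<close> leaves a product of power sums,
  and a power sum of exponent at least 1 is bounded by the same power of \<open>T\<close>.\<close>

lemma good_dsum_le:
  assumes "good \<omega>" "\<forall>n\<in>set ns. 1 \<le> n"
  shows "dsum ns (\<lambda>i. J i \<omega>) \<le> ennreal (T \<omega> ^ sum_list ns)"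
  using assms(2)
proof (induction ns)
  case (Cons n ns)
  have "dsum (n # ns) (\<lambda>i. J i \<omega>) \<le> (\<Sum>i. ennreal (J i \<omega>) ^ n) * dsum ns (\<lambda>i. J i \<omega>)"
    unfolding dsum_Cons by simp
  also have "\<dots> = ennreal (power_sum n \<omega>) * dsum ns (\<lambda>i. J i \<omega>)"
    using Cons.prems by (simp add: good_power_sum(4)[OF assms(1)])
  also have "\<dots> \<le> ennreal (T \<omega> ^ n) * ennreal (T \<omega> ^ sum_list ns)"
    using Cons good_power_sum(3)[OF assms(1), of n] by (intro mult_mono ennreal_leI) auto
  also have "\<dots> = ennreal (T \<omega> ^ sum_list (n # ns))"
    using good_T_pos[OF assms(1)] by (simp add: power_add flip: ennreal_mult)
  finally show ?case .
qed simp

lemma good_point_sum: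
  assumes "good \<omega>" "\<forall>n\<in>set ns. 1 \<le> n"
  shows "dsum ns (\<lambda>i. J i \<omega>) = ennreal (point_sum ns \<omega>)" "0 \<le> point_sum ns \<omega>" "point_sum ns \<omega> \<le> T \<omega> ^ sum_list ns"
proof -
  show "dsum ns (\<lambda>i. J i \<omega>) = ennreal (point_sum ns \<omega>)"
    using le_less_trans[OF good_dsum_le[OF assms]] by (simp add: point_sum_def)
  then show "point_sum ns \<omega> \<le> T \<omega> ^ sum_list ns"
    using good_dsum_le[OF assms] good_T_pos[OF assms(1)] by simp
qed (simp add: point_sum_def)

lemma good_point_sum_Cons:
  assumes "good \<omega>" "\<forall>m\<in>set (n # ns). 1 \<le> m"
  shows "power_sum n \<omega> * point_sum ns \<omega> = point_sum (n # ns) \<omega> + (\<Sum>l<length ns. point_sum (ns[l := ns ! l + n]) \<omega>)"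
proof -
  have upd: "\<forall>m\<in>set (ns[l := ns ! l + n]). 1 \<le> m" for l
    using assms(2) set_update_subset_insert[of ns l "ns ! l + n"] by auto
  have nn: "0 \<le> power_sum n \<omega>" "\<forall>m\<in>set ns. 1 \<le> m" using good_power_sum(2)[OF assms(1), of n] assms(2) by auto
  have "ennreal (power_sum n \<omega> * point_sum ns \<omega>) = (\<Sum>i. ennreal (J i \<omega>) ^ n) * dsum ns (\<lambda>i. J i \<omega>)"
    using assms(2) nn good_point_sum(1,2)[OF assms(1) nn(2)] good_power_sum(4)[OF assms(1), of n]
    by (simp add: ennreal_mult)
  also have "\<dots> = ennreal (point_sum (n # ns) \<omega>) + (\<Sum>l<length ns. ennreal (point_sum (ns[l := ns ! l + n]) \<omega>))"
    unfolding dsum_Cons by (simp only: good_point_sum(1)[OF assms] good_point_sum(1)[OF assms(1) upd])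
  also have "\<dots> = ennreal (point_sum (n # ns) \<omega> + (\<Sum>l<length ns. point_sum (ns[l := ns ! l + n]) \<omega>))"
    using good_point_sum(2)[OF assms] good_point_sum(2)[OF assms(1) upd]
    by (simp add: sum_ennreal sum_nonneg)
  finally show ?thesis
    using good_point_sum(2)[OF assms] good_point_sum(2)[OF assms(1) upd] good_point_sum(2)[OF assms(1) nn(2)] nn
    by (subst (asm) ennreal_inj) (auto intro!: add_nonneg_nonneg sum_nonneg)
qed

end

section \<open>Expectations of sums over distinct points, by differentiation\<close>

lemma has_field_derivative_prod_within:
  fixes f :: "'i \<Rightarrow> real \<Rightarrow> real"
  assumes "\<And>i. i \<in> I \<Longrightarrow> (f i has_real_derivative f' i) (at x within S)"
  shows "((\<lambda>x. \<Prod>i\<in>I. f i x) has_real_derivative (\<Sum>i\<in>I. f' i * (\<Prod>j\<in>I - {i}. f j x))) (at x within S)"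
proof -
  have "((\<lambda>x. \<Prod>i\<in>I. f i x) has_derivative (\<lambda>y. \<Sum>i\<in>I. (f' i * y) * (\<Prod>j\<in>I - {i}. f j x))) (at x within S)"
    using assms by (intro has_derivative_prod) (simp add: has_field_derivative_def)
  moreover have "(\<lambda>y. \<Sum>i\<in>I. (f' i * y) * (\<Prod>j\<in>I - {i}. f j x)) = (*) (\<Sum>i\<in>I. f' i * (\<Prod>j\<in>I - {i}. f j x))"
    by (simp add: fun_eq_iff sum_distrib_left mult_ac)
  ultimately show ?thesis
    by (simp add: has_field_derivative_def)
qed

text \<open>The two sides of the moment formula are compared only for \<open>t \<ge> 0\<close>,
  where the tilted exponents stay admissible, so the derivatives are matched as limits from the
  right.\<close>

lemma right_derivative_unique:
  fixes f :: "real \<Rightarrow> real"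
  assumes "(f has_real_derivative D) (at 0 within {0..})" "(h has_real_derivative E) (at 0 within {0..})"
    and "\<And>t. 0 \<le> t \<Longrightarrow> f t = h t"
  shows "D = E"
proof -
  have sub: "{0<..} \<subseteq> {0::real..}" by auto
  have 1: "((\<lambda>y. (f y - f 0) / (y - 0)) \<longlongrightarrow> D) (at_right 0)"
    using DERIV_subset[OF assms(1) sub] by (simp only: has_field_derivative_iff)
  have 2: "((\<lambda>y. (h y - h 0) / (y - 0)) \<longlongrightarrow> E) (at_right 0)"
    using DERIV_subset[OF assms(2) sub] by (simp only: has_field_derivative_iff)
  have "\<forall>\<^sub>F y in at_right 0. (f y - f 0) / (y - 0) = (h y - h 0) / (y - 0)"
    using eventually_at_right_less[of "0::real"] by eventually_elim (simp add: assms(3))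
  from tendsto_unique[OF trivial_limit_at_right_real Lim_transform_eventually[OF 1 this] 2]
  show ?thesis .
qed

context stable_points
begin

text \<open>The linear lower bound makes \<open>exp (- total \<phi>)\<close> beat every power of
  \<open>T\<close>, and summability makes \<open>total \<phi>\<close> finite. The class contains the
  linear exponents, which are the ones wanted in the end, and is closed under adding
  \<open>t * x ^ n\<close> with \<open>t \<ge> 0\<close>, which they alone are not.\<close>

definition admissible :: "(real \<Rightarrow> real) \<Rightarrow> bool" where
  "admissible \<phi> \<longleftrightarrow> \<phi> \<in> borel_measurable borel \<and> (\<exists>l>0. \<forall>x\<ge>0. l * x \<le> \<phi> x) \<and>
     (AE \<omega> in M. summable (\<lambda>i. \<phi> (J i \<omega>)))"

definition total :: "(real \<Rightarrow> real) \<Rightarrow> 'a \<Rightarrow> real" where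
  "total \<phi> \<omega> = (\<Sum>i. \<phi> (J i \<omega>))"

text \<open>Moments of the tilted intensity. In the direction \<open>x ^ n\<close> the derivative of
  \<open>lap\<close> is \<open>mom n\<close> and that of \<open>mom m\<close> is
  \<open>- mom (m + n)\<close>, so sums of products of moments times
  \<open>exp (- lap \<phi>)\<close> reproduce under differentiation.\<close>

definition mom :: "nat \<Rightarrow> (real \<Rightarrow> real) \<Rightarrow> real" where
  "mom n \<phi> = (LINT x|stable_intensity g. x ^ n * exp (- \<phi> x))"

definition lap :: "(real \<Rightarrow> real) \<Rightarrow> real" where
  "lap \<phi> = (LINT x|stable_intensity g. 1 - exp (- \<phi> x))"

lemma admissibleE:
  assumes "admissible \<phi>"
  obtains l where "0 < l" "\<And>x. 0 \<le> x \<Longrightarrow> l * x \<le> \<phi> x" "\<And>x. 0 \<le> x \<Longrightarrow> 0 \<le> \<phi> x"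
proof -
  obtain l where l: "0 < l" "\<And>x. 0 \<le> x \<Longrightarrow> l * x \<le> \<phi> x" using assms by (auto simp: admissible_def)
  moreover have "0 \<le> \<phi> x" if "0 \<le> x" for x
    using l(2)[OF that] mult_nonneg_nonneg[of l x] l(1) that by linarith
  ultimately show ?thesis using that by blast
qed

lemma admissible_measurable [measurable_dest]: "admissible \<phi> \<Longrightarrow> \<phi> \<in> borel_measurable borel"
  by (simp add: admissible_def)

lemma total_measurable [measurable]: "admissible \<phi> \<Longrightarrow> total \<phi> \<in> borel_measurable M"
  unfolding total_def[abs_def]
  by (intro borel_measurable_suminf measurable_compose[OF J_measurable] admissible_measurable)

lemma admissible_linear: "0 < l \<Longrightarrow> admissible (\<lambda>x. l * x)"
  using AE_summable by (auto simp: admissible_def elim!: eventually_mono intro!: summable_mult exI[of _ l])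

lemma AE_total_add_power:
  assumes "admissible \<phi>" "1 \<le> n"
  shows "AE \<omega> in M. summable (\<lambda>i. \<phi> (J i \<omega>) + t * J i \<omega> ^ n) \<and>
    total (\<lambda>x. \<phi> x + t * x ^ n) \<omega> = total \<phi> \<omega> + t * power_sum n \<omega>"
proof -
  have "AE \<omega> in M. summable (\<lambda>i. \<phi> (J i \<omega>))" using assms(1) by (simp add: admissible_def)
  with AE_good show ?thesis
  proof eventually_elim
    case (elim \<omega>)
    have sm: "summable (\<lambda>i. t * J i \<omega> ^ n)"
      by (rule summable_mult[OF good_power_sum(1)[OF elim(1) assms(2)]])
    show ?case
      unfolding total_def power_sum_def
      using summable_add[OF elim(2) sm] suminf_add[OF elim(2) sm] suminf_mult[OF good_power_sum(1)[OF elim(1) assms(2)], of t]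
      by simp
  qed
qed

lemma admissible_add_power:
  assumes "admissible \<phi>" "1 \<le> n" "0 \<le> t"
  shows "admissible (\<lambda>x. \<phi> x + t * x ^ n)"
proof -
  obtain l where l: "0 < l" "\<And>x. 0 \<le> x \<Longrightarrow> l * x \<le> \<phi> x" using assms(1) by (rule admissibleE) blast
  have "l * x \<le> \<phi> x + t * x ^ n" if "0 \<le> x" for x
    using l(2)[OF that] mult_nonneg_nonneg[OF assms(3) zero_le_power[OF that, of n]] by linarith
  moreover have "(\<lambda>x. \<phi> x + t * x ^ n) \<in> borel_measurable borel"
    using admissible_measurable[OF assms(1)] by measurable
  ultimately show ?thesis
    using AE_total_add_power[OF assms(1,2), of t] l(1)
    unfolding admissible_def by (auto elim!: eventually_mono)
qed

lemma AE_total_ge: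
  assumes "admissible \<phi>"
  obtains l where "0 < l" "AE \<omega> in M. l * T \<omega> \<le> total \<phi> \<omega>"
proof -
  obtain l where l: "0 < l" "\<And>x. 0 \<le> x \<Longrightarrow> l * x \<le> \<phi> x" using assms by (rule admissibleE) blast
  have "AE \<omega> in M. summable (\<lambda>i. \<phi> (J i \<omega>))" using assms by (simp add: admissible_def)
  with AE_good have "AE \<omega> in M. l * T \<omega> \<le> total \<phi> \<omega>"
  proof eventually_elim
    case (elim \<omega>)
    have sm: "summable (\<lambda>i. J i \<omega>)" and pos: "0 < J i \<omega>" for i using elim(1) by (auto simp: good_def)
    have "l * T \<omega> = (\<Sum>i. l * J i \<omega>)"
      unfolding inv_local_time_def by (rule suminf_mult[symmetric, OF sm])
    also have "\<dots> \<le> total \<phi> \<omega>"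
      unfolding total_def
      by (rule suminf_le[OF _ summable_mult[OF sm] elim(2)]) (use pos l in \<open>simp add: less_imp_le\<close>)
    finally show ?case .
  qed
  with l(1) show ?thesis by (rule that)
qed

lemma integrable_lap_expectation:
  assumes "admissible \<phi>"
  shows "integrable (stable_intensity g) (\<lambda>x. 1 - exp (- \<phi> x))"
    and "(LINT \<omega>|M. exp (- total \<phi> \<omega>)) = exp (- lap \<phi>)"
proof -
  note [measurable] = admissible_measurable[OF assms] total_measurable[OF assms]
  obtain l where pos: "\<And>x. 0 \<le> x \<Longrightarrow> 0 \<le> \<phi> x" using assms by (rule admissibleE) blast
  have sm: "AE \<omega> in M. summable (\<lambda>i. \<phi> (J i \<omega>))" using assms by (simp add: admissible_def)
  define I where "I = (\<integral>\<^sup>+x. ennreal (1 - exp (- \<phi> x)) \<partial>stable_intensity g)"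
  have "(\<integral>\<^sup>+\<omega>. ennreal (exp (- total \<phi> \<omega>)) \<partial>M) = (\<integral>\<^sup>+\<omega>. ennreal (lexp (\<Sum>i. ennreal (\<phi> (J i \<omega>)))) \<partial>M)"
  proof (rule nn_integral_cong_AE, use AE_good sm in eventually_elim)
    case (elim \<omega>)
    have nn: "0 \<le> \<phi> (J i \<omega>)" for i using elim(1) pos by (simp add: good_def less_imp_le)
    have "(\<Sum>i. ennreal (\<phi> (J i \<omega>))) = ennreal (total \<phi> \<omega>)"
      unfolding total_def by (rule suminf_ennreal2[OF nn elim(2)])
    moreover have "0 \<le> total \<phi> \<omega>" unfolding total_def by (rule suminf_nonneg[OF elim(2) nn])
    ultimately show ?case by (simp add: lexp_ennreal)
  qed
  also have "\<dots> = ennreal (lexp I)"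
    unfolding I_def by (rule laplace_functional') (use pos in auto)
  finally have E: "(\<integral>\<^sup>+\<omega>. ennreal (exp (- total \<phi> \<omega>)) \<partial>M) = ennreal (lexp I)" .
  \<comment> \<open>An infinite integral would force the expectation of the strictly positive
    variable \<open>exp (- total \<phi>)\<close> to be 0.\<close>
  have "I \<noteq> \<infinity>"
  proof
    assume "I = \<infinity>"
    then have "(\<integral>\<^sup>+\<omega>. ennreal (exp (- total \<phi> \<omega>)) \<partial>M) = 0" using E by simp
    then have "AE \<omega> in M. ennreal (exp (- total \<phi> \<omega>)) = 0" by (subst (asm) nn_integral_0_iff_AE) auto
    then have "AE \<omega> in M. False" by eventually_elim (simp add: ennreal_eq_0_iff not_le[symmetric])
    then show False by simp
  qed
  have nn: "AE x in stable_intensity g. 0 \<le> 1 - exp (- \<phi> x)"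
    using AE_stable_intensity_pos by eventually_elim (simp add: pos)
  show int: "integrable (stable_intensity g) (\<lambda>x. 1 - exp (- \<phi> x))"
    by (rule integrableI_nonneg) (use \<open>I \<noteq> \<infinity>\<close> nn in \<open>auto simp: I_def less_top\<close>)
  have I: "I = ennreal (lap \<phi>)" unfolding I_def lap_def by (rule nn_integral_eq_integral[OF int nn])
  moreover have "0 \<le> lap \<phi>" unfolding lap_def by (rule integral_nonneg_AE[OF nn])
  ultimately have "(\<integral>\<^sup>+\<omega>. ennreal (exp (- total \<phi> \<omega>)) \<partial>M) = ennreal (exp (- lap \<phi>))"
    using E by (simp add: lexp_ennreal)
  then show "(LINT \<omega>|M. exp (- total \<phi> \<omega>)) = exp (- lap \<phi>)"
    by (subst integral_eq_nn_integral) auto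
qed

lemma integrable_mom:
  assumes "admissible \<phi>" "1 \<le> n"
  shows "integrable (stable_intensity g) (\<lambda>x. x ^ n * exp (- \<phi> x))"
proof -
  note [measurable] = admissible_measurable[OF assms(1)]
  obtain l where l: "0 < l" "\<And>x. 0 \<le> x \<Longrightarrow> l * x \<le> \<phi> x" using assms(1) by (rule admissibleE) blast
  have nn: "AE x in stable_intensity g. 0 \<le> x ^ n * exp (- \<phi> x)"
    using AE_stable_intensity_pos by eventually_elim simp
  have "(\<integral>\<^sup>+x. ennreal (x ^ n * exp (- \<phi> x)) \<partial>stable_intensity g) \<le> (\<integral>\<^sup>+x. ennreal (x ^ n * exp (- l * x)) \<partial>stable_intensity g)"
  proof (rule nn_integral_mono_AE, use AE_stable_intensity_pos in eventually_elim)
    case (elim x)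
    then show ?case using l(2)[of x] by (intro ennreal_leI mult_left_mono) auto
  qed
  also have "\<dots> < \<infinity>" using assms(2) by (subst nn_integral_stable_moment[OF g _ l(1)]) auto
  finally show ?thesis using nn by (intro integrableI_nonneg) auto
qed

lemma tilt_mom:
  assumes "admissible \<phi>" "1 \<le> m" "1 \<le> n"
  shows "((\<lambda>t. mom m (\<lambda>x. \<phi> x + t * x ^ n)) has_real_derivative - mom (m + n) \<phi>) (at 0 within {0..})"
proof -
  note [measurable] = admissible_measurable[OF assms(1)]
  have "((\<lambda>t. LINT x|stable_intensity g. 0 + x ^ m * exp (- \<phi> x) * exp (- t * x ^ n)) has_real_derivative
      - (LINT x|stable_intensity g. x ^ m * exp (- \<phi> x) * x ^ n)) (at 0 within {0..})"
  proof (rule has_right_derivative_exp_tilt)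
    show "AE x in stable_intensity g. 0 \<le> x ^ n" using AE_stable_intensity_pos by eventually_elim simp
    show "integrable (stable_intensity g) (\<lambda>x. x ^ m * exp (- \<phi> x) * x ^ n)"
      using integrable_mom[OF assms(1), of "m + n"] assms(2) by (simp add: power_add mult_ac)
    show "integrable (stable_intensity g) (\<lambda>x. 0 + x ^ m * exp (- \<phi> x))"
      using integrable_mom[OF assms(1,2)] by simp
  qed measurable
  then show ?thesis
    by (simp add: mom_def exp_add[symmetric] exp_diff exp_minus power_add divide_inverse mult_ac)
qed

lemma tilt_lap:
  assumes "admissible \<phi>" "1 \<le> n"
  shows "((\<lambda>t. lap (\<lambda>x. \<phi> x + t * x ^ n)) has_real_derivative mom n \<phi>) (at 0 within {0..})"
proof -
  note [measurable] = admissible_measurable[OF assms(1)]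
  have "((\<lambda>t. LINT x|stable_intensity g. 1 + (- exp (- \<phi> x)) * exp (- t * x ^ n)) has_real_derivative
      - (LINT x|stable_intensity g. (- exp (- \<phi> x)) * x ^ n)) (at 0 within {0..})"
  proof (rule has_right_derivative_exp_tilt)
    show "AE x in stable_intensity g. 0 \<le> x ^ n" using AE_stable_intensity_pos by eventually_elim simp
    show "integrable (stable_intensity g) (\<lambda>x. - exp (- \<phi> x) * x ^ n)"
      using integrable_mom[OF assms] by (simp add: mult_ac)
    show "integrable (stable_intensity g) (\<lambda>x. 1 + - exp (- \<phi> x))"
      using integrable_lap_expectation(1)[OF assms(1)] by simp
  qed measurable
  then show ?thesis
    by (simp add: mom_def lap_def exp_add[symmetric] exp_diff exp_minus divide_inverse mult_ac)
qed

lemma integrable_point_sum: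
  assumes "admissible \<phi>" "\<forall>m\<in>set ns. 1 \<le> m"
  shows "integrable M (\<lambda>\<omega>. point_sum ns \<omega> * exp (- total \<phi> \<omega>))"
    and "1 \<le> n \<Longrightarrow> integrable M (\<lambda>\<omega>. point_sum ns \<omega> * exp (- total \<phi> \<omega>) * power_sum n \<omega>)"
proof -
  note [measurable] = total_measurable[OF assms(1)]
  obtain l where l: "0 < l" "AE \<omega> in M. l * T \<omega> \<le> total \<phi> \<omega>" using AE_total_ge[OF assms(1)] by blast
  \<comment> \<open>Since \<open>total \<phi>\<close> is at least \<open>l * T\<close>, a factor
    growing like \<open>T ^ N\<close> is absorbed by the exponential.\<close>
  have bounded: "integrable M (\<lambda>\<omega>. h \<omega> * exp (- total \<phi> \<omega>))"
    if h: "h \<in> borel_measurable M" "\<And>\<omega>. good \<omega> \<Longrightarrow> \<bar>h \<omega>\<bar> \<le> T \<omega> ^ N" for h N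
  proof -
    obtain C where C: "\<And>x. 0 \<le> x \<Longrightarrow> x ^ N * exp (- l * x) \<le> C" using power_times_exp_bounded[OF l(1)] by blast
    show ?thesis
    proof (rule integrable_const_bound)
      show "AE \<omega> in M. norm (h \<omega> * exp (- total \<phi> \<omega>)) \<le> C"
        using AE_good l(2)
      proof eventually_elim
        case (elim \<omega>)
        have "norm (h \<omega> * exp (- total \<phi> \<omega>)) = \<bar>h \<omega>\<bar> * exp (- total \<phi> \<omega>)" by (simp add: abs_mult)
        also have "\<dots> \<le> T \<omega> ^ N * exp (- l * T \<omega>)"
          using h(2)[OF elim(1)] elim(2) good_T_pos[OF elim(1)] by (intro mult_mono) auto
        also have "\<dots> \<le> C" using C[of "T \<omega>"] good_T_pos[OF elim(1)] by simp
        finally show ?case .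
      qed
      show "(\<lambda>\<omega>. h \<omega> * exp (- total \<phi> \<omega>)) \<in> borel_measurable M" using h(1) by measurable
    qed
  qed
  show "integrable M (\<lambda>\<omega>. point_sum ns \<omega> * exp (- total \<phi> \<omega>))"
    using good_point_sum(2,3)[OF _ assms(2)] by (intro bounded[of _ "sum_list ns"]) auto
  assume n: "1 \<le> n"
  have "integrable M (\<lambda>\<omega>. (point_sum ns \<omega> * power_sum n \<omega>) * exp (- total \<phi> \<omega>))"
  proof (rule bounded[of _ "sum_list ns + n"])
    fix \<omega> assume gd: "good \<omega>"
    have "point_sum ns \<omega> * power_sum n \<omega> \<le> T \<omega> ^ sum_list ns * T \<omega> ^ n"
      using good_point_sum(2,3)[OF gd assms(2)] good_power_sum(2,3)[OF gd n] good_T_pos[OF gd]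
      by (intro mult_mono) auto
    then show "\<bar>point_sum ns \<omega> * power_sum n \<omega>\<bar> \<le> T \<omega> ^ (sum_list ns + n)"
      using good_point_sum(2)[OF gd assms(2)] good_power_sum(2)[OF gd n] by (simp add: power_add)
  qed measurable
  then show "integrable M (\<lambda>\<omega>. point_sum ns \<omega> * exp (- total \<phi> \<omega>) * power_sum n \<omega>)"
    by (simp add: mult_ac)
qed

text \<open>Differentiating the formula for \<open>k\<close> points along \<open>\<phi> + t x ^ n\<close> at \<open>t = 0\<close> brings down one more
  factor \<open>\<Sum>i. J i ^ n\<close>, whose product with a sum over \<open>k\<close> distinct points splits into a sum over
  \<open>k + 1\<close> distinct points and \<open>k\<close> sums over \<open>k\<close> points.\<close>

theorem point_sum_expectation:
  assumes "\<forall>m\<in>set ns. 1 \<le> m" "admissible \<phi>"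
  shows "(LINT \<omega>|M. point_sum ns \<omega> * exp (- total \<phi> \<omega>)) = (\<Prod>l<length ns. mom (ns ! l) \<phi>) * exp (- lap \<phi>)"
  using assms
\<comment> \<open>The exponent is generalized because the hypothesis is needed at the tilted ones,
  and the list because it is needed at those with one entry increased. Both keep the length, which
  is why the induction is on the length.\<close>
proof (induction "length ns" arbitrary: ns \<phi>)
  case 0
  then have "ns = []" by simp
  then show ?case using integrable_lap_expectation(2)[OF 0(3)] by (simp add: point_sum_def)
next
  case (Suc k ns' \<phi>)
  then obtain n ns where ns': "ns' = n # ns" and k: "k = length ns" by (cases ns') auto
  have n: "1 \<le> n" and ns: "\<forall>m\<in>set ns. 1 \<le> m" using Suc.prems(1) ns' by auto
  note adm = \<open>admissible \<phi>\<close>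
  note [measurable] = total_measurable[OF adm]
  have upd: "\<forall>m\<in>set (ns[l := ns ! l + n]). 1 \<le> m" for l
    using ns n set_update_subset_insert[of ns l "ns ! l + n"] by auto
  define L where "L t = (LINT \<omega>|M. 0 + point_sum ns \<omega> * exp (- total \<phi> \<omega>) * exp (- t * power_sum n \<omega>))" for t
  define R where "R t = (\<Prod>l<k. mom (ns ! l) (\<lambda>x. \<phi> x + t * x ^ n)) * exp (- lap (\<lambda>x. \<phi> x + t * x ^ n))" for t
  have LR: "L t = R t" if t: "0 \<le> t" for t
  proof -
    have "L t = (LINT \<omega>|M. point_sum ns \<omega> * exp (- total (\<lambda>x. \<phi> x + t * x ^ n) \<omega>))"
      unfolding L_def
    proof (rule integral_cong_AE)
      show "AE \<omega> in M. 0 + point_sum ns \<omega> * exp (- total \<phi> \<omega>) * exp (- t * power_sum n \<omega>) =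
          point_sum ns \<omega> * exp (- total (\<lambda>x. \<phi> x + t * x ^ n) \<omega>)"
        using AE_total_add_power[OF adm n, of t]
        by eventually_elim (simp add: exp_add[symmetric] mult.assoc)
      show "(\<lambda>\<omega>. point_sum ns \<omega> * exp (- total (\<lambda>x. \<phi> x + t * x ^ n) \<omega>)) \<in> borel_measurable M"
        using total_measurable[OF admissible_add_power[OF adm n t]] by measurable
    qed measurable
    also have "\<dots> = R t"
      unfolding R_def k by (rule Suc.hyps(1)[OF k ns admissible_add_power[OF adm n t]])
    finally show ?thesis .
  qed
  have "(L has_real_derivative - (LINT \<omega>|M. point_sum ns \<omega> * exp (- total \<phi> \<omega>) * power_sum n \<omega>)) (at 0 within {0..})"
    unfolding L_def
  proof (rule has_right_derivative_exp_tilt)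
    show "AE \<omega> in M. 0 \<le> power_sum n \<omega>" using AE_good by eventually_elim (rule good_power_sum(2)[OF _ n])
  qed (use integrable_point_sum[OF adm ns] n in auto)
  moreover have "(R has_real_derivative
      (\<Prod>l<k. mom (ns ! l) \<phi>) * (exp (- lap \<phi>) * - mom n \<phi>)
      + (\<Sum>l<k. - mom (ns ! l + n) \<phi> * (\<Prod>j\<in>{..<k} - {l}. mom (ns ! j) \<phi>)) * exp (- lap \<phi>)) (at 0 within {0..})"
  proof -
    have P: "((\<lambda>t. \<Prod>l<k. mom (ns ! l) (\<lambda>x. \<phi> x + t * x ^ n)) has_real_derivative
       (\<Sum>l<k. - mom (ns ! l + n) \<phi> * (\<Prod>j\<in>{..<k} - {l}. mom (ns ! j) (\<lambda>x. \<phi> x + 0 * x ^ n)))) (at 0 within {0..})"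
      using ns k by (intro has_field_derivative_prod_within tilt_mom adm n) auto
    have E: "((\<lambda>t. exp (- lap (\<lambda>x. \<phi> x + t * x ^ n))) has_real_derivative
        exp (- lap (\<lambda>x. \<phi> x + 0 * x ^ n)) * - mom n \<phi>) (at 0 within {0..})"
      by (rule DERIV_chain2[OF DERIV_exp DERIV_minus[OF tilt_lap[OF adm n]]])
    show ?thesis unfolding R_def using DERIV_mult'[OF P E] by simp
  qed
  ultimately have eq: "- (LINT \<omega>|M. point_sum ns \<omega> * exp (- total \<phi> \<omega>) * power_sum n \<omega>) =
      (\<Prod>l<k. mom (ns ! l) \<phi>) * (exp (- lap \<phi>) * - mom n \<phi>)
      + (\<Sum>l<k. - mom (ns ! l + n) \<phi> * (\<Prod>j\<in>{..<k} - {l}. mom (ns ! j) \<phi>)) * exp (- lap \<phi>)"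
    by (rule right_derivative_unique) (rule LR)
  \<comment> \<open>The merged list still has length \<open>k\<close>, so the hypothesis evaluates
    it. These are exactly the terms that the product rule creates from the moments, and the two
    families cancel.\<close>
  have part: "(LINT \<omega>|M. point_sum (ns[l := ns ! l + n]) \<omega> * exp (- total \<phi> \<omega>)) =
      mom (ns ! l + n) \<phi> * (\<Prod>j\<in>{..<k} - {l}. mom (ns ! j) \<phi>) * exp (- lap \<phi>)" if "l < k" for l
  proof -
    have "(\<Prod>j<k. mom (ns[l := ns ! l + n] ! j) \<phi>) = mom (ns[l := ns ! l + n] ! l) \<phi> * (\<Prod>j\<in>{..<k} - {l}. mom (ns[l := ns ! l + n] ! j) \<phi>)"
      using that by (intro prod.remove) auto
    also have "(\<Prod>j\<in>{..<k} - {l}. mom (ns[l := ns ! l + n] ! j) \<phi>) = (\<Prod>j\<in>{..<k} - {l}. mom (ns ! j) \<phi>)"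
      by (intro prod.cong) auto
    finally show ?thesis
      using Suc.hyps(1)[of "ns[l := ns ! l + n]" \<phi>] k upd adm that by simp
  qed
  have "(LINT \<omega>|M. point_sum ns \<omega> * exp (- total \<phi> \<omega>) * power_sum n \<omega>)
      = (LINT \<omega>|M. point_sum (n # ns) \<omega> * exp (- total \<phi> \<omega>) + (\<Sum>l<k. point_sum (ns[l := ns ! l + n]) \<omega> * exp (- total \<phi> \<omega>)))"
  proof (rule integral_cong_AE)
    show "AE \<omega> in M. point_sum ns \<omega> * exp (- total \<phi> \<omega>) * power_sum n \<omega>
      = point_sum (n # ns) \<omega> * exp (- total \<phi> \<omega>) + (\<Sum>l<k. point_sum (ns[l := ns ! l + n]) \<omega> * exp (- total \<phi> \<omega>))"
      using AE_good
    proof eventually_elim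
      case (elim \<omega>)
      have "point_sum ns \<omega> * exp (- total \<phi> \<omega>) * power_sum n \<omega> = (power_sum n \<omega> * point_sum ns \<omega>) * exp (- total \<phi> \<omega>)"
        by simp
      also have "\<dots> = (point_sum (n # ns) \<omega> + (\<Sum>l<k. point_sum (ns[l := ns ! l + n]) \<omega>)) * exp (- total \<phi> \<omega>)"
        using Suc.prems(1) unfolding ns' k by (subst good_point_sum_Cons[OF elim]) auto
      finally show ?case by (simp add: distrib_right sum_distrib_right)
    qed
  qed measurable
  also have "\<dots> = (LINT \<omega>|M. point_sum (n # ns) \<omega> * exp (- total \<phi> \<omega>))
      + (\<Sum>l<k. LINT \<omega>|M. point_sum (ns[l := ns ! l + n]) \<omega> * exp (- total \<phi> \<omega>))"
    using integrable_point_sum(1)[OF adm upd] integrable_point_sum(1)[OF adm, of "n # ns"] Suc.prems(1) ns'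
    by (subst Bochner_Integration.integral_add) auto
  also have "(\<Sum>l<k. LINT \<omega>|M. point_sum (ns[l := ns ! l + n]) \<omega> * exp (- total \<phi> \<omega>)) =
      (\<Sum>l<k. mom (ns ! l + n) \<phi> * (\<Prod>j\<in>{..<k} - {l}. mom (ns ! j) \<phi>)) * exp (- lap \<phi>)"
    by (simp add: part sum_distrib_right)
  \<comment> \<open>What survives is the derivative of \<open>exp (- lap \<phi>)\<close>, which
    contributes the new factor \<open>mom n \<phi>\<close>.\<close>
  finally have "(LINT \<omega>|M. point_sum (n # ns) \<omega> * exp (- total \<phi> \<omega>)) = mom n \<phi> * (\<Prod>l<k. mom (ns ! l) \<phi>) * exp (- lap \<phi>)"
    using eq by (simp add: sum_negf algebra_simps)
  then show ?case
    unfolding ns' by (simp add: prod.lessThan_Suc_shift k del: prod.lessThan_Suc)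
qed

text \<open>For the exponent \<open>l * x\<close> the total is \<open>l * T\<close>. An entry
  \<open>m\<close> of \<open>ns\<close> contributes the power \<open>g - m\<close> of
  \<open>l\<close>, and these exponents add up to the number of entries times \<open>g\<close>,
  minus their sum.\<close>

corollary nn_integral_point_sum:
  assumes "\<forall>m\<in>set ns. 1 \<le> m" "0 < l"
  shows "(\<integral>\<^sup>+\<omega>. dsum ns (\<lambda>i. J i \<omega>) * ennreal (exp (- l * T \<omega>)) \<partial>M) =
    ennreal (g ^ length ns * (\<Prod>j<length ns. pochhammer (1 - g) (ns ! j - 1)) * l powr (real (length ns) * g - real (sum_list ns)) * exp (- (l powr g)))"
proof -
  have adm: "admissible (\<lambda>x. l * x)" by (rule admissible_linear[OF assms(2)])
  have tot: "AE \<omega> in M. total (\<lambda>x. l * x) \<omega> = l * T \<omega>"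
    using AE_summable unfolding total_def inv_local_time_def by eventually_elim (rule suminf_mult)
  have mom: "mom n (\<lambda>x. l * x) = g * pochhammer (1 - g) (n - 1) * l powr (g - real n)" if "1 \<le> n" for n
  proof -
    have nn: "AE x in stable_intensity g. 0 \<le> x ^ n * exp (- (l * x))"
      using AE_stable_intensity_pos by eventually_elim simp
    have "mom n (\<lambda>x. l * x) = enn2real (\<integral>\<^sup>+x. ennreal (x ^ n * exp (- (l * x))) \<partial>stable_intensity g)"
      unfolding mom_def by (rule integral_eq_nn_integral[OF _ nn]) measurable
    also have "\<dots> = enn2real (ennreal (g * pochhammer (1 - g) (n - 1) * l powr (g - real n)))"
      using nn_integral_stable_moment[OF g _ assms(2), of n] that by simp
    also have "\<dots> = g * pochhammer (1 - g) (n - 1) * l powr (g - real n)"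
      using g by (intro enn2real_ennreal mult_nonneg_nonneg pochhammer_nonneg) auto
    finally show ?thesis .
  qed
  have lap: "lap (\<lambda>x. l * x) = l powr g"
  proof -
    have nn: "AE x in stable_intensity g. 0 \<le> 1 - exp (- (l * x))"
      using AE_stable_intensity_pos by eventually_elim (use assms(2) in simp)
    have "lap (\<lambda>x. l * x) = enn2real (\<integral>\<^sup>+x. ennreal (1 - exp (- (l * x))) \<partial>stable_intensity g)"
      unfolding lap_def by (rule integral_eq_nn_integral[OF _ nn]) measurable
    then show ?thesis using nn_integral_stable_exponent[OF g, of l] assms(2) by simp
  qed
  have "(\<integral>\<^sup>+\<omega>. dsum ns (\<lambda>i. J i \<omega>) * ennreal (exp (- l * T \<omega>)) \<partial>M)
      = (\<integral>\<^sup>+\<omega>. ennreal (point_sum ns \<omega> * exp (- total (\<lambda>x. l * x) \<omega>)) \<partial>M)"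
  proof (rule nn_integral_cong_AE, use AE_good tot in eventually_elim)
    case (elim \<omega>)
    then show ?case
      using good_point_sum(1,2)[OF elim(1) assms(1)] by (simp add: ennreal_mult)
  qed
  also have "\<dots> = ennreal (LINT \<omega>|M. point_sum ns \<omega> * exp (- total (\<lambda>x. l * x) \<omega>))"
    by (rule nn_integral_eq_integral[OF integrable_point_sum(1)[OF adm assms(1)]]) (simp add: point_sum_def)
  also have "(LINT \<omega>|M. point_sum ns \<omega> * exp (- total (\<lambda>x. l * x) \<omega>)) = (\<Prod>j<length ns. mom (ns ! j) (\<lambda>x. l * x)) * exp (- (l powr g))"
    unfolding point_sum_expectation[OF assms(1) adm] lap ..
  also have "(\<Prod>j<length ns. mom (ns ! j) (\<lambda>x. l * x)) = (\<Prod>j<length ns. g * pochhammer (1 - g) (ns ! j - 1) * l powr (g - real (ns ! j)))"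
    using assms(1) by (intro prod.cong mom) auto
  also have "\<dots> = g ^ length ns * (\<Prod>j<length ns. pochhammer (1 - g) (ns ! j - 1)) * (\<Prod>j<length ns. l powr (g - real (ns ! j)))"
    by (simp add: prod.distrib)
  also have "(\<Prod>j<length ns. l powr (g - real (ns ! j))) = l powr (\<Sum>j<length ns. g - real (ns ! j))"
    using assms(2) by (simp add: powr_sum)
  also have "(\<Sum>j<length ns. g - real (ns ! j)) = real (length ns) * g - real (sum_list ns)"
    by (simp add: sum_subtractf sum_list_sum_nth lessThan_atLeast0)
  finally show ?thesis .
qed

end

section \<open>Transforms of fractional integrals, negative moments and the densities of the
  quotients\<close>

text \<open>The inner integral is \<open>Gamma a\<close> times the fractional integral of order
  \<open>a\<close> of \<open>F\<close>. Convolution with a power multiplies the transform by that of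
  the power, so negative powers of \<open>l\<close> in a transform can be undone.\<close>

lemma nn_integral_exp_convolution:
  fixes F :: "real \<Rightarrow> ennreal"
  assumes "0 < a" "0 < l" and [measurable]: "F \<in> borel_measurable borel"
  shows "(\<integral>\<^sup>+u. ennreal (exp (- l * u)) * (\<integral>\<^sup>+v. indicator {0<..} (u - v) * ennreal ((u - v) powr (a - 1)) * F v \<partial>lborel) \<partial>lborel) =
    ennreal (Gamma a * l powr (- a)) * (\<integral>\<^sup>+v. ennreal (exp (- l * v)) * F v \<partial>lborel)"
proof -
  have inner: "(\<integral>\<^sup>+u. ennreal (exp (- l * u)) * (indicator {0<..} (u - v) * ennreal ((u - v) powr (a - 1)) * F v) \<partial>lborel)
      = ennreal (Gamma a * l powr (- a)) * (ennreal (exp (- l * v)) * F v)" for v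
  proof -
    have "(\<integral>\<^sup>+u. ennreal (exp (- l * u)) * (indicator {0<..} (u - v) * ennreal ((u - v) powr (a - 1)) * F v) \<partial>lborel)
        = (\<integral>\<^sup>+x. ennreal (exp (- l * (v + x))) * (indicator {0<..} x * ennreal (x powr (a - 1)) * F v) \<partial>lborel)"
      by (subst nn_integral_real_affine[of _ 1 v]) auto
    also have "\<dots> = (\<integral>\<^sup>+x. (ennreal (exp (- l * v)) * F v) * (indicator {0<..} x * ennreal (x powr (a - 1) * exp (- l * x))) \<partial>lborel)"
      by (intro nn_integral_cong) (auto simp: indicator_def distrib_left exp_diff exp_minus ennreal_mult divide_inverse mult_ac exp_add)
    also have "\<dots> = (ennreal (exp (- l * v)) * F v) * ennreal (Gamma a * l powr (- a))"
      by (subst nn_integral_cmult) (auto simp: nn_integral_gamma[OF assms(1,2), simplified])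
    finally show ?thesis by (simp only: mult.commute)
  qed
  have "(\<integral>\<^sup>+u. ennreal (exp (- l * u)) * (\<integral>\<^sup>+v. indicator {0<..} (u - v) * ennreal ((u - v) powr (a - 1)) * F v \<partial>lborel) \<partial>lborel)
      = (\<integral>\<^sup>+u. (\<integral>\<^sup>+v. ennreal (exp (- l * u)) * (indicator {0<..} (u - v) * ennreal ((u - v) powr (a - 1)) * F v) \<partial>lborel) \<partial>lborel)"
    by (intro nn_integral_cong nn_integral_cmult[symmetric]) measurable
  also have "\<dots> = (\<integral>\<^sup>+v. (\<integral>\<^sup>+u. ennreal (exp (- l * u)) * (indicator {0<..} (u - v) * ennreal ((u - v) powr (a - 1)) * F v) \<partial>lborel) \<partial>lborel)"
    by (rule lborel_pair.Fubini'[symmetric]) measurable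
  also have "\<dots> = (\<integral>\<^sup>+v. ennreal (Gamma a * l powr (- a)) * (ennreal (exp (- l * v)) * F v) \<partial>lborel)"
    by (simp only: inner)
  also have "\<dots> = ennreal (Gamma a * l powr (- a)) * (\<integral>\<^sup>+v. ennreal (exp (- l * v)) * F v \<partial>lborel)"
    by (rule nn_integral_cmult) measurable
  finally show ?thesis .
qed

text \<open>The substitution \<open>b = 1 / u\<close> moves the singular exponential to
  \<open>exp (- c * u)\<close> on \<open>{1<..}\<close>, and a shift by 1 leaves a Gamma integral.
  The exponent of \<open>b\<close> is the one for which no power of \<open>u\<close> is left
  over.\<close>

lemma nn_integral_beta_exp:
  assumes "0 < a" "0 < c"
  shows "(\<integral>\<^sup>+b. indicator {0<..<1} b * ennreal (b powr (- a - 1) * (1 - b) powr (a - 1) * exp (- c / b)) \<partial>lborel)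
    = ennreal (Gamma a * c powr (- a) * exp (- c))"
proof -
  have "(\<integral>\<^sup>+b. indicator {0<..<1} b * ennreal (b powr (- a - 1) * (1 - b) powr (a - 1) * exp (- c / b)) \<partial>lborel)
      = (\<integral>\<^sup>+b. indicator {0<..} b * (indicator {..<1} b * ennreal (b powr (- a - 1) * (1 - b) powr (a - 1) * exp (- c / b))) \<partial>lborel)"
    by (intro nn_integral_cong) (auto simp: indicator_def)
  also have "\<dots> = (\<integral>\<^sup>+u. indicator {0<..} u * ennreal (1 / u ^ 2) * (indicator {..<1} (1 / u) *
      ennreal ((1 / u) powr (- a - 1) * (1 - 1 / u) powr (a - 1) * exp (- c / (1 / u)))) \<partial>lborel)"
    by (rule nn_integral_inverse_subst) measurable
  also have "\<dots> = (\<integral>\<^sup>+u. indicator {1<..} u * ennreal ((u - 1) powr (a - 1) * exp (- c * u)) \<partial>lborel)"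
  proof (intro nn_integral_cong)
    fix u :: real
    show "indicator {0<..} u * ennreal (1 / u ^ 2) * (indicator {..<1} (1 / u) *
        ennreal ((1 / u) powr (- a - 1) * (1 - 1 / u) powr (a - 1) * exp (- c / (1 / u))))
      = indicator {1<..} u * ennreal ((u - 1) powr (a - 1) * exp (- c * u))"
    proof (cases "1 < u")
      case True
      have "1 / u ^ 2 = u powr (- 2)" using True by (simp add: powr_minus divide_inverse powr_numeral)
      moreover have "(1 / u) powr (- a - 1) = u powr (a + 1)"
        using True by (simp add: powr_divide powr_minus[symmetric] powr_diff powr_add field_simps powr_minus)
      moreover have "(1 - 1 / u) powr (a - 1) = (u - 1) powr (a - 1) * u powr (1 - a)"
      proof -
        have "1 - 1 / u = (u - 1) / u" using True by (simp add: field_simps)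
        then have "(1 - 1 / u) powr (a - 1) = (u - 1) powr (a - 1) / u powr (a - 1)"
          using True by (simp add: powr_divide)
        also have "\<dots> = (u - 1) powr (a - 1) * u powr (- (a - 1))" by (simp only: powr_minus divide_inverse)
        finally show ?thesis by simp
      qed
      ultimately have "1 / u ^ 2 * ((1 / u) powr (- a - 1) * (1 - 1 / u) powr (a - 1) * exp (- c / (1 / u)))
          = (u powr (- 2) * u powr (a + 1) * u powr (1 - a)) * ((u - 1) powr (a - 1) * exp (- c * u))"
        by (simp add: mult_ac)
      \<comment> \<open>The Jacobian and the two remaining powers cancel, as
        \<open>-2 + (a + 1) + (1 - a) = 0\<close>.\<close>
      also have "u powr (- 2) * u powr (a + 1) * u powr (1 - a) = 1"
        using True by (simp add: powr_add[symmetric])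
      finally show ?thesis using True by (simp add: ennreal_mult[symmetric] del: power2_eq_square)
    next
      case False
      then have "\<not> (0 < u \<and> 1 / u < 1)" by (auto simp: field_simps)
      then show ?thesis using False by (auto simp: indicator_def)
    qed
  qed
  also have "\<dots> = (\<integral>\<^sup>+x. indicator {1<..} (1 + x) * ennreal ((1 + x - 1) powr (a - 1) * exp (- c * (1 + x))) \<partial>lborel)"
    by (subst nn_integral_real_affine[of _ 1 1]) auto
  also have "\<dots> = (\<integral>\<^sup>+x. ennreal (exp (- c)) * (indicator {0<..} x * ennreal (x powr (a - 1) * exp (- c * x))) \<partial>lborel)"
    by (intro nn_integral_cong) (auto simp: indicator_def distrib_left exp_diff exp_minus divide_inverse mult_ac exp_add simp flip: ennreal_mult)
  also have "\<dots> = ennreal (exp (- c)) * ennreal (Gamma a * c powr (- a))"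
    by (subst nn_integral_cmult) (auto simp: nn_integral_gamma[OF assms, simplified])
  also have "\<dots> = ennreal (Gamma a * c powr (- a) * exp (- c))"
    using assms Gamma_real_pos[of a] by (simp add: mult_ac flip: ennreal_mult)
  finally show ?thesis .
qed

lemma pos_density_measurable:
  assumes "pos_density f"
  shows "f \<in> borel_measurable borel"
proof -
  have "(\<lambda>x. indicator {0<..} x *\<^sub>R f x) \<in> borel_measurable borel"
    using assms by (intro borel_measurable_continuous_on_indicator) (auto simp: pos_density_def)
  moreover have "(\<lambda>x. indicator {0<..} x *\<^sub>R f x) = f"
    using assms by (auto simp: pos_density_def indicator_def fun_eq_iff)
  ultimately show ?thesis by simp
qed

lemma pos_density_nonneg: "pos_density f \<Longrightarrow> 0 \<le> f x"
  by (cases "0 < x") (auto simp: pos_density_def)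

lemma pos_density_eq_0: "pos_density f \<Longrightarrow> x \<le> 0 \<Longrightarrow> f x = 0"
  by (simp add: pos_density_def)

lemma stable_densityD:
  assumes "stable_density g f"
  shows "pos_density f" "f \<in> borel_measurable borel" "0 \<le> f x" "x \<le> 0 \<Longrightarrow> f x = 0"
    "0 \<le> l \<Longrightarrow> (\<integral>\<^sup>+x. ennreal (exp (- l * x)) * ennreal (f x) \<partial>lborel) = ennreal (exp (- (l powr g)))"
proof -
  show "pos_density f" using assms by (simp add: stable_density_def)
  then show "f \<in> borel_measurable borel" "0 \<le> f x" "x \<le> 0 \<Longrightarrow> f x = 0" for x
    by (simp_all add: pos_density_measurable pos_density_nonneg pos_density_eq_0)
  show "(\<integral>\<^sup>+x. ennreal (exp (- l * x)) * ennreal (f x) \<partial>lborel) = ennreal (exp (- (l powr g)))" if "0 \<le> l"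
    using assms that by (simp add: stable_density_def ennreal_mult')
qed

text \<open>A negative power is a mixture of exponentials: integrating
  \<open>l powr (\<theta> - 1) * exp (- l * u)\<close> over \<open>l\<close> gives
  \<open>Gamma \<theta> * u powr (- \<theta>)\<close>. Exchanging the integrals leaves only the
  transform of \<open>f\<close>. With \<open>\<theta> = j * \<beta>\<close> this is the normalizing
  constant of \<open>tilted_density\<close>.\<close>

lemma stable_negative_moment:
  assumes f: "stable_density g f" and "0 < g" "0 < \<theta>"
  shows "(\<integral>\<^sup>+u. indicator {0<..} u * ennreal (u powr (- \<theta>) * f u) \<partial>lborel) = ennreal (Gamma (\<theta> / g) / (g * Gamma \<theta>))"
proof -
  note [measurable] = stable_densityD(2)[OF f]
  have G: "0 < Gamma \<theta>" by (rule Gamma_real_pos[OF assms(3)])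
  have inner: "(\<integral>\<^sup>+l. indicator {0<..} l * ennreal (l powr (\<theta> - 1)) * (ennreal (exp (- l * u)) * ennreal (f u)) \<partial>lborel)
      = ennreal (Gamma \<theta>) * (indicator {0<..} u * ennreal (u powr (- \<theta>) * f u))" for u
  proof (cases "0 < u")
    case True
    have "(\<integral>\<^sup>+l. indicator {0<..} l * ennreal (l powr (\<theta> - 1)) * (ennreal (exp (- l * u)) * ennreal (f u)) \<partial>lborel)
        = (\<integral>\<^sup>+l. ennreal (f u) * (indicator {0<..} l * ennreal (l powr (\<theta> - 1) * exp (- u * l))) \<partial>lborel)"
      by (intro nn_integral_cong) (simp add: ennreal_mult mult_ac)
    also have "\<dots> = ennreal (f u) * ennreal (Gamma \<theta> * u powr (- \<theta>))"
      by (subst nn_integral_cmult) (auto simp: nn_integral_gamma[OF assms(3) True, simplified])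
    also have "\<dots> = ennreal (Gamma \<theta>) * (indicator {0<..} u * ennreal (u powr (- \<theta>) * f u))"
      using True G stable_densityD(3)[OF f, of u] by (simp add: mult_ac flip: ennreal_mult)
    finally show ?thesis .
  next
    case False
    then show ?thesis using stable_densityD(4)[OF f, of u] by simp
  qed
  have "ennreal (Gamma (\<theta> / g) / g) = (\<integral>\<^sup>+l. indicator {0<..} l * ennreal (l powr (\<theta> / g * g - 1) * exp (- (l powr g))) \<partial>lborel)"
    by (rule nn_integral_gamma_powr[symmetric]) (use assms in auto)
  also have "\<dots> = (\<integral>\<^sup>+l. indicator {0<..} l * ennreal (l powr (\<theta> - 1)) * (\<integral>\<^sup>+u. ennreal (exp (- l * u)) * ennreal (f u) \<partial>lborel) \<partial>lborel)"
  proof (intro nn_integral_cong)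
    fix l :: real
    show "indicator {0<..} l * ennreal (l powr (\<theta> / g * g - 1) * exp (- (l powr g)))
      = indicator {0<..} l * ennreal (l powr (\<theta> - 1)) * (\<integral>\<^sup>+u. ennreal (exp (- l * u)) * ennreal (f u) \<partial>lborel)"
      using stable_densityD(5)[OF f, of l] assms(2) by (cases "0 < l") (simp_all add: ennreal_mult)
  qed
  also have "\<dots> = (\<integral>\<^sup>+l. (\<integral>\<^sup>+u. indicator {0<..} l * ennreal (l powr (\<theta> - 1)) * (ennreal (exp (- l * u)) * ennreal (f u)) \<partial>lborel) \<partial>lborel)"
    by (intro nn_integral_cong nn_integral_cmult[symmetric]) measurable
  also have "\<dots> = (\<integral>\<^sup>+u. (\<integral>\<^sup>+l. indicator {0<..} l * ennreal (l powr (\<theta> - 1)) * (ennreal (exp (- l * u)) * ennreal (f u)) \<partial>lborel) \<partial>lborel)"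
    by (rule lborel_pair.Fubini'[symmetric]) measurable
  also have "\<dots> = ennreal (Gamma \<theta>) * (\<integral>\<^sup>+u. indicator {0<..} u * ennreal (u powr (- \<theta>) * f u) \<partial>lborel)"
    unfolding inner by (rule nn_integral_cmult) measurable
  finally have "ennreal (1 / Gamma \<theta>) * ennreal (Gamma (\<theta> / g) / g) = ennreal (1 / Gamma \<theta>) *
      (ennreal (Gamma \<theta>) * (\<integral>\<^sup>+u. indicator {0<..} u * ennreal (u powr (- \<theta>) * f u) \<partial>lborel))" by simp
  then show ?thesis
    using G Gamma_real_pos[of "\<theta> / g"] assms by (simp add: mult.assoc[symmetric] mult.commute flip: ennreal_mult)
qed

text \<open>Put \<open>\<theta> = j * \<beta>\<close> and \<open>a = n - \<theta>\<close>. The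
  weight \<open>y ^ n\<close>, with \<open>y = t / b\<close>, lowers the exponent of
  \<open>b\<close> from \<open>\<theta> - 1\<close> to \<open>- a - 1\<close>, so that
  \<open>nn_integral_beta_exp\<close> applies at \<open>c = l * t\<close> and returns the power
  \<open>- a\<close> of \<open>l * t\<close>. Since \<open>\<theta> + a = n\<close>, all powers of
  \<open>t\<close> then cancel and the transform of \<open>f\<close> remains.\<close>

lemma Y_density_laplace:
  assumes f: "stable_density \<beta> f" and Y: "Y_density f \<beta> n j h"
    and "0 < \<beta>" "\<beta> < 1" "1 \<le> j" "j \<le> n" "0 < l"
  shows "(\<integral>\<^sup>+y. ennreal (y ^ n * exp (- l * y)) * ennreal (h y) \<partial>lborel)
    = ennreal (\<beta> * Gamma n / Gamma j * l powr (j * \<beta> - n) * exp (- (l powr \<beta>)))"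
proof -
  note [measurable] = stable_densityD(2)[OF f]
  define \<theta> where "\<theta> = real j * \<beta>"
  define a where "a = real n - real j * \<beta>"
  have "0 < \<theta>" using assms by (simp add: \<theta>_def)
  have "real j * \<beta> < real j" using assms by simp
  then have "0 < a" using \<open>j \<le> n\<close> unfolding a_def by linarith
  note Gp = Gamma_real_pos[OF \<open>0 < \<theta>\<close>] Gamma_real_pos[OF \<open>0 < a\<close>]
  have Gn: "0 < Gamma (real n)" "0 < Gamma (real j)" using assms by (auto intro!: Gamma_real_pos)
  \<comment> \<open>The negative moment of order \<open>\<theta>\<close>, where
    \<open>\<theta> / \<beta>\<close> is the integer \<open>j\<close>.\<close>
  define E where "E = Gamma (real j) / (\<beta> * Gamma \<theta>)"
  have E: "0 < E" using Gn Gp assms by (simp add: E_def)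
  have Eint: "(LINT u:{0<..}|lborel. u powr (- \<theta>) * f u) = E"
  proof -
    have "(LINT u:{0<..}|lborel. u powr (- \<theta>) * f u) = enn2real (\<integral>\<^sup>+u. ennreal (indicator {0<..} u *\<^sub>R (u powr (- \<theta>) * f u)) \<partial>lborel)"
      unfolding set_lebesgue_integral_def
      by (rule integral_eq_nn_integral) (use stable_densityD(3)[OF f] in \<open>auto simp: indicator_def\<close>)
    also have "(\<integral>\<^sup>+u. ennreal (indicator {0<..} u *\<^sub>R (u powr (- \<theta>) * f u)) \<partial>lborel) = (\<integral>\<^sup>+u. indicator {0<..} u * ennreal (u powr (- \<theta>) * f u) \<partial>lborel)"
      by (intro nn_integral_cong) (auto simp: indicator_def)
    also have "\<dots> = ennreal E"
      using stable_negative_moment[OF f \<open>0 < \<beta>\<close> \<open>0 < \<theta>\<close>] assms by (simp add: E_def \<theta>_def)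
    finally show ?thesis using E by simp
  qed
  have Beta: "Beta \<theta> a = Gamma \<theta> * Gamma a / Gamma (real n)"
    by (simp add: Beta_def \<theta>_def a_def)
  define P1 where "P1 = density lborel (\<lambda>t. ennreal (tilted_density f \<theta> t))"
  define P2 where "P2 = density lborel (\<lambda>b. ennreal (beta_density \<theta> a b))"
  have td [measurable]: "tilted_density f \<theta> \<in> borel_measurable borel"
    unfolding tilted_density_def[abs_def] by measurable
  have bd [measurable]: "beta_density \<theta> a \<in> borel_measurable borel"
    unfolding beta_density_def[abs_def] by measurable
  have [measurable_cong]: "sets P1 = sets borel" "sets P2 = sets borel" by (simp_all add: P1_def P2_def)
  interpret P2: sigma_finite_measure P2
    unfolding P2_def by (subst sigma_finite_measure.sigma_finite_iff_density_finite[OF sigma_finite_lborel]) auto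
  have h: "pos_density h" and dist: "distributed (P1 \<Otimes>\<^sub>M P2) lborel (\<lambda>(t, b). t / b) (\<lambda>x. ennreal (h x))"
    using Y by (simp_all add: Y_density_def P1_def P2_def \<theta>_def a_def)
  note [measurable] = pos_density_measurable[OF h]
  have "(\<integral>\<^sup>+y. ennreal (y ^ n * exp (- l * y)) * ennreal (h y) \<partial>lborel) = (\<integral>\<^sup>+y. ennreal (y ^ n * exp (- l * y)) \<partial>density lborel (\<lambda>x. ennreal (h x)))"
    by (subst nn_integral_density) (auto simp: mult.commute)
  also have "density lborel (\<lambda>x. ennreal (h x)) = distr (P1 \<Otimes>\<^sub>M P2) lborel (\<lambda>(t, b). t / b)"
    using dist by (simp add: distributed_def)
  also have "(\<integral>\<^sup>+y. ennreal (y ^ n * exp (- l * y)) \<partial>distr (P1 \<Otimes>\<^sub>M P2) lborel (\<lambda>(t, b). t / b))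
      = (\<integral>\<^sup>+p. ennreal ((fst p / snd p) ^ n * exp (- l * (fst p / snd p))) \<partial>(P1 \<Otimes>\<^sub>M P2))"
    by (subst nn_integral_distr) (auto simp: split_beta')
  also have "\<dots> = (\<integral>\<^sup>+t. (\<integral>\<^sup>+b. ennreal ((t / b) ^ n * exp (- l * (t / b))) \<partial>P2) \<partial>P1)"
    by (subst P2.nn_integral_fst[symmetric]) auto
  also have "\<dots> = (\<integral>\<^sup>+t. ennreal (tilted_density f \<theta> t) * (\<integral>\<^sup>+b. ennreal (beta_density \<theta> a b) * ennreal ((t / b) ^ n * exp (- l * (t / b))) \<partial>lborel) \<partial>lborel)"
    unfolding P1_def P2_def by (subst nn_integral_density) (auto simp: nn_integral_density)
  also have "\<dots> = (\<integral>\<^sup>+t. ennreal (l powr (- a) * Gamma (real n) / (Gamma \<theta> * E)) * (ennreal (exp (- l * t)) * ennreal (f t)) \<partial>lborel)"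
  proof (intro nn_integral_cong)
    fix t :: real
    show "ennreal (tilted_density f \<theta> t) * (\<integral>\<^sup>+b. ennreal (beta_density \<theta> a b) * ennreal ((t / b) ^ n * exp (- l * (t / b))) \<partial>lborel)
      = ennreal (l powr (- a) * Gamma (real n) / (Gamma \<theta> * E)) * (ennreal (exp (- l * t)) * ennreal (f t))"
    proof (cases "0 < t")
      case True
      have "(\<integral>\<^sup>+b. ennreal (beta_density \<theta> a b) * ennreal ((t / b) ^ n * exp (- l * (t / b))) \<partial>lborel)
          = (\<integral>\<^sup>+b. ennreal (t ^ n / Beta \<theta> a) * (indicator {0<..<1} b * ennreal (b powr (- a - 1) * (1 - b) powr (a - 1) * exp (- (l * t) / b))) \<partial>lborel)"
      proof (intro nn_integral_cong)
        fix b :: real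
        show "ennreal (beta_density \<theta> a b) * ennreal ((t / b) ^ n * exp (- l * (t / b)))
          = ennreal (t ^ n / Beta \<theta> a) * (indicator {0<..<1} b * ennreal (b powr (- a - 1) * (1 - b) powr (a - 1) * exp (- (l * t) / b)))"
        proof (cases "b \<in> {0<..<1}")
          case b: True
          have "b powr (\<theta> - 1) * (t / b) ^ n = t ^ n * (b powr (\<theta> - 1) * b powr (- real n))"
            using b by (simp add: power_mult_distrib power_inverse powr_minus powr_realpow divide_inverse)
          also have "b powr (\<theta> - 1) * b powr (- real n) = b powr (- a - 1)"
            using b by (simp add: powr_add[symmetric] a_def \<theta>_def algebra_simps)
          finally have eq: "b powr (\<theta> - 1) * (t / b) ^ n = t ^ n * b powr (- a - 1)" .
          have "beta_density \<theta> a b * ((t / b) ^ n * exp (- l * (t / b)))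
              = (b powr (\<theta> - 1) * (t / b) ^ n) * ((1 - b) powr (a - 1) * exp (- (l * t) / b)) / Beta \<theta> a"
            using b by (simp add: beta_density_def)
          also have "\<dots> = t ^ n / Beta \<theta> a * (b powr (- a - 1) * (1 - b) powr (a - 1) * exp (- (l * t) / b))"
            unfolding eq by simp
          finally show ?thesis
            using b True Gp Gn by (simp add: Beta beta_density_def flip: ennreal_mult)
        qed (simp add: beta_density_def)
      qed
      also have "\<dots> = ennreal (t ^ n / Beta \<theta> a) * ennreal (Gamma a * (l * t) powr (- a) * exp (- (l * t)))"
        by (subst nn_integral_cmult) (use nn_integral_beta_exp[OF \<open>0 < a\<close>, of "l * t"] True \<open>0 < l\<close> in simp_all)
      also have "ennreal (tilted_density f \<theta> t) * \<dots> = ennreal (t powr (- \<theta>) * f t / E * (t ^ n / Beta \<theta> a * (Gamma a * (l * t) powr (- a) * exp (- (l * t)))))"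
        using True stable_densityD(3)[OF f, of t] E Gp Gn
        by (simp add: tilted_density_def Eint Beta flip: ennreal_mult)
      also have "t powr (- \<theta>) * f t / E * (t ^ n / Beta \<theta> a * (Gamma a * (l * t) powr (- a) * exp (- (l * t))))
          = (t powr (- \<theta>) * t powr real n * t powr (- a)) * (l powr (- a) * Gamma (real n) / (Gamma \<theta> * E)) * (exp (- l * t) * f t)"
        using True \<open>0 < l\<close> Gp Gn by (simp add: Beta powr_mult powr_realpow mult_ac)
      \<comment> \<open>The exponents come from the tilt, from the weight \<open>y ^ n\<close> and
        from the beta integral.\<close>
      also have "t powr (- \<theta>) * t powr real n * t powr (- a) = 1"
        using True by (simp add: powr_add[symmetric] a_def \<theta>_def)
      finally show ?thesis
        using stable_densityD(3)[OF f, of t] E Gp Gn by (simp flip: ennreal_mult)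
    next
      case False
      then show ?thesis using stable_densityD(4)[OF f, of t] by (simp add: tilted_density_def)
    qed
  qed
  also have "\<dots> = ennreal (l powr (- a) * Gamma (real n) / (Gamma \<theta> * E)) * ennreal (exp (- (l powr \<beta>)))"
    using stable_densityD(5)[OF f, of l] \<open>0 < l\<close> by (subst nn_integral_cmult) auto
  also have "\<dots> = ennreal (l powr (- a) * Gamma (real n) / (Gamma \<theta> * E) * exp (- (l powr \<beta>)))"
    using E Gp Gn by (subst ennreal_mult) auto
  also have "l powr (- a) * Gamma (real n) / (Gamma \<theta> * E) * exp (- (l powr \<beta>)) = \<beta> * Gamma n / Gamma j * l powr (j * \<beta> - n) * exp (- (l powr \<beta>))"
    using Gp Gn \<open>0 < \<beta>\<close> by (simp add: E_def a_def)
  finally show ?thesis .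
qed

section \<open>Recovering the total from the normalized points\<close>

lemma emeasure_stable_intensity_atLeast:
  assumes "0 < g" "g < 1" "0 < x"
  shows "emeasure (stable_intensity g) {x..} = ennreal (x powr (- g) / Gamma (1 - g))"
proof -
  have G: "0 < Gamma (1 - g)" using assms by (intro Gamma_real_pos) auto
  have "emeasure (stable_intensity g) {x..} = (\<integral>\<^sup>+y. indicator {x..} y \<partial>stable_intensity g)" by simp
  also have "\<dots> = (\<integral>\<^sup>+y. ennreal (g / Gamma (1 - g) * y powr (- g - 1)) * indicator {x..} y \<partial>lborel)"
    by (subst nn_integral_stable_intensity) (use assms in \<open>auto intro!: nn_integral_cong simp: indicator_def\<close>)
  also have "\<dots> = ennreal (0 - (- (x powr (- g) / Gamma (1 - g))))"
  proof (rule nn_integral_FTC_atLeast)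
    show "((\<lambda>y. - (y powr (- g) / Gamma (1 - g))) has_real_derivative g / Gamma (1 - g) * y powr (- g - 1)) (at y)"
      if "x \<le> y" for y
      using that assms less_imp_neq[OF G] by (auto intro!: derivative_eq_intros simp: field_simps)
    have "((\<lambda>y. y powr (- g)) \<longlongrightarrow> 0) at_top"
      using assms by (intro tendsto_neg_powr) (auto simp: filterlim_ident)
    then have "((\<lambda>y. - (y powr (- g) / Gamma (1 - g))) \<longlongrightarrow> - (0 / Gamma (1 - g))) at_top"
      using G by (intro tendsto_intros) auto
    then show "((\<lambda>y. - (y powr (- g) / Gamma (1 - g))) \<longlongrightarrow> 0) at_top" by simp
  qed (use assms G in auto)
  finally show ?thesis by simp
qed

context stable_points
begin

lemma AE_J_decreasing: "AE \<omega> in M. \<forall>i k. i \<le> k \<longrightarrow> J k \<omega> \<le> J i \<omega>"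
proof -
  have "AE \<omega> in M. \<forall>i. J (Suc i) \<omega> < J i \<omega>"
    using ranked unfolding ranked_stable_points_def by (auto elim: eventually_mono)
  then show ?thesis
  proof eventually_elim
    case (elim \<omega>)
    then have "J (Suc n) \<omega> \<le> J n \<omega>" for n by (simp add: less_imp_le)
    then show ?case using lift_Suc_antimono_le[of "\<lambda>i. J i \<omega>"] by blast
  qed
qed

text \<open>The tail of the intensity maps the points to a unit-rate Poisson process.\<close>

definition arrival :: "nat \<Rightarrow> 'a \<Rightarrow> real" where
  "arrival i \<omega> = J i \<omega> powr (- g) / Gamma (1 - g)"

lemma arrival_measurable [measurable]: "arrival i \<in> borel_measurable M"
  unfolding arrival_def[abs_def] by measurable

text \<open>That \<open>arrival i\<close> is at most \<open>a\<close> means that at least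
  \<open>i + 1\<close> points lie at or above the level \<open>x\<close> whose tail intensity is
  \<open>a\<close>. The complementary Poisson probabilities add up to the Erlang distribution
  function. Indices start at 0, so \<open>arrival i\<close> is the arrival time number
  \<open>i + 1\<close>.\<close>

lemma arrival_distributed: "distributed M lborel (arrival i) (erlang_density i 1)"
proof (rule erlang_distributedI)
  have G: "0 < Gamma (1 - g)" using g by (intro Gamma_real_pos) auto
  then have [simp]: "Gamma (1 - g) \<noteq> 0" by (metis less_irrefl)
  fix a :: real assume "0 \<le> a"
  show "emeasure M {\<omega> \<in> space M. arrival i \<omega> \<le> a} = ennreal (erlang_CDF i 1 a)"
  proof (cases "a = 0")
    case True
    have "AE \<omega> in M. \<not> (arrival i \<omega> \<le> 0)"
      using AE_J_pos
    proof eventually_elim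
      case (elim \<omega>)
      then have "0 < J i \<omega> powr (- g)" by (simp add: less_imp_neq[symmetric])
      then show ?case using divide_pos_pos[OF _ G] by (simp add: arrival_def not_le)
    qed
    then have "emeasure M {\<omega> \<in> space M. arrival i \<omega> \<le> 0} = 0"
      by (subst AE_iff_measurable[symmetric, where N = "{\<omega> \<in> space M. arrival i \<omega> \<le> 0}"]) auto
    then show ?thesis using True by (simp add: erlang_CDF_at0)
  next
    case False
    then have a: "0 < a" using \<open>0 \<le> a\<close> by simp
    \<comment> \<open>The solution of \<open>x powr (- g) / Gamma (1 - g) = a\<close>.\<close>
    define x where "x = (a * Gamma (1 - g)) powr (- 1 / g)"
    have x: "0 < x" "x powr (- g) = a * Gamma (1 - g)" using a G g by (auto simp: x_def powr_powr)
    define N where "N = num_points J {x..}"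
    have [measurable]: "N \<in> borel_measurable M" unfolding N_def num_points_def[abs_def] by measurable
    have em: "emeasure (stable_intensity g) {x..} = ennreal a"
      using emeasure_stable_intensity_atLeast[OF g x(1)] x(2) G by simp
    then have "measure (stable_intensity g) {x..} = a" using a by (simp add: measure_def)
    then have pN: "prob {\<omega> \<in> space M. N \<omega> = of_nat m} = exp (- a) * a ^ m / fact m" for m
      using points em unfolding poisson_points_def N_def by auto
    \<comment> \<open>The condition is phrased by excluding the counts from 0 to \<open>i\<close>,
      which leaves the complement of a finite union of events with known Poisson
      probabilities.\<close>
    have iff: "AE \<omega> in M. arrival i \<omega> \<le> a \<longleftrightarrow> \<not> (\<exists>m\<le>i. N \<omega> = of_nat m)"
      using AE_J_pos AE_J_decreasing
    proof eventually_elim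
      case (elim \<omega>)
      have "arrival i \<omega> \<le> a \<longleftrightarrow> J i \<omega> powr (- g) \<le> x powr (- g)"
        using G by (simp add: arrival_def x(2) field_simps)
      also have "\<dots> \<longleftrightarrow> x \<le> J i \<omega>"
        using elim(1) x(1) g powr_less_mono2_neg[of "- g" x "J i \<omega>"] powr_less_mono2_neg[of "- g" "J i \<omega>" x]
        by (metis linorder_cases less_le_not_le linorder_not_le neg_less_0_iff_less order_refl)
      also have "\<dots> \<longleftrightarrow> \<not> (\<exists>m\<le>i. N \<omega> = of_nat m)"
      proof (cases "x \<le> J i \<omega>")
        case True
        have "(of_nat (Suc i) :: ennreal) = (\<Sum>k\<le>i. indicator {x..} (J k \<omega>))"
        proof -
          have "(\<Sum>k\<le>i. indicator {x..} (J k \<omega>)) = (\<Sum>k\<le>i. 1 :: ennreal)"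
            using elim(2) True by (intro sum.cong) (auto simp: indicator_def intro: order_trans)
          then show ?thesis by simp
        qed
        also have "\<dots> \<le> N \<omega>" unfolding N_def num_points_def by (rule sum_le_suminf) auto
        finally have "of_nat (Suc i) \<le> N \<omega>" .
        then have "N \<omega> \<noteq> of_nat m" if "m \<le> i" for m
          using that by (auto simp: ennreal_of_nat_eq_real_of_nat simp del: of_nat_Suc)
        then show ?thesis using True by blast
      next
        case False
        have "N \<omega> = (\<Sum>k<i. indicator {x..} (J k \<omega>))"
          unfolding N_def num_points_def
        proof (rule suminf_finite)
          fix k assume "k \<notin> {..<i}"
          then have "J k \<omega> \<le> J i \<omega>" using elim(2) by simp
          then show "indicator {x..} (J k \<omega>) = 0" using False by (simp add: indicator_def)
        qed simp
        also have "\<dots> = of_nat (card {k. k < i \<and> x \<le> J k \<omega>})"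
          by (simp add: indicator_def sum.If_cases Int_def)
        finally have "N \<omega> = of_nat (card {k. k < i \<and> x \<le> J k \<omega>})" .
        moreover have "card {k. k < i \<and> x \<le> J k \<omega>} \<le> i"
          using card_mono[of "{..<i}" "{k. k < i \<and> x \<le> J k \<omega>}"] by auto
        ultimately show ?thesis using False by blast
      qed
      finally show ?case .
    qed
    have "emeasure M {\<omega> \<in> space M. arrival i \<omega> \<le> a} = emeasure M (space M - (\<Union>m\<le>i. {\<omega> \<in> space M. N \<omega> = of_nat m}))"
      by (rule emeasure_eq_AE) (use iff in \<open>auto elim!: eventually_mono\<close>)
    also have "\<dots> = ennreal (1 - prob (\<Union>m\<le>i. {\<omega> \<in> space M. N \<omega> = of_nat m}))"
      by (subst prob_compl[symmetric]) (auto simp: emeasure_eq_measure)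
    also have "prob (\<Union>m\<le>i. {\<omega> \<in> space M. N \<omega> = of_nat m}) = (\<Sum>m\<le>i. prob {\<omega> \<in> space M. N \<omega> = of_nat m})"
      by (rule finite_measure_finite_Union) (auto simp: disjoint_family_on_def)
    also have "1 - \<dots> = erlang_CDF i 1 a"
      using a by (simp add: pN erlang_CDF_def mult.commute)
    finally show ?thesis .
  qed
qed (auto simp: arrival_measurable)

text \<open>The arrival with index \<open>i\<close> has mean and variance \<open>i + 1\<close>.
  Along squares the variances of the ratios are \<open>1 / (m + 1) ^ 2\<close>, which is summable,
  so the squared deviations have an almost surely finite sum and tend to 0.\<close>

lemma AE_arrival_limit: "AE \<omega> in M. (\<lambda>m. arrival (Suc m ^ 2 - 1) \<omega> / real (Suc m) ^ 2) \<longlonglongrightarrow> 1"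
proof -
  define Y where "Y m \<omega> = (arrival (Suc m ^ 2 - 1) \<omega> / real (Suc m) ^ 2 - 1) ^ 2" for m \<omega>
  have [measurable]: "Y m \<in> borel_measurable M" for m unfolding Y_def[abs_def] by measurable
  have EY: "(\<integral>\<^sup>+\<omega>. ennreal (Y m \<omega>) \<partial>M) = ennreal (1 / real (Suc m) ^ 2)" for m
  proof -
    define i where "i = Suc m ^ 2 - 1"
    have i: "real (Suc i) = real (Suc m) ^ 2" unfolding i_def by (simp add: of_nat_diff)
    have ex: "expectation (arrival i) = real (Suc i)" and var: "variance (arrival i) = real (Suc i)"
      using erlang_ith_moment[OF _ arrival_distributed[of i], of 1] erlang_distributed_variance[OF _ arrival_distributed[of i]]
      by simp_all
    have Yeq: "Y m \<omega> = (arrival i \<omega> - expectation (arrival i)) ^ 2 / real (Suc i) ^ 2" for \<omega>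
      unfolding Y_def i_def[symmetric] ex i[symmetric]
      by (simp add: power_divide[symmetric] diff_divide_distrib del: of_nat_Suc)
    have "expectation (Y m) = variance (arrival i) / real (Suc i) ^ 2" unfolding Yeq by simp
    also have "\<dots> = 1 / real (Suc m) ^ 2" unfolding var i by (simp add: power2_eq_square)
    finally have E: "expectation (Y m) = 1 / real (Suc m) ^ 2" .
    \<comment> \<open>A Bochner integral with a nonzero value certifies integrability, since it
      would be 0 by convention otherwise.\<close>
    then have "integrable M (Y m)" using not_integrable_integral_eq[of M "Y m"] by force
    then show ?thesis using E by (subst nn_integral_eq_integral) (auto simp: Y_def)
  qed
  have "(\<integral>\<^sup>+\<omega>. (\<Sum>m. ennreal (Y m \<omega>)) \<partial>M) = (\<Sum>m. ennreal (1 / real (Suc m) ^ 2))"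
    by (subst nn_integral_suminf) (auto simp: EY)
  also have "\<dots> < \<infinity>"
  proof -
    have "summable (\<lambda>m. 1 / real (Suc m) ^ 2)"
      using inverse_power_summable[of 2, where 'a = real] by (subst summable_Suc_iff) (simp add: inverse_eq_divide)
    then show ?thesis by (simp add: suminf_ennreal2 less_top del: of_nat_Suc)
  qed
  finally have "AE \<omega> in M. (\<Sum>m. ennreal (Y m \<omega>)) \<noteq> \<infinity>"
    by (intro nn_integral_PInf_AE) (auto simp: less_top)
  then show ?thesis
  proof eventually_elim
    case (elim \<omega>)
    then have "summable (\<lambda>m. Y m \<omega>)" by (intro summable_suminf_not_top) (auto simp: Y_def)
    then have "(\<lambda>m. sqrt (Y m \<omega>)) \<longlonglongrightarrow> sqrt 0" by (intro tendsto_real_sqrt summable_LIMSEQ_zero)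
    then have "(\<lambda>m. \<bar>arrival (Suc m ^ 2 - 1) \<omega> / real (Suc m) ^ 2 - 1\<bar>) \<longlonglongrightarrow> 0" by (simp add: Y_def)
    then show ?case by (simp add: tendsto_rabs_zero_iff LIM_zero_iff)
  qed
qed

text \<open>For the normalized points the expression \<open>s i powr (- g) / Gamma (1 - g)\<close>
  equals \<open>T powr g\<close> times \<open>arrival i\<close>, so the limit is
  \<open>T powr g\<close>. The subtraction of 1 makes the position of the square zero-based.\<close>

definition recover :: "(nat \<Rightarrow> real) \<Rightarrow> real" where
  "recover s = lim (\<lambda>m. s (Suc m ^ 2 - 1) powr (- g) / Gamma (1 - g) / real (Suc m) ^ 2) powr (1 / g)"

lemma recover_measurable [measurable]: "recover \<in> borel_measurable seq_space"
proof -
  have comp: "(\<lambda>s. s i) \<in> borel_measurable seq_space" for i :: nat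
    by (rule measurable_component_singleton) simp
  have p: "(\<lambda>x :: real. x powr a) \<in> borel_measurable borel" for a by measurable
  have "(\<lambda>s. lim (\<lambda>m. s (Suc m ^ 2 - 1) powr (- g) / Gamma (1 - g) / real (Suc m) ^ 2)) \<in> borel_measurable seq_space"
    by (intro borel_measurable_lim_metric borel_measurable_divide borel_measurable_const measurable_compose[OF comp p])
  then show ?thesis unfolding recover_def[abs_def] by (rule measurable_compose[OF _ p])
qed

lemma AE_recover: "AE \<omega> in M. recover (normalized J \<omega>) = T \<omega>"
  using AE_good AE_arrival_limit
proof eventually_elim
  case (elim \<omega>)
  have T: "0 < T \<omega>" by (rule good_T_pos[OF elim(1)])
  have J: "0 < J i \<omega>" for i using elim(1) by (simp add: good_def)
  have "normalized J \<omega> i powr (- g) / Gamma (1 - g) = T \<omega> powr g * arrival i \<omega>" for i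
    unfolding normalized_def arrival_def using T J[of i] by (simp add: powr_divide powr_minus field_simps)
  then have "(\<lambda>m. normalized J \<omega> (Suc m ^ 2 - 1) powr (- g) / Gamma (1 - g) / real (Suc m) ^ 2) \<longlonglongrightarrow> T \<omega> powr g"
    using tendsto_mult[OF tendsto_const[of "T \<omega> powr g"] elim(2)] by simp
  then have "recover (normalized J \<omega>) = (T \<omega> powr g) powr (1 / g)"
    unfolding recover_def by (simp only: limI)
  then show ?case using T g by (simp add: powr_powr)
qed

lemma normalized_measurable [measurable]: "normalized J \<in> M \<rightarrow>\<^sub>M seq_space"
  unfolding normalized_def[abs_def] by (rule measurable_PiM_single') (auto simp: space_PiM)

lemma AE_normalized: "AE \<omega> in M. normalized J \<omega> \<in> P_infty"
  using AE_good AE_J_decreasing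
proof eventually_elim
  case (elim \<omega>)
  have T: "0 < T \<omega>" by (rule good_T_pos[OF elim(1)])
  have "normalized J \<omega> sums (T \<omega> / T \<omega>)"
    unfolding normalized_def using elim(1)
    by (intro sums_divide) (auto simp: good_def inv_local_time_def summable_sums)
  then show ?case
    using T elim by (auto simp: P_infty_def good_def normalized_def decseq_def less_imp_le intro!: divide_right_mono)
qed

end

section \<open>Set partitions and the probabilities of sampling them\<close>

text \<open>If a continuous function were positive at one point it would be so on an interval, which
  is not a null set. This is how almost everywhere comparisons of densities become statements about
  the given point.\<close>

lemma AE_nonpos_imp_nonpos:
  fixes h :: "real \<Rightarrow> real"
  assumes "continuous_on {0<..} h" "AE x in lborel. 0 < x \<longrightarrow> h x \<le> 0" "0 < x"
  shows "h x \<le> 0"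
proof (rule ccontr)
  assume "\<not> h x \<le> 0"
  then have x: "x \<in> h -` {0<..} \<inter> {0<..}" using assms(3) by simp
  have "open (h -` {0<..} \<inter> {0<..})"
    using continuous_on_open_vimage[of "{0<..}" h] assms(1) by (simp add: Int_commute)
  then obtain d where d: "0 < d" "ball x d \<subseteq> h -` {0<..} \<inter> {0<..}" using x open_contains_ball by blast
  have ae: "AE y in lborel. y \<notin> {x - d<..<x + d}"
    using assms(2)
  proof eventually_elim
    case (elim y)
    show ?case
    proof
      assume "y \<in> {x - d<..<x + d}"
      then have "y \<in> ball x d" by (simp add: dist_real_def abs_less_iff)
      then have "0 < h y" "0 < y" using d(2) by auto
      then show False using elim by simp
    qed
  qed
  have "AE y in lborel. y \<in> {x - d<..<x + d} \<longleftrightarrow> y \<in> {}" using ae by simp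
  from emeasure_eq_AE[OF this] have "emeasure lborel {x - d<..<x + d} = 0" by simp
  then show False using d(1) by simp
qed

definition partitions :: "nat \<Rightarrow> nat set set set" where
  "partitions n = {\<pi>. partition_on {1..n} \<pi>}"

lemma finite_partitions [simp]: "finite (partitions n)"
  by (rule finite_subset[of _ "Pow (Pow {1..n})"]) (auto simp: partitions_def partition_on_def)

lemma finite_partition: "\<pi> \<in> partitions n \<Longrightarrow> finite \<pi>"
  unfolding partitions_def using finite_elements[of "{1..n}"] by auto

lemma card_partition_le: "\<pi> \<in> partitions n \<Longrightarrow> card \<pi> \<le> n"
proof -
  assume \<pi>: "\<pi> \<in> partitions n"
  then have p: "partition_on {1..n} \<pi>" by (simp add: partitions_def)
  have "\<forall>A\<in>\<pi>. \<exists>m. m \<in> A" using p unfolding partition_on_def by (metis ex_in_conv)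
  then obtain c where c: "\<And>A. A \<in> \<pi> \<Longrightarrow> c A \<in> A" by metis
  have "inj_on c \<pi>"
    using p c unfolding partition_on_def disjoint_def inj_on_def by (metis disjoint_iff)
  moreover have "c ` \<pi> \<subseteq> {1..n}" using p c unfolding partition_on_def by blast
  ultimately have "card \<pi> \<le> card {1..n}" by (intro card_inj_on_le) auto
  then show "card \<pi> \<le> n" by simp
qed

lemma card_partition_pos:
  assumes "\<pi> \<in> partitions n" "1 \<le> n"
  shows "1 \<le> card \<pi>"
proof -
  have "\<pi> \<noteq> {}" using assms by (auto simp: partitions_def partition_on_def)
  then show ?thesis using finite_partition[OF assms(1)] by (simp add: card_gt_0_iff Suc_le_eq)
qed

lemma index_partition_in_partitions: "index_partition n i \<in> partitions n"
proof -
  define c where "c m = {m' \<in> {1..n}. i m' = i m}" for m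
  have "disjoint (c ` {1..n})"
  proof (rule disjointI)
    fix A B assume "A \<in> c ` {1..n}" "B \<in> c ` {1..n}" "A \<noteq> B"
    then obtain a b where "A = c a" "B = c b" "c a \<noteq> c b" by blast
    then show "A \<inter> B = {}" unfolding c_def by force
  qed
  moreover have "\<Union> (c ` {1..n}) = {1..n}" unfolding c_def by blast
  moreover have "{} \<notin> c ` {1..n}" unfolding c_def by blast
  moreover have "index_partition n i = c ` {1..n}" unfolding index_partition_def c_def ..
  ultimately show ?thesis unfolding partitions_def partition_on_def by simp
qed

lemma set_pmf_partition_pmf: "set_pmf (partition_pmf n P) \<subseteq> partitions n"
  unfolding partition_pmf_def using index_partition_in_partitions by auto

lemma sum_partition_pmf: "(\<Sum>\<pi>\<in>partitions n. ennreal (pmf (partition_pmf n P) \<pi>)) = 1"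
  using sum_pmf_eq_1[OF finite_partitions set_pmf_partition_pmf, of n P] by (simp add: sum_ennreal)

lemma partitions_listE:
  assumes "\<pi> \<in> partitions n"
  obtains As where "distinct As" "set As = \<pi>" "partition_on {1..n} (set As)" "length As = card \<pi>"
    "\<forall>m\<in>set (map card As). 1 \<le> m" "sum_list (map card As) = n"
proof -
  obtain As where As: "distinct As" "set As = \<pi>" using finite_distinct_list[OF finite_partition[OF assms]] by auto
  have p: "partition_on {1..n} \<pi>" using assms by (simp add: partitions_def)
  have fin: "finite A" "A \<noteq> {}" if "A \<in> \<pi>" for A
    using p that finite_subset[of A "{1..n}"] by (auto simp: partition_on_def)
  have "sum_list (map card As) = (\<Sum>A\<in>\<pi>. card A)" using As by (simp add: sum_list_distinct_conv_sum_set)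
  also have "\<dots> = card (\<Union>\<pi>)"
    using p fin by (intro card_Union_disjoint[symmetric]) (auto simp: partition_on_def disjoint_def pairwise_def disjnt_def)
  also have "\<dots> = n" using p by (simp add: partition_on_def)
  finally have "sum_list (map card As) = n" .
  moreover have "\<forall>m\<in>set (map card As). 1 \<le> m" using As fin by (auto simp: Suc_le_eq card_gt_0_iff)
  ultimately show ?thesis using that[of As] As p distinct_card[of As] by simp
qed

text \<open>The Gibbs weight without its normalization: \<open>p_PD\<close> is this product times a
  factor that depends only on the number of blocks and on \<open>n\<close>. It carries the factor
  \<open>g\<close> once per block, hence one more than in \<open>p_PD\<close>.\<close>

definition partition_weight :: "real \<Rightarrow> nat set set \<Rightarrow> real" where
  "partition_weight g \<pi> = (\<Prod>A\<in>\<pi>. g * pochhammer (1 - g) (card A - 1))"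

lemma partition_weight_pos: "0 < g \<Longrightarrow> g < 1 \<Longrightarrow> 0 < partition_weight g \<pi>"
  unfolding partition_weight_def by (intro prod_pos) (simp add: pochhammer_pos)

lemma partition_weight_list:
  assumes "distinct As"
  shows "g ^ length As * (\<Prod>j<length As. pochhammer (1 - g) (map card As ! j - 1)) = partition_weight g (set As)"
proof -
  have "partition_weight g (set As) = (\<Prod>j<length As. g * pochhammer (1 - g) (card (As ! j) - 1))"
    unfolding partition_weight_def
    using assms by (intro prod.reindex_bij_betw[symmetric] bij_betw_nth) auto
  then show ?thesis by (simp add: prod.distrib)
qed

lemma p_PD_partition_weight:
  assumes "distinct As" "As \<noteq> []" "g \<noteq> 0"
  shows "p_PD g (map card As) = partition_weight g (set As) * Gamma (real (length As)) / (g * Gamma (real (sum_list (map card As))))"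
proof -
  have "g ^ length As = g * g ^ (length As - 1)" using assms(2) by (cases As) auto
  then show ?thesis
    using assms(3) unfolding partition_weight_list[OF assms(1), symmetric] p_PD_def Let_def by simp
qed

lemma measurable_pmf_partition_pmf [measurable]: "(\<lambda>P. pmf (partition_pmf n P) \<pi>) \<in> borel_measurable seq_space"
proof (cases "\<pi> \<in> partitions n")
  case True
  then obtain As where As: "distinct As" "set As = \<pi>" "partition_on {1..n} (set As)" by (rule partitions_listE)
  \<comment> \<open>Off \<open>P_infty\<close> the convention in \<open>index_pmf\<close> makes all
    indices 0, so the probability is a constant there.\<close>
  define c where "c = pmf (map_pmf (index_partition n) (Pi_pmf {1..n} 0 (\<lambda>_. return_pmf 0))) \<pi>"
  have "pmf (partition_pmf n P) \<pi> = (if P \<in> P_infty then enn2real (dsum (map card As) P) else c)" for P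
  proof (cases "P \<in> P_infty")
    case True
    then show ?thesis using pmf_partition_pmf_dsum[OF True As(1,3)] As(2) by (metis enn2real_ennreal pmf_nonneg)
  next
    case False
    then have "index_pmf P = return_pmf 0" by (simp add: index_pmf_def)
    then show ?thesis using False by (simp only: partition_pmf_def c_def if_False)
  qed
  then show ?thesis by (simp only:) measurable
next
  case False
  then have "pmf (partition_pmf n P) \<pi> = 0" for P
    using set_pmf_partition_pmf[of n P] by (auto simp: set_pmf_eq)
  then show ?thesis by simp
qed

lemma measurable_partition_kernel [measurable]:
  "(\<lambda>P. measure_pmf (partition_pmf n P)) \<in> seq_space \<rightarrow>\<^sub>M subprob_algebra (count_space UNIV)"
proof (rule measurable_subprob_algebra)
  fix A :: "nat set set set"
  have "emeasure (measure_pmf (partition_pmf n P)) A = (\<Sum>\<pi>\<in>partitions n \<inter> A. ennreal (pmf (partition_pmf n P) \<pi>))" for P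
  proof -
    have "emeasure (measure_pmf (partition_pmf n P)) A = emeasure (measure_pmf (partition_pmf n P)) (partitions n \<inter> A)"
      using set_pmf_partition_pmf[of n P] by (intro emeasure_eq_AE) (auto simp: AE_measure_pmf_iff)
    then show ?thesis by (simp add: emeasure_measure_pmf_finite)
  qed
  then show "(\<lambda>P. emeasure (measure_pmf (partition_pmf n P)) A) \<in> borel_measurable seq_space"
    by simp
qed (auto simp: measure_pmf.subprob_space_axioms)

lemma emeasure_partition_law:
  assumes sets: "sets \<mu> = sets seq_space"
  shows "emeasure (partition_law \<mu> n) A = (\<Sum>\<pi>\<in>partitions n \<inter> A. \<integral>\<^sup>+P. ennreal (pmf (partition_pmf n P) \<pi>) \<partial>\<mu>)"
proof -
  note [measurable_cong] = sets
  have ne: "space \<mu> \<noteq> {}" using sets_eq_imp_space_eq[OF sets] by (simp add: space_PiM PiE_eq_empty_iff)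
  have "emeasure (partition_law \<mu> n) A = (\<integral>\<^sup>+P. emeasure (measure_pmf (partition_pmf n P)) A \<partial>\<mu>)"
    unfolding partition_law_def
    by (rule emeasure_bind[OF ne, where N = "count_space UNIV"])
      (simp_all only: measurable_cong_sets[OF sets refl] measurable_partition_kernel, simp)
  also have "\<dots> = (\<integral>\<^sup>+P. (\<Sum>\<pi>\<in>partitions n \<inter> A. ennreal (pmf (partition_pmf n P) \<pi>)) \<partial>\<mu>)"
  proof (rule nn_integral_cong)
    fix P
    have "emeasure (measure_pmf (partition_pmf n P)) A = emeasure (measure_pmf (partition_pmf n P)) (partitions n \<inter> A)"
      using set_pmf_partition_pmf[of n P] by (intro emeasure_eq_AE) (auto simp: AE_measure_pmf_iff)
    then show "emeasure (measure_pmf (partition_pmf n P)) A = (\<Sum>\<pi>\<in>partitions n \<inter> A. ennreal (pmf (partition_pmf n P) \<pi>))"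
      by (simp add: emeasure_measure_pmf_finite)
  qed
  also have "\<dots> = (\<Sum>\<pi>\<in>partitions n \<inter> A. \<integral>\<^sup>+P. ennreal (pmf (partition_pmf n P) \<pi>) \<partial>\<mu>)"
    by (rule nn_integral_sum) (simp add: measurable_cong_sets[OF sets refl])
  finally show ?thesis .
qed

context stable_points
begin

definition partition_prob :: "nat \<Rightarrow> nat set set \<Rightarrow> 'a \<Rightarrow> real" where
  "partition_prob n \<pi> \<omega> = pmf (partition_pmf n (normalized J \<omega>)) \<pi>"

lemma partition_prob_measurable [measurable]: "partition_prob n \<pi> \<in> borel_measurable M"
  unfolding partition_prob_def[abs_def]
  by (rule measurable_compose[OF normalized_measurable measurable_pmf_partition_pmf])

lemma partition_prob_nonneg [simp]: "0 \<le> partition_prob n \<pi> \<omega>"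
  by (simp add: partition_prob_def)

lemma partition_prob_laplace:
  assumes \<pi>: "\<pi> \<in> partitions n" and l: "0 < l"
  shows "(\<integral>\<^sup>+\<omega>. ennreal (partition_prob n \<pi> \<omega>) * ennreal (T \<omega> ^ n * exp (- l * T \<omega>)) \<partial>M) =
    ennreal (partition_weight g \<pi> * l powr (real (card \<pi>) * g - real n) * exp (- (l powr g)))"
proof -
  obtain As where As: "distinct As" "set As = \<pi>" "partition_on {1..n} (set As)" "length As = card \<pi>"
    "\<forall>m\<in>set (map card As). 1 \<le> m" "sum_list (map card As) = n" using \<pi> by (rule partitions_listE)
  have "(\<integral>\<^sup>+\<omega>. ennreal (partition_prob n \<pi> \<omega>) * ennreal (T \<omega> ^ n * exp (- l * T \<omega>)) \<partial>M)
      = (\<integral>\<^sup>+\<omega>. dsum (map card As) (\<lambda>i. J i \<omega>) * ennreal (exp (- l * T \<omega>)) \<partial>M)"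
  proof (rule nn_integral_cong_AE, use AE_good AE_normalized in eventually_elim)
    case (elim \<omega>)
    have T: "0 < T \<omega>" by (rule good_T_pos[OF elim(1)])
    have nn: "0 \<le> normalized J \<omega> i" for i using elim(2) unfolding P_infty_def by blast
    have "(\<lambda>i. J i \<omega>) = (\<lambda>i. T \<omega> * normalized J \<omega> i)" using T by (simp add: normalized_def)
    \<comment> \<open>Homogeneity of degree \<open>n\<close>: the weight \<open>T ^ n\<close> turns
      the normalized masses back into the points.\<close>
    then have "dsum (map card As) (\<lambda>i. J i \<omega>) = ennreal (T \<omega>) ^ n * dsum (map card As) (normalized J \<omega>)"
      using dsum_cmult[OF less_imp_le[OF T] nn, of "map card As"] As(6) by simp
    also have "\<dots> = ennreal (T \<omega> ^ n) * ennreal (partition_prob n \<pi> \<omega>)"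
      using pmf_partition_pmf_dsum[OF elim(2) As(1,3)] As(2) T by (simp add: partition_prob_def ennreal_power)
    finally show ?case using T by (simp add: ennreal_mult mult_ac)
  qed
  also have "\<dots> = ennreal (partition_weight g \<pi> * l powr (real (card \<pi>) * g - real n) * exp (- (l powr g)))"
    using nn_integral_point_sum[OF As(5) l] partition_weight_list[OF As(1), of g] As(2,4,6) by simp
  finally show ?thesis .
qed

lemma T_laplace: "0 < l \<Longrightarrow> (\<integral>\<^sup>+\<omega>. ennreal (exp (- l * T \<omega>)) \<partial>M) = ennreal (exp (- (l powr g)))"
  using nn_integral_point_sum[of "[]" l] by simp

text \<open>Summing over all partitions removes the partition, as the probabilities add up to 1. The
  result is the expansion of the \<open>n\<close>-th derivative of
  \<open>exp (- (l powr g))\<close>, up to sign, in the form of Faa di Bruno.\<close>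

lemma T_power_laplace:
  assumes l: "0 < l"
  shows "(\<integral>\<^sup>+\<omega>. ennreal (T \<omega> ^ n * exp (- l * T \<omega>)) \<partial>M) =
    (\<Sum>\<pi>\<in>partitions n. ennreal (partition_weight g \<pi> * l powr (real (card \<pi>) * g - real n) * exp (- (l powr g))))"
proof -
  have "(\<integral>\<^sup>+\<omega>. ennreal (T \<omega> ^ n * exp (- l * T \<omega>)) \<partial>M)
      = (\<integral>\<^sup>+\<omega>. (\<Sum>\<pi>\<in>partitions n. ennreal (partition_prob n \<pi> \<omega>) * ennreal (T \<omega> ^ n * exp (- l * T \<omega>))) \<partial>M)"
    by (simp add: sum_distrib_right[symmetric] partition_prob_def sum_partition_pmf)
  also have "\<dots> = (\<Sum>\<pi>\<in>partitions n. \<integral>\<^sup>+\<omega>. ennreal (partition_prob n \<pi> \<omega>) * ennreal (T \<omega> ^ n * exp (- l * T \<omega>)) \<partial>M)"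
    by (rule nn_integral_sum) measurable
  finally show ?thesis by (simp add: partition_prob_laplace[OF _ l, simplified])
qed

text \<open>The weight \<open>T ^ n\<close> is removed by integrating over \<open>l\<close> with
  \<open>l powr (n - 1)\<close>, because \<open>T ^ n * exp (- l * T)\<close> then yields
  \<open>Gamma n\<close> whatever the value of \<open>T\<close>. On the other side
  \<open>nn_integral_gamma_powr\<close> gives the Gamma factor of the number of blocks.\<close>

lemma partition_prob_expectation:
  assumes \<pi>: "\<pi> \<in> partitions n" and n: "1 \<le> n"
  shows "(\<integral>\<^sup>+\<omega>. ennreal (partition_prob n \<pi> \<omega>) \<partial>M) = ennreal (partition_weight g \<pi> * Gamma (real (card \<pi>)) / (g * Gamma (real n)))"
proof -
  define k where "k = card \<pi>"
  have k: "1 \<le> k" unfolding k_def by (rule card_partition_pos[OF \<pi> n])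
  have Gn: "0 < Gamma (real n)" "0 < Gamma (real k)" using n k by (auto intro!: Gamma_real_pos)
  define G where "G l \<omega> = indicator {0<..} l * ennreal (l powr (real n - 1)) * (ennreal (partition_prob n \<pi> \<omega>) * ennreal (T \<omega> ^ n * exp (- l * T \<omega>)))" for l \<omega>
  have [measurable]: "case_prod G \<in> borel_measurable (lborel \<Otimes>\<^sub>M M)" unfolding G_def[abs_def] by measurable
  interpret LM: pair_sigma_finite lborel M ..
  have inner: "AE \<omega> in M. (\<integral>\<^sup>+l. G l \<omega> \<partial>lborel) = ennreal (Gamma (real n)) * ennreal (partition_prob n \<pi> \<omega>)"
    using AE_good
  proof eventually_elim
    case (elim \<omega>)
    have T: "0 < T \<omega>" by (rule good_T_pos[OF elim])
    have "(\<integral>\<^sup>+l. G l \<omega> \<partial>lborel) = (\<integral>\<^sup>+l. ennreal (partition_prob n \<pi> \<omega> * T \<omega> ^ n) * (indicator {0<..} l * ennreal (l powr (real n - 1) * exp (- T \<omega> * l))) \<partial>lborel)"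
      using T by (intro nn_integral_cong) (simp add: G_def ennreal_mult mult_ac)
    also have "\<dots> = ennreal (partition_prob n \<pi> \<omega> * T \<omega> ^ n) * ennreal (Gamma (real n) * T \<omega> powr (- real n))"
      by (subst nn_integral_cmult, simp, subst nn_integral_gamma) (use n T in auto)
    also have "\<dots> = ennreal (Gamma (real n)) * ennreal (partition_prob n \<pi> \<omega>)"
      using T Gn by (simp add: powr_minus powr_realpow flip: ennreal_mult)
    finally show ?case .
  qed
  have "ennreal (Gamma (real n)) * (\<integral>\<^sup>+\<omega>. ennreal (partition_prob n \<pi> \<omega>) \<partial>M) = (\<integral>\<^sup>+\<omega>. (\<integral>\<^sup>+l. G l \<omega> \<partial>lborel) \<partial>M)"
    by (subst nn_integral_cmult[symmetric], simp, rule nn_integral_cong_AE, use inner in eventually_elim) simp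
  also have "\<dots> = (\<integral>\<^sup>+l. (\<integral>\<^sup>+\<omega>. G l \<omega> \<partial>M) \<partial>lborel)"
    by (rule LM.Fubini') measurable
  also have "\<dots> = (\<integral>\<^sup>+l. ennreal (partition_weight g \<pi>) * (indicator {0<..} l * ennreal (l powr (real k * g - 1) * exp (- (l powr g)))) \<partial>lborel)"
  proof (rule nn_integral_cong)
    fix l :: real
    show "(\<integral>\<^sup>+\<omega>. G l \<omega> \<partial>M) = ennreal (partition_weight g \<pi>) * (indicator {0<..} l * ennreal (l powr (real k * g - 1) * exp (- (l powr g))))"
    proof (cases "0 < l")
      case True
      have "(\<integral>\<^sup>+\<omega>. G l \<omega> \<partial>M) = ennreal (l powr (real n - 1)) * (\<integral>\<^sup>+\<omega>. ennreal (partition_prob n \<pi> \<omega>) * ennreal (T \<omega> ^ n * exp (- l * T \<omega>)) \<partial>M)"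
        unfolding G_def using True by (subst nn_integral_cmult) auto
      also have "\<dots> = ennreal (l powr (real n - 1) * (partition_weight g \<pi> * l powr (real k * g - real n) * exp (- (l powr g))))"
        unfolding partition_prob_laplace[OF \<pi> True] k_def[symmetric]
        using partition_weight_pos[OF g, of \<pi>] by (simp add: ennreal_mult)
      also have "l powr (real n - 1) * (partition_weight g \<pi> * l powr (real k * g - real n) * exp (- (l powr g)))
          = partition_weight g \<pi> * (l powr ((real n - 1) + (real k * g - real n)) * exp (- (l powr g)))"
        by (simp only: powr_add mult_ac)
      also have "(real n - 1) + (real k * g - real n) = real k * g - 1" by simp
      finally show ?thesis using True partition_weight_pos[OF g, of \<pi>] by (simp add: ennreal_mult)
    qed (simp add: G_def)
  qed
  also have "\<dots> = ennreal (partition_weight g \<pi>) * ennreal (Gamma (real k) / g)"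
    by (subst nn_integral_cmult, simp, subst nn_integral_gamma_powr) (use k g in auto)
  finally have "ennreal (1 / Gamma (real n)) * (ennreal (Gamma (real n)) * (\<integral>\<^sup>+\<omega>. ennreal (partition_prob n \<pi> \<omega>) \<partial>M))
      = ennreal (1 / Gamma (real n)) * (ennreal (partition_weight g \<pi>) * ennreal (Gamma (real k) / g))" by simp
  then show ?thesis
    using Gn g partition_weight_pos[OF g, of \<pi>] unfolding k_def[symmetric]
    by (simp add: mult.assoc[symmetric] mult_ac flip: ennreal_mult)
qed

lemma blocks_prob_PD_law:
  assumes "1 \<le> k"
  shows "blocks_prob (PD_law M J) k j =
    (\<Sum>\<pi> | \<pi> \<in> partitions k \<and> card \<pi> = j. partition_weight g \<pi> * Gamma (real j) / (g * Gamma (real k)))"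
proof -
  have nn: "0 \<le> partition_weight g \<pi> * Gamma (real j) / (g * Gamma (real k))" if "\<pi> \<in> partitions k" "card \<pi> = j" for \<pi>
    using partition_weight_pos[OF g, of \<pi>] g card_partition_pos[OF that(1) assms] that(2) assms
    by (intro divide_nonneg_nonneg mult_nonneg_nonneg less_imp_le[OF Gamma_real_pos]) auto
  have "emeasure (partition_law (PD_law M J) k) {\<pi>. card \<pi> = j} =
      (\<Sum>\<pi>\<in>partitions k \<inter> {\<pi>. card \<pi> = j}. \<integral>\<^sup>+\<omega>. ennreal (partition_prob k \<pi> \<omega>) \<partial>M)"
    by (subst emeasure_partition_law) (auto simp: PD_law_def nn_integral_distr partition_prob_def intro!: sum.cong)
  also have "\<dots> = (\<Sum>\<pi>\<in>partitions k \<inter> {\<pi>. card \<pi> = j}. ennreal (partition_weight g \<pi> * Gamma (real j) / (g * Gamma (real k))))"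
    by (intro sum.cong refl) (auto simp: partition_prob_expectation[OF _ assms])
  also have "\<dots> = ennreal (\<Sum>\<pi>\<in>partitions k \<inter> {\<pi>. card \<pi> = j}. partition_weight g \<pi> * Gamma (real j) / (g * Gamma (real k)))"
    using nn by (intro sum_ennreal) auto
  finally show ?thesis
    unfolding blocks_prob_def measure_def using nn by (subst enn2real_ennreal[symmetric]) (auto intro!: sum_nonneg simp: Int_def)
qed

lemma distr_T_density:
  assumes f: "stable_density g f"
  shows "distr M borel T = density lborel (\<lambda>x. ennreal (f x))"
proof (rule laplace_unique)
  note [measurable] = stable_densityD(2)[OF f]
  show "AE x in distr M borel T. 0 < x"
    by (subst AE_distr_iff) (use AE_good good_T_pos in \<open>auto elim: eventually_mono\<close>)
  show "AE x in density lborel (\<lambda>x. ennreal (f x)). 0 < x"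
  proof (subst AE_density, simp, intro AE_I2 impI)
    fix x assume "0 < ennreal (f x)"
    then show "0 < x" using stable_densityD(4)[OF f, of x] by (cases "x \<le> 0") auto
  qed
  have 1: "(\<integral>\<^sup>+x. ennreal (exp (- real (Suc n) * x)) \<partial>distr M borel T) = ennreal (exp (- (real (Suc n) powr g)))" for n
    using T_laplace[of "real (Suc n)"] by (subst nn_integral_distr) auto
  have 2: "(\<integral>\<^sup>+x. ennreal (exp (- real (Suc n) * x)) \<partial>density lborel (\<lambda>x. ennreal (f x))) = ennreal (exp (- (real (Suc n) powr g)))" for n
    using stable_densityD(5)[OF f, of "real (Suc n)"] by (subst nn_integral_density) (auto simp: mult.commute)
  show "(\<integral>\<^sup>+x. ennreal (exp (- real (Suc n) * x)) \<partial>distr M borel T) < \<infinity>" for n unfolding 1 by simp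
  show "(\<integral>\<^sup>+x. ennreal (exp (- real (Suc n) * x)) \<partial>distr M borel T) = (\<integral>\<^sup>+x. ennreal (exp (- real (Suc n) * x)) \<partial>density lborel (\<lambda>x. ennreal (f x)))" for n
    unfolding 1 2 ..
qed auto

end

section \<open>A bound for the stable density, and the law of the composed time with the
  partition\<close>

context stable_points
begin

text \<open>By \<open>T_power_laplace\<close> the transform of \<open>u ^ n * f u\<close> is a
  finite sum of terms \<open>l powr (- a \<pi>) * exp (- (l powr g))\<close>, each that of a
  multiple of a fractional integral of \<open>f\<close>. For large \<open>n\<close> all orders
  \<open>a \<pi>\<close> are at least 1, so the kernels are bounded and only the mass of
  \<open>f\<close> below \<open>u\<close> matters. That mass is small for small \<open>u\<close>,
  which compensates the division by \<open>u ^ (n - 1)\<close>.\<close>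

lemma stable_density_bounded:
  assumes f: "stable_density g f"
  obtains C where "\<And>u. 0 < u \<Longrightarrow> u * f u \<le> C"
proof -
  note [measurable] = stable_densityD(2)[OF f]
  \<comment> \<open>With at most \<open>n\<close> blocks, \<open>n * (1 - g) \<ge> 1\<close> makes
    every order \<open>a \<pi>\<close> at least 1.\<close>
  obtain n :: nat where "1 / (1 - g) < real n" using reals_Archimedean2 by blast
  then have n: "1 \<le> real n * (1 - g)" using g by (simp add: field_simps)
  define a where "a \<pi> = real n - real (card \<pi>) * g" for \<pi> :: "nat set set"
  have a: "1 \<le> a \<pi>" if "\<pi> \<in> partitions n" for \<pi>
  proof -
    have "real (card \<pi>) * g \<le> real n * g" using card_partition_le[OF that] g by (intro mult_right_mono) auto
    then show ?thesis using n by (simp add: a_def algebra_simps)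
  qed
  \<comment> \<open>The division by \<open>Gamma (a \<pi>)\<close> cancels the constant of the
    fractional integral.\<close>
  define c where "c \<pi> = partition_weight g \<pi> / Gamma (a \<pi>)" for \<pi>
  have Ga: "0 < Gamma (a \<pi>)" if "\<pi> \<in> partitions n" for \<pi> using a[OF that] by (intro Gamma_real_pos) auto
  have c: "0 \<le> c \<pi>" if "\<pi> \<in> partitions n" for \<pi>
    using partition_weight_pos[OF g, of \<pi>] Ga[OF that] by (simp add: c_def)
  define conv where "conv \<pi> u = (\<integral>\<^sup>+v. indicator {0<..} (u - v) * ennreal ((u - v) powr (a \<pi> - 1)) * ennreal (f v) \<partial>lborel)" for \<pi> u
  have [measurable]: "conv \<pi> \<in> borel_measurable borel" for \<pi> unfolding conv_def[abs_def] by measurable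
  define h where "h u = (\<Sum>\<pi>\<in>partitions n. ennreal (c \<pi>) * conv \<pi> u)" for u
  have [measurable]: "h \<in> borel_measurable borel" unfolding h_def[abs_def] by measurable
  have conv0: "conv \<pi> u = 0" if "u \<le> 0" for \<pi> u
  proof -
    have "indicator {0<..} (u - v) * ennreal ((u - v) powr (a \<pi> - 1)) * ennreal (f v) = 0" for v
      using stable_densityD(4)[OF f, of v] that by (cases "v \<le> 0") (auto simp: indicator_def)
    then show ?thesis by (simp only: conv_def nn_integral_const mult_zero_left)
  qed
  have lapf: "(\<integral>\<^sup>+x. ennreal (exp (- l * x)) \<partial>density lborel (\<lambda>u. ennreal (u ^ n * f u)))
      = (\<integral>\<^sup>+\<omega>. ennreal (T \<omega> ^ n * exp (- l * T \<omega>)) \<partial>M)" for l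
  proof -
    have "(\<integral>\<^sup>+\<omega>. ennreal (T \<omega> ^ n * exp (- l * T \<omega>)) \<partial>M) = (\<integral>\<^sup>+x. ennreal (x ^ n * exp (- l * x)) \<partial>distr M borel T)"
      by (subst nn_integral_distr) auto
    also have "\<dots> = (\<integral>\<^sup>+x. ennreal (f x) * ennreal (x ^ n * exp (- l * x)) \<partial>lborel)"
      unfolding distr_T_density[OF f] by (subst nn_integral_density) auto
    also have "\<dots> = (\<integral>\<^sup>+x. ennreal (x ^ n * f x) * ennreal (exp (- l * x)) \<partial>lborel)"
      using stable_densityD(3)[OF f] by (intro nn_integral_cong) (simp add: mult_ac flip: ennreal_mult' ennreal_mult'')
    finally show ?thesis by (subst nn_integral_density) auto
  qed
  have "density lborel (\<lambda>u. ennreal (u ^ n * f u)) = density lborel h"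
  proof (rule laplace_unique)
    show "AE u in density lborel (\<lambda>u. ennreal (u ^ n * f u)). 0 < u"
    proof (subst AE_density, simp, intro AE_I2 impI)
      fix u assume "0 < ennreal (u ^ n * f u)"
      then show "0 < u" using stable_densityD(4)[OF f, of u] by (cases "u \<le> 0") auto
    qed
    show "AE u in density lborel h. 0 < u"
    proof (subst AE_density, simp, intro AE_I2 impI)
      fix u assume "0 < h u"
      then show "0 < u" using conv0[of u] by (cases "u \<le> 0") (auto simp: h_def)
    qed
    show fin: "(\<integral>\<^sup>+x. ennreal (exp (- real (Suc m) * x)) \<partial>density lborel (\<lambda>u. ennreal (u ^ n * f u))) < \<infinity>" for m
      unfolding lapf using T_power_laplace[of "real (Suc m)" n] by simp
    fix m
    define l where "l = real (Suc m)"
    have l: "0 < l" by (simp add: l_def)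
    have "(\<integral>\<^sup>+x. ennreal (exp (- l * x)) \<partial>density lborel h) = (\<integral>\<^sup>+x. (\<Sum>\<pi>\<in>partitions n. ennreal (c \<pi>) * (ennreal (exp (- l * x)) * conv \<pi> x)) \<partial>lborel)"
      by (subst nn_integral_density) (auto simp: h_def sum_distrib_left sum_distrib_right mult_ac)
    also have "\<dots> = (\<Sum>\<pi>\<in>partitions n. ennreal (c \<pi>) * (\<integral>\<^sup>+x. ennreal (exp (- l * x)) * conv \<pi> x \<partial>lborel))"
      by (subst nn_integral_sum) (auto intro!: sum.cong nn_integral_cmult)
    also have "\<dots> = (\<Sum>\<pi>\<in>partitions n. ennreal (partition_weight g \<pi> * l powr (real (card \<pi>) * g - real n) * exp (- (l powr g))))"
    proof (intro sum.cong refl)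
      fix \<pi> assume \<pi>: "\<pi> \<in> partitions n"
      have "(\<integral>\<^sup>+x. ennreal (exp (- l * x)) * conv \<pi> x \<partial>lborel) = ennreal (Gamma (a \<pi>) * l powr (- a \<pi>)) * ennreal (exp (- (l powr g)))"
        unfolding conv_def using a[OF \<pi>] l
        by (subst nn_integral_exp_convolution) (auto simp: stable_densityD(5)[OF f, simplified])
      also have "ennreal (c \<pi>) * \<dots> = ennreal (c \<pi> * (Gamma (a \<pi>) * l powr (- a \<pi>) * exp (- (l powr g))))"
        using c[OF \<pi>] Ga[OF \<pi>] by (simp add: mult.assoc flip: ennreal_mult)
      also have "c \<pi> * (Gamma (a \<pi>) * l powr (- a \<pi>) * exp (- (l powr g))) = partition_weight g \<pi> * l powr (- a \<pi>) * exp (- (l powr g))"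
        using Ga[OF \<pi>] by (simp add: c_def less_imp_neq[symmetric])
      also have "- a \<pi> = real (card \<pi>) * g - real n" by (simp add: a_def)
      finally show "ennreal (c \<pi>) * (\<integral>\<^sup>+x. ennreal (exp (- l * x)) * conv \<pi> x \<partial>lborel) =
        ennreal (partition_weight g \<pi> * l powr (real (card \<pi>) * g - real n) * exp (- (l powr g)))" .
    qed
    also have "\<dots> = (\<integral>\<^sup>+x. ennreal (exp (- l * x)) \<partial>density lborel (\<lambda>u. ennreal (u ^ n * f u)))"
      unfolding lapf by (rule T_power_laplace[OF l, symmetric])
    finally show "(\<integral>\<^sup>+x. ennreal (exp (- real (Suc m) * x)) \<partial>density lborel (\<lambda>u. ennreal (u ^ n * f u))) =
        (\<integral>\<^sup>+x. ennreal (exp (- real (Suc m) * x)) \<partial>density lborel h)"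
      unfolding l_def by (rule sym)
  qed auto
  then have ae: "AE u in lborel. ennreal (u ^ n * f u) = h u"
    by (subst (asm) sigma_finite_measure.density_unique_iff[OF sigma_finite_lborel]) auto
  have conv_le: "conv \<pi> u \<le> ennreal (u powr (a \<pi> - 1) * (exp 1 * exp (- (u powr (- g)))))"
    if \<pi>: "\<pi> \<in> partitions n" and u: "0 < u" for \<pi> u
  proof -
    \<comment> \<open>A Chernoff bound: for \<open>v < u\<close> the factor
      \<open>exp (1 - v / u)\<close> is at least 1, so the mass below \<open>u\<close> is at most
      \<open>exp 1\<close> times the transform at \<open>1 / u\<close>, namely
      \<open>exp (- (u powr (- g)))\<close>.\<close>
    have "conv \<pi> u \<le> (\<integral>\<^sup>+v. ennreal (u powr (a \<pi> - 1) * exp 1) * (ennreal (exp (- (1 / u) * v)) * ennreal (f v)) \<partial>lborel)"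
      unfolding conv_def
    proof (rule nn_integral_mono)
      fix v :: real
      show "indicator {0<..} (u - v) * ennreal ((u - v) powr (a \<pi> - 1)) * ennreal (f v)
          \<le> ennreal (u powr (a \<pi> - 1) * exp 1) * (ennreal (exp (- (1 / u) * v)) * ennreal (f v))"
      proof (cases "0 < v \<and> v < u")
        case True
        have "(u - v) powr (a \<pi> - 1) * 1 \<le> u powr (a \<pi> - 1) * (exp 1 * exp (- (1 / u) * v))"
        proof (rule mult_mono)
          show "(u - v) powr (a \<pi> - 1) \<le> u powr (a \<pi> - 1)" using True a[OF \<pi>] by (intro powr_mono2) auto
          have "v / u \<le> 1" using True by simp
          then have "exp 0 \<le> exp (1 - v / u)" by simp
          then show "1 \<le> exp 1 * exp (- (1 / u) * v)" by (simp add: exp_add[symmetric])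
        qed auto
        then have "ennreal ((u - v) powr (a \<pi> - 1)) * ennreal (f v) \<le> ennreal (u powr (a \<pi> - 1) * (exp 1 * exp (- (1 / u) * v))) * ennreal (f v)"
          by (intro mult_right_mono ennreal_leI) auto
        then show ?thesis using True by (simp add: ennreal_mult mult.assoc)
      qed (use stable_densityD(4)[OF f, of v] in \<open>auto simp: indicator_def not_less\<close>)
    qed
    also have "\<dots> = ennreal (u powr (a \<pi> - 1) * exp 1) * ennreal (exp (- ((1 / u) powr g)))"
      using u stable_densityD(5)[OF f, of "1 / u"] by (subst nn_integral_cmult) auto
    also have "\<dots> = ennreal (u powr (a \<pi> - 1) * (exp 1 * exp (- (u powr (- g)))))"
      using u by (simp add: powr_divide powr_minus inverse_eq_divide mult.assoc flip: ennreal_mult)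
    finally show ?thesis .
  qed
  have "\<exists>D. \<forall>x\<ge>0 :: real. x ^ m * exp (- 1 * x) \<le> D" for m :: nat
  proof -
    obtain C where C: "\<And>x :: real. 0 \<le> x \<Longrightarrow> x ^ m * exp (- 1 * x) \<le> C"
      using power_times_exp_bounded[OF zero_less_one, where N = m] by metis
    have "\<forall>x\<ge>0. x ^ m * exp (- 1 * x) \<le> C" by (intro allI impI C)
    then show ?thesis by (rule exI)
  qed
  then obtain D where D: "\<And>m (x :: real). 0 \<le> x \<Longrightarrow> x ^ m * exp (- 1 * x) \<le> D m" by metis
  define C where "C = (\<Sum>\<pi>\<in>partitions n. c \<pi> * (exp 1 * D (card \<pi>)))"
  have "AE u in lborel. 0 < u \<longrightarrow> u * f u - C \<le> 0"
    using ae
  proof eventually_elim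
    case (elim u)
    show ?case
    proof
      assume u: "0 < u"
      have "ennreal (u ^ n * f u) \<le> (\<Sum>\<pi>\<in>partitions n. ennreal (c \<pi> * (u powr (a \<pi> - 1) * (exp 1 * exp (- (u powr (- g)))))))"
        unfolding elim h_def
        by (intro sum_mono) (use conv_le[OF _ u] c in \<open>auto simp: ennreal_mult' intro!: mult_left_mono\<close>)
      also have "\<dots> = ennreal (\<Sum>\<pi>\<in>partitions n. c \<pi> * (u powr (a \<pi> - 1) * (exp 1 * exp (- (u powr (- g))))))"
        using c by (intro sum_ennreal) auto
      finally have le: "u ^ n * f u \<le> (\<Sum>\<pi>\<in>partitions n. c \<pi> * (u powr (a \<pi> - 1) * (exp 1 * exp (- (u powr (- g))))))"
        using c by (subst (asm) ennreal_le_iff) (auto intro!: sum_nonneg)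
      have "u * f u = u powr (1 - real n) * (u ^ n * f u)"
        using u by (simp add: powr_realpow[symmetric] mult.assoc[symmetric] powr_add[symmetric])
      also have "\<dots> \<le> u powr (1 - real n) * (\<Sum>\<pi>\<in>partitions n. c \<pi> * (u powr (a \<pi> - 1) * (exp 1 * exp (- (u powr (- g))))))"
        by (rule mult_left_mono[OF le]) simp
      also have "\<dots> = (\<Sum>\<pi>\<in>partitions n. c \<pi> * (exp 1 * ((u powr (- g)) ^ card \<pi> * exp (- 1 * u powr (- g)))))"
        unfolding sum_distrib_left
      proof (intro sum.cong refl)
        fix \<pi> :: "nat set set"
        \<comment> \<open>What is left is a power of \<open>x = u powr (- g)\<close> with exponent
          the number of blocks, and such a power times \<open>exp (- x)\<close> is bounded by
          \<open>D\<close>.\<close>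
        have "u powr (1 - real n) * u powr (a \<pi> - 1) = u powr (- (real (card \<pi>) * g))"
          by (simp add: powr_add[symmetric] a_def)
        also have "\<dots> = (u powr (- g)) ^ card \<pi>"
          using u by (simp add: powr_realpow[symmetric] powr_powr mult.commute)
        finally have "u powr (1 - real n) * u powr (a \<pi> - 1) = (u powr (- g)) ^ card \<pi>" .
        then show "u powr (1 - real n) * (c \<pi> * (u powr (a \<pi> - 1) * (exp 1 * exp (- (u powr (- g))))))
            = c \<pi> * (exp 1 * ((u powr (- g)) ^ card \<pi> * exp (- 1 * u powr (- g))))"
          by (metis (no_types, lifting) mult.assoc mult.left_commute mult_minus1)
      qed
      also have "\<dots> \<le> C"
        unfolding C_def using c D by (intro sum_mono mult_left_mono) auto
      finally show "u * f u - C \<le> 0" by simp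
    qed
  qed
  moreover have "continuous_on {0<..} (\<lambda>u. u * f u - C)"
    using stable_densityD(1)[OF f] unfolding pos_density_def by (intro continuous_intros) auto
  ultimately have "u * f u - C \<le> 0" if "0 < u" for u by - (rule AE_nonpos_imp_nonpos[OF _ _ that])
  then show ?thesis using that[of C] by simp
qed

text \<open>The second variable enters only through its density \<open>fb\<close>, not as a random
  variable on the same space. The formula therefore serves both for the law conditioned on
  \<open>T\<close> and for the joint law with \<open>composed_time\<close>.\<close>

theorem composite_law:
  assumes other: "stable_points M' b J'" and \<beta>: "\<beta> = g * b"
    and fb: "stable_density b fb" and f\<beta>: "stable_density \<beta> f\<beta>"
    and Y: "\<And>j. 1 \<le> j \<Longrightarrow> j \<le> n \<Longrightarrow> Y_density f\<beta> \<beta> n j (h j)"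
    and \<pi>: "\<pi> \<in> partitions n" and n: "1 \<le> n" and G: "G \<in> borel_measurable borel"
  shows "(\<integral>\<^sup>+\<omega>. ennreal (partition_prob n \<pi> \<omega>) * (\<integral>\<^sup>+u. ennreal (fb u) * G (T \<omega> * u powr (1 / g)) \<partial>lborel) \<partial>M) =
    (\<integral>\<^sup>+y. ennreal (partition_weight g \<pi> * Gamma (real (card \<pi>)) / (g * Gamma (real n)) *
        (\<Sum>j=1..card \<pi>. blocks_prob (PD_law M' J') (card \<pi>) j * h j y)) * G y \<partial>lborel)"
proof -
  interpret B: stable_points M' b J' by fact
  define k where "k = card \<pi>"
  have k: "1 \<le> k" "k \<le> n" unfolding k_def using card_partition_pos[OF \<pi> n] card_partition_le[OF \<pi>] by auto
  have bs: "0 < \<beta>" "\<beta> < 1"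
    using g B.g mult_strict_mono[of g 1 b 1] by (auto simp: \<beta>)
  have Gk: "0 < Gamma (real k)" "0 < Gamma (real n)" using k n by (auto intro!: Gamma_real_pos)
  note [measurable] = stable_densityD(2)[OF fb]
  have hp: "pos_density (h j)" if "j \<in> {1..k}" for j using Y[of j] that k by (auto simp: Y_density_def)
  have hm [measurable]: "j \<in> {1..k} \<Longrightarrow> h j \<in> borel_measurable borel" for j by (rule pos_density_measurable[OF hp])
  define bp where "bp j = blocks_prob (PD_law M' J') k j" for j
  have bp0: "0 \<le> bp j" for j by (simp add: bp_def blocks_prob_def)
  define p where "p = partition_weight g \<pi> * Gamma (real k) / (g * Gamma (real n))"
  have p: "0 < p" unfolding p_def using partition_weight_pos[OF g, of \<pi>] Gk g by simp
  define H where "H y = p * (\<Sum>j=1..k. bp j * h j y)" for y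
  have H0: "0 \<le> H y" for y unfolding H_def using p bp0 pos_density_nonneg[OF hp] by (intro mult_nonneg_nonneg sum_nonneg) auto
  have Hm [measurable]: "H \<in> borel_measurable borel" unfolding H_def[abs_def] by (intro borel_measurable_times borel_measurable_sum borel_measurable_const hm)
  \<comment> \<open>Under \<open>D\<close> the sample point is weighted by the probability of
    \<open>\<pi>\<close> and paired with an independent \<open>u\<close> of density
    \<open>fb\<close>; \<open>\<mu>\<close> is the image under \<open>T * u powr (1 / g)\<close>,
    and \<open>\<nu>\<close> is the claimed law.\<close>
  define D where "D = density (M \<Otimes>\<^sub>M lborel) (\<lambda>(\<omega>, u). ennreal (partition_prob n \<pi> \<omega>) * ennreal (fb u))"
  define \<mu> where "\<mu> = distr D borel (\<lambda>(\<omega>, u). T \<omega> * u powr (1 / g))"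
  define \<nu> where "\<nu> = density lborel (\<lambda>y. ennreal (H y))"
  have [measurable_cong]: "sets D = sets (M \<Otimes>\<^sub>M lborel)" "sets \<mu> = sets borel" "sets \<nu> = sets borel"
    by (simp_all add: D_def \<mu>_def \<nu>_def)
  \<comment> \<open>Both orders of integration are needed: the first is the left side of the claim,
    while the second integrates over the points with \<open>u\<close> fixed, where
    \<open>partition_prob_laplace\<close> applies.\<close>
  have mu_integral: "(\<integral>\<^sup>+y. F y \<partial>\<mu>) = (\<integral>\<^sup>+\<omega>. ennreal (partition_prob n \<pi> \<omega>) * (\<integral>\<^sup>+u. ennreal (fb u) * F (T \<omega> * u powr (1 / g)) \<partial>lborel) \<partial>M)"
    and mu_integral': "(\<integral>\<^sup>+y. F y \<partial>\<mu>) = (\<integral>\<^sup>+u. ennreal (fb u) * (\<integral>\<^sup>+\<omega>. ennreal (partition_prob n \<pi> \<omega>) * F (T \<omega> * u powr (1 / g)) \<partial>M) \<partial>lborel)"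
    if [measurable]: "F \<in> borel_measurable borel" for F
  proof -
    interpret MB: pair_sigma_finite M lborel ..
    define F2 where "F2 \<omega> u = ennreal (partition_prob n \<pi> \<omega>) * ennreal (fb u) * F (T \<omega> * u powr (1 / g))" for \<omega> u
    have F2 [measurable]: "case_prod F2 \<in> borel_measurable (M \<Otimes>\<^sub>M lborel)" unfolding F2_def[abs_def] by measurable
    have 1: "(\<integral>\<^sup>+y. F y \<partial>\<mu>) = (\<integral>\<^sup>+z. case_prod F2 z \<partial>(M \<Otimes>\<^sub>M lborel))"
      unfolding \<mu>_def D_def F2_def by (simp add: nn_integral_distr nn_integral_density split_beta')
    also have "\<dots> = (\<integral>\<^sup>+\<omega>. (\<integral>\<^sup>+u. F2 \<omega> u \<partial>lborel) \<partial>M)"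
      using lborel.nn_integral_fst[OF F2] by simp
    also have "\<dots> = (\<integral>\<^sup>+\<omega>. ennreal (partition_prob n \<pi> \<omega>) * (\<integral>\<^sup>+u. ennreal (fb u) * F (T \<omega> * u powr (1 / g)) \<partial>lborel) \<partial>M)"
      unfolding F2_def mult.assoc by (intro nn_integral_cong nn_integral_cmult) measurable
    finally show "(\<integral>\<^sup>+y. F y \<partial>\<mu>) = (\<integral>\<^sup>+\<omega>. ennreal (partition_prob n \<pi> \<omega>) * (\<integral>\<^sup>+u. ennreal (fb u) * F (T \<omega> * u powr (1 / g)) \<partial>lborel) \<partial>M)" .
    have "(\<integral>\<^sup>+y. F y \<partial>\<mu>) = (\<integral>\<^sup>+u. (\<integral>\<^sup>+\<omega>. F2 \<omega> u \<partial>M) \<partial>lborel)"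
      unfolding 1 using MB.nn_integral_snd[OF F2] by simp
    also have "\<dots> = (\<integral>\<^sup>+u. ennreal (fb u) * (\<integral>\<^sup>+\<omega>. ennreal (partition_prob n \<pi> \<omega>) * F (T \<omega> * u powr (1 / g)) \<partial>M) \<partial>lborel)"
    proof (rule nn_integral_cong)
      fix u
      have "(\<integral>\<^sup>+\<omega>. F2 \<omega> u \<partial>M) = (\<integral>\<^sup>+\<omega>. ennreal (fb u) * (ennreal (partition_prob n \<pi> \<omega>) * F (T \<omega> * u powr (1 / g))) \<partial>M)"
        unfolding F2_def by (simp only: mult_ac)
      then show "(\<integral>\<^sup>+\<omega>. F2 \<omega> u \<partial>M) = ennreal (fb u) * (\<integral>\<^sup>+\<omega>. ennreal (partition_prob n \<pi> \<omega>) * F (T \<omega> * u powr (1 / g)) \<partial>M)"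
        by (simp add: nn_integral_cmult)
    qed
    finally show "(\<integral>\<^sup>+y. F y \<partial>\<mu>) = (\<integral>\<^sup>+u. ennreal (fb u) * (\<integral>\<^sup>+\<omega>. ennreal (partition_prob n \<pi> \<omega>) * F (T \<omega> * u powr (1 / g)) \<partial>M) \<partial>lborel)" .
  qed
  have mu_pos: "AE y in \<mu>. 0 < y"
  proof -
    have "(\<integral>\<^sup>+y. indicator {..0} y \<partial>\<mu>) = 0"
    proof -
      have "(\<integral>\<^sup>+y. indicator {..0} y \<partial>\<mu>) = (\<integral>\<^sup>+\<omega>. ennreal (partition_prob n \<pi> \<omega>) * (\<integral>\<^sup>+u. ennreal (fb u) * indicator {..0} (T \<omega> * u powr (1 / g)) \<partial>lborel) \<partial>M)"
        by (rule mu_integral) simp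
      also have "\<dots> = (\<integral>\<^sup>+\<omega>. 0 \<partial>M)"
      proof (rule nn_integral_cong_AE, use AE_good in eventually_elim)
        case (elim \<omega>)
        have "ennreal (fb u) * indicator {..0} (T \<omega> * u powr (1 / g)) = 0" for u
          using good_T_pos[OF elim] stable_densityD(4)[OF fb, of u]
          by (cases "0 < u") (auto simp: indicator_def mult_le_0_iff)
        then show ?case by (simp only: nn_integral_const mult_zero_left mult_zero_right)
      qed
      finally show ?thesis by simp
    qed
    then have "AE y in \<mu>. indicator {..0} y = (0 :: ennreal)" by (subst (asm) nn_integral_0_iff_AE) auto
    then show ?thesis by eventually_elim (auto simp: indicator_def split: if_splits)
  qed
  have nu_pos: "AE y in \<nu>. 0 < y"
    unfolding \<nu>_def
  proof (subst AE_density, simp, intro AE_I2 impI)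
    fix y assume "0 < ennreal (H y)"
    then show "0 < y" using pos_density_eq_0[OF hp, of _ y] by (cases "y \<le> 0") (auto simp: H_def)
  qed
  have mu_laplace: "(\<integral>\<^sup>+y. ennreal (y ^ n * exp (- l * y)) \<partial>\<mu>) =
      ennreal (\<Sum>\<pi>'\<in>partitions k. partition_weight g \<pi> * partition_weight b \<pi>' * l powr (real (card \<pi>') * \<beta> - real n) * exp (- (l powr \<beta>)))"
    if l: "0 < l" for l
  proof -
    have "(\<integral>\<^sup>+y. ennreal (y ^ n * exp (- l * y)) \<partial>\<mu>) = (\<integral>\<^sup>+u. ennreal (fb u) * (\<integral>\<^sup>+\<omega>. ennreal (partition_prob n \<pi> \<omega>) *
        ennreal ((T \<omega> * u powr (1 / g)) ^ n * exp (- l * (T \<omega> * u powr (1 / g)))) \<partial>M) \<partial>lborel)"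
      by (rule mu_integral') measurable
    also have "\<dots> = (\<integral>\<^sup>+u. ennreal (partition_weight g \<pi> * l powr (real k * g - real n)) * (ennreal (fb u) * ennreal (u ^ k * exp (- (l powr g) * u))) \<partial>lborel)"
    proof (rule nn_integral_cong)
      fix u :: real
      show "ennreal (fb u) * (\<integral>\<^sup>+\<omega>. ennreal (partition_prob n \<pi> \<omega>) * ennreal ((T \<omega> * u powr (1 / g)) ^ n * exp (- l * (T \<omega> * u powr (1 / g)))) \<partial>M)
        = ennreal (partition_weight g \<pi> * l powr (real k * g - real n)) * (ennreal (fb u) * ennreal (u ^ k * exp (- (l powr g) * u)))"
      proof (cases "0 < u")
        case True
        define m where "m = l * u powr (1 / g)"
        have m: "0 < m" using l True by (simp add: m_def)
        have "(\<integral>\<^sup>+\<omega>. ennreal (partition_prob n \<pi> \<omega>) * ennreal ((T \<omega> * u powr (1 / g)) ^ n * exp (- l * (T \<omega> * u powr (1 / g)))) \<partial>M)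
            = (\<integral>\<^sup>+\<omega>. ennreal (u powr (real n / g)) * (ennreal (partition_prob n \<pi> \<omega>) * ennreal (T \<omega> ^ n * exp (- m * T \<omega>))) \<partial>M)"
        proof (rule nn_integral_cong)
          fix \<omega>
          have "(u powr (1 / g)) ^ n = u powr (real n / g)"
            using True by (simp add: powr_realpow[symmetric] powr_powr)
          then have "(T \<omega> * u powr (1 / g)) ^ n * exp (- l * (T \<omega> * u powr (1 / g))) = u powr (real n / g) * (T \<omega> ^ n * exp (- m * T \<omega>))"
            by (simp add: power_mult_distrib m_def mult_ac)
          then show "ennreal (partition_prob n \<pi> \<omega>) * ennreal ((T \<omega> * u powr (1 / g)) ^ n * exp (- l * (T \<omega> * u powr (1 / g))))
            = ennreal (u powr (real n / g)) * (ennreal (partition_prob n \<pi> \<omega>) * ennreal (T \<omega> ^ n * exp (- m * T \<omega>)))"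
            by (simp only: ennreal_mult'[OF powr_ge_zero]) (rule mult.left_commute)
        qed
        also have "\<dots> = ennreal (u powr (real n / g)) * ennreal (partition_weight g \<pi> * m powr (real k * g - real n) * exp (- (m powr g)))"
          using partition_prob_laplace[OF \<pi> m] by (subst nn_integral_cmult) (simp_all add: k_def)
        also have "\<dots> = ennreal (u powr (real n / g) * (partition_weight g \<pi> * m powr (real k * g - real n) * exp (- (m powr g))))"
          by (simp add: ennreal_mult')
        also have "m powr g = l powr g * u" using l True g by (simp add: m_def powr_mult powr_powr)
        also have "m powr (real k * g - real n) = l powr (real k * g - real n) * u powr (real k - real n / g)"
          using l True g by (simp add: m_def powr_mult powr_powr diff_divide_distrib)
        also have "u powr (real n / g) * (partition_weight g \<pi> * (l powr (real k * g - real n) * u powr (real k - real n / g)) * exp (- (l powr g * u)))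
            = partition_weight g \<pi> * l powr (real k * g - real n) * ((u powr (real n / g) * u powr (real k - real n / g)) * exp (- (l powr g) * u))"
          by simp
        \<comment> \<open>The powers of \<open>u\<close> from the weight and from the parameter
          \<open>m\<close> combine to \<open>u ^ k\<close>. The number \<open>n\<close> of sampled
          items has disappeared, and \<open>u\<close> is left with the weight suited to a partition
          of \<open>k\<close> blocks.\<close>
        also have "u powr (real n / g) * u powr (real k - real n / g) = u ^ k"
          using True by (simp add: powr_add[symmetric] powr_realpow)
        finally show ?thesis
          using True partition_weight_pos[OF g, of \<pi>] by (simp add: ennreal_mult mult_ac)
      qed (use stable_densityD(4)[OF fb, of u] in simp)
    qed
    also have "\<dots> = ennreal (partition_weight g \<pi> * l powr (real k * g - real n)) * (\<integral>\<^sup>+u. ennreal (fb u) * ennreal (u ^ k * exp (- (l powr g) * u)) \<partial>lborel)"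
      by (rule nn_integral_cmult) measurable
    also have "(\<integral>\<^sup>+u. ennreal (fb u) * ennreal (u ^ k * exp (- (l powr g) * u)) \<partial>lborel) = (\<integral>\<^sup>+\<omega>. ennreal (B.T \<omega> ^ k * exp (- (l powr g) * B.T \<omega>)) \<partial>M')"
    proof -
      have "(\<integral>\<^sup>+\<omega>. ennreal (B.T \<omega> ^ k * exp (- (l powr g) * B.T \<omega>)) \<partial>M') = (\<integral>\<^sup>+u. ennreal (u ^ k * exp (- (l powr g) * u)) \<partial>distr M' borel B.T)"
        by (subst nn_integral_distr) auto
      also have "\<dots> = (\<integral>\<^sup>+u. ennreal (fb u) * ennreal (u ^ k * exp (- (l powr g) * u)) \<partial>lborel)"
        unfolding B.distr_T_density[OF fb] by (subst nn_integral_density) auto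
      finally show ?thesis ..
    qed
    also have "\<dots> = (\<Sum>\<pi>'\<in>partitions k. ennreal (partition_weight b \<pi>' * (l powr g) powr (real (card \<pi>') * b - real k) * exp (- ((l powr g) powr b))))"
      using l by (intro B.T_power_laplace) simp
    also have "\<dots> = ennreal (\<Sum>\<pi>'\<in>partitions k. partition_weight b \<pi>' * (l powr g) powr (real (card \<pi>') * b - real k) * exp (- ((l powr g) powr b)))"
      using partition_weight_pos[OF B.g] by (intro sum_ennreal) (simp add: less_imp_le)
    also have "ennreal (partition_weight g \<pi> * l powr (real k * g - real n)) * \<dots>
        = ennreal (partition_weight g \<pi> * l powr (real k * g - real n) * (\<Sum>\<pi>'\<in>partitions k. partition_weight b \<pi>' * (l powr g) powr (real (card \<pi>') * b - real k) * exp (- ((l powr g) powr b))))"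
      using partition_weight_pos[OF g, of \<pi>] by (subst ennreal_mult') auto
    also have "partition_weight g \<pi> * l powr (real k * g - real n) * (\<Sum>\<pi>'\<in>partitions k. partition_weight b \<pi>' * (l powr g) powr (real (card \<pi>') * b - real k) * exp (- ((l powr g) powr b)))
        = (\<Sum>\<pi>'\<in>partitions k. partition_weight g \<pi> * partition_weight b \<pi>' * l powr (real (card \<pi>') * \<beta> - real n) * exp (- (l powr \<beta>)))"
      unfolding sum_distrib_left
    proof (intro sum.cong refl)
      fix \<pi>' :: "nat set set"
      have 1: "(l powr g) powr b = l powr \<beta>" by (simp add: powr_powr \<beta>)
      have "l powr (real k * g - real n) * (l powr g) powr (real (card \<pi>') * b - real k) = l powr ((real k * g - real n) + g * (real (card \<pi>') * b - real k))"
        by (simp only: powr_powr powr_add)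
      also have "(real k * g - real n) + g * (real (card \<pi>') * b - real k) = real (card \<pi>') * \<beta> - real n"
        by (simp add: \<beta> algebra_simps)
      finally have 2: "l powr (real k * g - real n) * (l powr g) powr (real (card \<pi>') * b - real k) = l powr (real (card \<pi>') * \<beta> - real n)" .
      have "partition_weight g \<pi> * l powr (real k * g - real n) * (partition_weight b \<pi>' * (l powr g) powr (real (card \<pi>') * b - real k) * exp (- ((l powr g) powr b)))
          = partition_weight g \<pi> * partition_weight b \<pi>' * (l powr (real k * g - real n) * (l powr g) powr (real (card \<pi>') * b - real k)) * exp (- (l powr \<beta>))"
        unfolding 1 by (simp only: mult_ac)
      then show "partition_weight g \<pi> * l powr (real k * g - real n) * (partition_weight b \<pi>' * (l powr g) powr (real (card \<pi>') * b - real k) * exp (- ((l powr g) powr b)))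
        = partition_weight g \<pi> * partition_weight b \<pi>' * l powr (real (card \<pi>') * \<beta> - real n) * exp (- (l powr \<beta>))"
        unfolding 2 .
    qed
    finally show ?thesis .
  qed
  have nu_laplace: "(\<integral>\<^sup>+y. ennreal (y ^ n * exp (- l * y)) \<partial>\<nu>) =
      ennreal (\<Sum>\<pi>'\<in>partitions k. partition_weight g \<pi> * partition_weight b \<pi>' * l powr (real (card \<pi>') * \<beta> - real n) * exp (- (l powr \<beta>)))"
    if l: "0 < l" for l
  proof -
    define cc where "cc j = \<beta> * Gamma (real n) / Gamma (real j) * l powr (real j * \<beta> - real n) * exp (- (l powr \<beta>))" for j
    have cc0: "0 \<le> cc j" if "j \<in> {1..k}" for j
      using that bs Gk less_imp_le[OF Gamma_real_pos[of "real j"]] by (simp add: cc_def)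
    have "(\<integral>\<^sup>+y. ennreal (y ^ n * exp (- l * y)) \<partial>\<nu>) = (\<integral>\<^sup>+y. (\<Sum>j=1..k. ennreal (p * bp j) * (ennreal (y ^ n * exp (- l * y)) * ennreal (h j y))) \<partial>lborel)"
      unfolding \<nu>_def
    proof (subst nn_integral_density, simp, simp, rule nn_integral_cong)
      fix y
      have "ennreal (H y) = (\<Sum>j=1..k. ennreal (p * bp j) * ennreal (h j y))"
        unfolding H_def sum_distrib_left using p bp0 pos_density_nonneg[OF hp]
        by (subst sum_ennreal[symmetric]) (auto simp: mult.assoc[symmetric] ennreal_mult intro!: sum.cong mult_nonneg_nonneg less_imp_le[OF p])
      then show "ennreal (H y) * ennreal (y ^ n * exp (- l * y)) = (\<Sum>j=1..k. ennreal (p * bp j) * (ennreal (y ^ n * exp (- l * y)) * ennreal (h j y)))"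
        by (simp add: sum_distrib_left mult_ac)
    qed
    also have "\<dots> = (\<Sum>j=1..k. \<integral>\<^sup>+y. ennreal (p * bp j) * (ennreal (y ^ n * exp (- l * y)) * ennreal (h j y)) \<partial>lborel)"
      by (rule nn_integral_sum) (use hm in measurable)
    also have "\<dots> = (\<Sum>j=1..k. ennreal (p * bp j) * ennreal (cc j))"
    proof (intro sum.cong refl)
      fix j assume j: "j \<in> {1..k}"
      note [measurable] = hm[OF j]
      have "(\<integral>\<^sup>+y. ennreal (y ^ n * exp (- l * y)) * ennreal (h j y) \<partial>lborel) = ennreal (cc j)"
        unfolding cc_def using j k by (intro Y_density_laplace[OF f\<beta> Y bs _ _ l]) auto
      then show "(\<integral>\<^sup>+y. ennreal (p * bp j) * (ennreal (y ^ n * exp (- l * y)) * ennreal (h j y)) \<partial>lborel) = ennreal (p * bp j) * ennreal (cc j)"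
        by (subst nn_integral_cmult) simp_all
    qed
    also have "\<dots> = ennreal (\<Sum>j=1..k. p * bp j * cc j)"
      using p bp0 cc0 by (subst sum_ennreal[symmetric]) (auto simp: ennreal_mult' intro!: sum.cong mult_nonneg_nonneg less_imp_le[OF p])
    \<comment> \<open>The Gamma factors telescope: \<open>p\<close> has
      \<open>Gamma k / (g * Gamma n)\<close>, the block probability has
      \<open>Gamma j / (b * Gamma k)\<close>, the transform of \<open>h j\<close> has
      \<open>\<beta> * Gamma n / Gamma j\<close>, and \<open>\<beta> = g * b\<close>.\<close>
    also have "(\<Sum>j=1..k. p * bp j * cc j) = (\<Sum>j=1..k. \<Sum>\<pi>' | \<pi>' \<in> partitions k \<and> card \<pi>' = j.
        partition_weight g \<pi> * partition_weight b \<pi>' * l powr (real (card \<pi>') * \<beta> - real n) * exp (- (l powr \<beta>)))"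
    proof (intro sum.cong refl)
      fix j assume j: "j \<in> {1..k}"
      have Gj: "Gamma (real j) \<noteq> 0" using j less_imp_neq[OF Gamma_real_pos[of "real j"]] by auto
      have Gkn: "Gamma (real k) \<noteq> 0" "Gamma (real n) \<noteq> 0" using less_imp_neq[OF Gk(1)] less_imp_neq[OF Gk(2)] by auto
      show "p * bp j * cc j = (\<Sum>\<pi>' | \<pi>' \<in> partitions k \<and> card \<pi>' = j.
          partition_weight g \<pi> * partition_weight b \<pi>' * l powr (real (card \<pi>') * \<beta> - real n) * exp (- (l powr \<beta>)))"
        unfolding bp_def B.blocks_prob_PD_law[OF k(1)] sum_distrib_left sum_distrib_right
      proof (intro sum.cong refl)
        fix \<pi>' assume "\<pi>' \<in> {\<pi>' \<in> partitions k. card \<pi>' = j}"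
        then have "card \<pi>' = j" by simp
        then show "p * (partition_weight b \<pi>' * Gamma (real j) / (b * Gamma (real k))) * cc j =
          partition_weight g \<pi> * partition_weight b \<pi>' * l powr (real (card \<pi>') * \<beta> - real n) * exp (- (l powr \<beta>))"
          using Gj Gkn g B.g by (simp add: p_def cc_def \<beta>)
      qed
    qed
    \<comment> \<open>Grouping by the number of blocks is the only place where the index
      \<open>j\<close> of the claimed sum comes from.\<close>
    also have "\<dots> = (\<Sum>\<pi>'\<in>partitions k. partition_weight g \<pi> * partition_weight b \<pi>' * l powr (real (card \<pi>') * \<beta> - real n) * exp (- (l powr \<beta>)))"
      using card_partition_pos[OF _ k(1)] card_partition_le[of _ k] by (intro sum.group) auto
    finally show ?thesis .
  qed
  have eq: "density \<mu> (\<lambda>y. ennreal (y ^ n)) = density \<nu> (\<lambda>y. ennreal (y ^ n))"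
  proof (rule laplace_unique)
    show "AE y in density \<mu> (\<lambda>y. ennreal (y ^ n)). 0 < y"
      using mu_pos by (subst AE_density) auto
    show "AE y in density \<nu> (\<lambda>y. ennreal (y ^ n)). 0 < y"
      using nu_pos by (subst AE_density) auto
    have tr: "(\<integral>\<^sup>+y. ennreal (exp (- l * y)) \<partial>density L (\<lambda>y. ennreal (y ^ n))) = (\<integral>\<^sup>+y. ennreal (y ^ n * exp (- l * y)) \<partial>L)"
      if [measurable_cong]: "sets L = sets borel" for L and l :: real
      by (subst nn_integral_density) (auto simp: ennreal_mult'' intro!: nn_integral_cong)
    show "(\<integral>\<^sup>+y. ennreal (exp (- real (Suc m) * y)) \<partial>density \<mu> (\<lambda>y. ennreal (y ^ n))) < \<infinity>" for m
      unfolding tr[OF \<open>sets \<mu> = sets borel\<close>] by (subst mu_laplace) auto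
    show "(\<integral>\<^sup>+y. ennreal (exp (- real (Suc m) * y)) \<partial>density \<mu> (\<lambda>y. ennreal (y ^ n))) = (\<integral>\<^sup>+y. ennreal (exp (- real (Suc m) * y)) \<partial>density \<nu> (\<lambda>y. ennreal (y ^ n)))" for m
      unfolding tr[OF \<open>sets \<mu> = sets borel\<close>] tr[OF \<open>sets \<nu> = sets borel\<close>] by (subst mu_laplace, simp, subst nu_laplace) auto
  qed (simp_all add: \<mu>_def \<nu>_def)
  \<comment> \<open>As \<open>y\<close> is positive almost everywhere, the weight
    \<open>y ^ n\<close> can be divided out again.\<close>
  have unweight: "(\<integral>\<^sup>+y. G y \<partial>L) = (\<integral>\<^sup>+y. ennreal (1 / y ^ n) * G y \<partial>density L (\<lambda>y. ennreal (y ^ n)))"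
    if [measurable_cong]: "sets L = sets borel" and pos: "AE y in L. 0 < y" for L
  proof -
    note [measurable] = G
    have "(\<integral>\<^sup>+y. ennreal (1 / y ^ n) * G y \<partial>density L (\<lambda>y. ennreal (y ^ n))) = (\<integral>\<^sup>+y. ennreal (y ^ n) * (ennreal (1 / y ^ n) * G y) \<partial>L)"
      by (subst nn_integral_density) auto
    also have "\<dots> = (\<integral>\<^sup>+y. G y \<partial>L)"
      by (rule nn_integral_cong_AE, use pos in eventually_elim) (simp add: mult.assoc[symmetric] flip: ennreal_mult)
    finally show ?thesis ..
  qed
  have "(\<integral>\<^sup>+y. G y \<partial>\<mu>) = (\<integral>\<^sup>+y. G y \<partial>\<nu>)"
    unfolding unweight[OF \<open>sets \<mu> = sets borel\<close> mu_pos] unweight[OF \<open>sets \<nu> = sets borel\<close> nu_pos] eq ..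
  also have "\<dots> = (\<integral>\<^sup>+y. ennreal (H y) * G y \<partial>lborel)"
    unfolding \<nu>_def using G by (subst nn_integral_density) auto
  finally show ?thesis
    unfolding mu_integral[OF G] H_def p_def bp_def k_def .
qed

end

section \<open>Independence, sampled indices and the composed time\<close>

text \<open>Independence makes the joint law a product measure. The second variable is frozen in the
  outer integral, which is the order used for a random scale and for a random time.\<close>

lemma (in prob_space) nn_integral_independent_rvs:
  assumes ind: "independent_rvs M S X S' X'" and F [measurable]: "F \<in> borel_measurable (S \<Otimes>\<^sub>M S')"
  shows "(\<integral>\<^sup>+\<omega>. F (X \<omega>, X' \<omega>) \<partial>M) = (\<integral>\<^sup>+\<omega>'. (\<integral>\<^sup>+\<omega>. F (X \<omega>, X' \<omega>') \<partial>M) \<partial>M)"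
proof -
  have [measurable]: "X \<in> M \<rightarrow>\<^sub>M S" "X' \<in> M \<rightarrow>\<^sub>M S'" using ind by (simp_all add: independent_rvs_def)
  interpret D: prob_space "distr M S X" by (rule prob_space_distr) measurable
  interpret D': prob_space "distr M S' X'" by (rule prob_space_distr) measurable
  interpret P: pair_sigma_finite "distr M S X" "distr M S' X'" ..
  have "distr M S X \<Otimes>\<^sub>M distr M S' X' = distr M (S \<Otimes>\<^sub>M S') (\<lambda>\<omega>. (X \<omega>, X' \<omega>))"
  proof (rule pair_measure_eqI)
    fix A B assume "A \<in> sets (distr M S X)" "B \<in> sets (distr M S' X')"
    then have [measurable]: "A \<in> sets S" "B \<in> sets S'" by simp_all
    have "prob ((X -` A \<inter> space M) \<inter> (X' -` B \<inter> space M)) = prob (X -` A \<inter> space M) * prob (X' -` B \<inter> space M)"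
      using ind unfolding independent_rvs_def by (intro indep_setD) auto
    moreover have "(X -` A \<inter> space M) \<inter> (X' -` B \<inter> space M) = (\<lambda>\<omega>. (X \<omega>, X' \<omega>)) -` (A \<times> B) \<inter> space M" by auto
    ultimately show "emeasure (distr M S X) A * emeasure (distr M S' X') B = emeasure (distr M (S \<Otimes>\<^sub>M S') (\<lambda>\<omega>. (X \<omega>, X' \<omega>))) (A \<times> B)"
      by (simp add: emeasure_distr emeasure_eq_measure ennreal_mult)
  qed (auto intro: D.sigma_finite_measure_axioms D'.sigma_finite_measure_axioms)
  then have "(\<integral>\<^sup>+\<omega>. F (X \<omega>, X' \<omega>) \<partial>M) = (\<integral>\<^sup>+z. F z \<partial>(distr M S X \<Otimes>\<^sub>M distr M S' X'))"
    by (simp add: nn_integral_distr)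
  also have "\<dots> = (\<integral>\<^sup>+x'. (\<integral>\<^sup>+x. F (x, x') \<partial>distr M S X) \<partial>distr M S' X')"
    by (rule P.nn_integral_snd[symmetric]) measurable
  also have "\<dots> = (\<integral>\<^sup>+\<omega>'. (\<integral>\<^sup>+\<omega>. F (X \<omega>, X' \<omega>') \<partial>M) \<partial>M)"
  proof -
    have "(\<integral>\<^sup>+x. F (x, x') \<partial>distr M S X) = (\<integral>\<^sup>+\<omega>. F (X \<omega>, x') \<partial>M)" if "x' \<in> space S'" for x'
      using that by (intro nn_integral_distr) measurable
    moreover have "(\<lambda>x'. \<integral>\<^sup>+x. F (x, x') \<partial>distr M S X) \<in> borel_measurable S'" by measurable
    ultimately show ?thesis
      by (subst nn_integral_distr) (auto intro!: nn_integral_cong dest: measurable_space[OF \<open>X' \<in> M \<rightarrow>\<^sub>M S'\<close>])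
  qed
  finally show ?thesis .
qed

text \<open>\<open>laplace_unique\<close> asks for strictly positive support. Shifting both
  variables by 1 multiplies the transforms by the same factor and reduces nonnegative variables to
  that case.\<close>

lemma distr_eqI_laplace:
  fixes X :: "'a \<Rightarrow> real" and Y :: "'b \<Rightarrow> real"
  assumes [measurable]: "X \<in> borel_measurable M" "Y \<in> borel_measurable N"
    and "AE \<omega> in M. 0 \<le> X \<omega>" "AE \<omega> in N. 0 \<le> Y \<omega>"
    and X: "\<And>l. 0 < l \<Longrightarrow> (\<integral>\<^sup>+\<omega>. ennreal (exp (- l * X \<omega>)) \<partial>M) = ennreal (\<psi> l)"
    and Y: "\<And>l. 0 < l \<Longrightarrow> (\<integral>\<^sup>+\<omega>. ennreal (exp (- l * Y \<omega>)) \<partial>N) = ennreal (\<psi> l)"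
  shows "distr M borel X = distr N borel Y"
proof -
  have "distr M borel (\<lambda>\<omega>. X \<omega> + 1) = distr N borel (\<lambda>\<omega>. Y \<omega> + 1)"
  proof (rule laplace_unique)
    show "AE x in distr M borel (\<lambda>\<omega>. X \<omega> + 1). 0 < x"
      by (subst AE_distr_iff, simp, simp, use assms(3) in eventually_elim) simp
    show "AE x in distr N borel (\<lambda>\<omega>. Y \<omega> + 1). 0 < x"
      by (subst AE_distr_iff, simp, simp, use assms(4) in eventually_elim) simp
    have shift: "exp (- l * (x + 1)) = exp (- l) * exp (- l * x)" for l x :: real
      by (simp add: exp_add[symmetric] algebra_simps)
    have 1: "(\<integral>\<^sup>+x. ennreal (exp (- real (Suc n) * x)) \<partial>distr M borel (\<lambda>\<omega>. X \<omega> + 1)) = ennreal (exp (- real (Suc n))) * ennreal (\<psi> (real (Suc n)))" for n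
    proof -
      have "(\<integral>\<^sup>+x. ennreal (exp (- real (Suc n) * x)) \<partial>distr M borel (\<lambda>\<omega>. X \<omega> + 1)) = (\<integral>\<^sup>+\<omega>. ennreal (exp (- real (Suc n) * (X \<omega> + 1))) \<partial>M)"
        by (rule nn_integral_distr) measurable
      also have "\<dots> = ennreal (exp (- real (Suc n))) * (\<integral>\<^sup>+\<omega>. ennreal (exp (- real (Suc n) * X \<omega>)) \<partial>M)"
        unfolding shift ennreal_mult'[OF exp_ge_zero] by (rule nn_integral_cmult) measurable
      finally show ?thesis unfolding X[OF of_nat_0_less_iff[THEN iffD2, OF zero_less_Suc]] .
    qed
    have 2: "(\<integral>\<^sup>+x. ennreal (exp (- real (Suc n) * x)) \<partial>distr N borel (\<lambda>\<omega>. Y \<omega> + 1)) = ennreal (exp (- real (Suc n))) * ennreal (\<psi> (real (Suc n)))" for n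
    proof -
      have "(\<integral>\<^sup>+x. ennreal (exp (- real (Suc n) * x)) \<partial>distr N borel (\<lambda>\<omega>. Y \<omega> + 1)) = (\<integral>\<^sup>+\<omega>. ennreal (exp (- real (Suc n) * (Y \<omega> + 1))) \<partial>N)"
        by (rule nn_integral_distr) measurable
      also have "\<dots> = ennreal (exp (- real (Suc n))) * (\<integral>\<^sup>+\<omega>. ennreal (exp (- real (Suc n) * Y \<omega>)) \<partial>N)"
        unfolding shift ennreal_mult'[OF exp_ge_zero] by (rule nn_integral_cmult) measurable
      finally show ?thesis unfolding Y[OF of_nat_0_less_iff[THEN iffD2, OF zero_less_Suc]] .
    qed
    show "(\<integral>\<^sup>+x. ennreal (exp (- real (Suc n) * x)) \<partial>distr M borel (\<lambda>\<omega>. X \<omega> + 1)) < \<infinity>" for n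
      unfolding 1 by (simp add: ennreal_mult_less_top)
    show "(\<integral>\<^sup>+x. ennreal (exp (- real (Suc n) * x)) \<partial>distr M borel (\<lambda>\<omega>. X \<omega> + 1)) = (\<integral>\<^sup>+x. ennreal (exp (- real (Suc n) * x)) \<partial>distr N borel (\<lambda>\<omega>. Y \<omega> + 1))" for n
      unfolding 1 2 ..
  qed auto
  then have "distr (distr M borel (\<lambda>\<omega>. X \<omega> + 1)) borel (\<lambda>x. x - 1) = distr (distr N borel (\<lambda>\<omega>. Y \<omega> + 1)) borel (\<lambda>x. x - 1)" by simp
  then show ?thesis by (simp add: distr_distr comp_def)
qed

lemma countable_index_maps: "countable (index_maps n \<pi>)"
proof (rule countable_image_inj_on)
  show "countable ((\<lambda>i. map i [1..<Suc n]) ` index_maps n \<pi>)" by simp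
  show "inj_on (\<lambda>i. map i [1..<Suc n]) (index_maps n \<pi>)"
  proof (rule inj_onI, rule ext)
    fix i i' m assume *: "i \<in> index_maps n \<pi>" "i' \<in> index_maps n \<pi>" "map i [1..<Suc n] = map i' [1..<Suc n]"
    show "i m = i' m"
    proof (cases "m \<in> {1..n}")
      case True
      then have "m \<in> set [1..<Suc n]" by auto
      then show ?thesis using *(3) map_eq_conv by metis
    next
      case False
      then show ?thesis using *(1,2) unfolding index_maps_def by simp
    qed
  qed
qed

lemma index_partition_cong: "(\<And>m. m \<in> {1..n} \<Longrightarrow> i m = i' m) \<Longrightarrow> index_partition n i = index_partition n i'"
  unfolding index_partition_def by (intro image_cong) auto

text \<open>Only \<open>I\<close> restricted to \<open>{1..n}\<close> with default 0 can agree with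
  \<open>I\<close> on that set, so the sum has at most one nonzero term. It writes the event of
  sampling \<open>\<pi>\<close> as a countable disjoint union of events for which
  \<open>iid_indices_given\<close> gives a formula.\<close>

lemma nn_integral_index_maps:
  "(\<integral>\<^sup>+i. (if \<forall>m\<in>{1..n}. I m = i m then 1 else 0) \<partial>count_space (index_maps n \<pi>)) = (if index_partition n I = \<pi> then 1 else (0 :: ennreal))"
proof -
  define i0 where "i0 m = (if m \<in> {1..n} then I m else 0)" for m
  have ip: "index_partition n i0 = index_partition n I" by (rule index_partition_cong) (simp only: i0_def if_True)
  have uniq: "i = i0" if "i \<in> index_maps n \<pi>" "\<forall>m\<in>{1..n}. I m = i m" for i
  proof (rule ext)
    fix m
    show "i m = i0 m" using that unfolding index_maps_def i0_def by (cases "m \<in> {1..n}") auto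
  qed
  show ?thesis
  proof (cases "index_partition n I = \<pi>")
    case True
    moreover have "i0 m = 0" if "m \<notin> {1..n}" for m using that by (simp only: i0_def if_False)
    ultimately have "i0 \<in> index_maps n \<pi>" unfolding index_maps_def mem_Collect_eq ip by blast
    then have "(\<integral>\<^sup>+i. (if \<forall>m\<in>{1..n}. I m = i m then 1 else 0) \<partial>count_space (index_maps n \<pi>)) = (\<Sum>i\<in>{i0}. if \<forall>m\<in>{1..n}. I m = i m then 1 else (0 :: ennreal))"
      using uniq by (intro nn_integral_count_space') auto
    also have "\<dots> = 1" by (simp add: i0_def)
    finally show ?thesis using True by simp
  next
    case False
    have "(if \<forall>m\<in>{1..n}. I m = i m then 1 else 0) = (0 :: ennreal)" if "i \<in> index_maps n \<pi>" for i
      using uniq[OF that] that False ip unfolding index_maps_def by force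
    then have "(\<integral>\<^sup>+i. (if \<forall>m\<in>{1..n}. I m = i m then 1 else 0) \<partial>count_space (index_maps n \<pi>)) = (\<integral>\<^sup>+i. 0 \<partial>count_space (index_maps n \<pi>))"
      by (intro nn_integral_cong) simp
    then show ?thesis using False by simp
  qed
qed

context stable_points
begin

text \<open>The realized indices give the same integrals as the sampling kernel: under functions of
  the normalized points, the indicator of sampling \<open>\<pi>\<close> may be replaced by its
  conditional probability.\<close>

lemma nn_integral_index_partition:
  assumes I: "iid_indices_given M (normalized J) I" and F: "F \<in> borel_measurable seq_space"
  shows "(\<integral>\<^sup>+\<omega>. (if index_partition n (\<lambda>m. I m \<omega>) = \<pi> then 1 else 0) * F (normalized J \<omega>) \<partial>M) =
    (\<integral>\<^sup>+\<omega>. ennreal (partition_prob n \<pi> \<omega>) * F (normalized J \<omega>) \<partial>M)"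
proof -
  have [measurable]: "I m \<in> M \<rightarrow>\<^sub>M count_space UNIV" for m using I by (simp add: iid_indices_given_def)
  note [measurable] = normalized_measurable
  define e where "e i \<omega> = (if \<forall>m\<in>{1..n}. I m \<omega> = i m then 1 else (0 :: ennreal))" for i \<omega>
  have e [measurable]: "e i \<in> borel_measurable M" for i unfolding e_def by measurable
  have ind_e: "(if index_partition n (\<lambda>m. I m \<omega>) = \<pi> then 1 else 0) = (\<integral>\<^sup>+i. e i \<omega> \<partial>count_space (index_maps n \<pi>))" for \<omega>
    unfolding e_def by (rule nn_integral_index_maps[symmetric])
  interpret C: sigma_finite_measure "count_space (index_maps n \<pi>)"
    by (rule sigma_finite_measure_count_space_countable[OF countable_index_maps])
  have e' [measurable]: "(\<lambda>\<omega>. if index_partition n (\<lambda>m. I m \<omega>) = \<pi> then 1 else (0 :: ennreal)) \<in> borel_measurable M"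
    unfolding ind_e
  proof (rule C.borel_measurable_nn_integral)
    have *: "(\<lambda>(i, \<omega>). e i \<omega>) \<in> borel_measurable (count_space (index_maps n \<pi>) \<Otimes>\<^sub>M M)"
      by (rule measurable_pair_measure_countable1[OF countable_index_maps]) simp
    show "(\<lambda>(\<omega>, i). e i \<omega>) \<in> borel_measurable (M \<Otimes>\<^sub>M count_space (index_maps n \<pi>))"
      using measurable_compose[OF measurable_pair_swap' *] by (simp add: split_beta)
  qed
  \<comment> \<open>The product formula is available for events of the normalized sequence. Stated
    as an equality of image measures, it extends to every \<open>F\<close>.\<close>
  have "distr (density M (\<lambda>\<omega>. if index_partition n (\<lambda>m. I m \<omega>) = \<pi> then 1 else 0)) seq_space (normalized J)
      = distr (density M (\<lambda>\<omega>. ennreal (partition_prob n \<pi> \<omega>))) seq_space (normalized J)" (is "?L = ?R")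
  proof (rule measure_eqI)
    fix A assume "A \<in> sets ?L"
    then have A [measurable]: "A \<in> sets seq_space" by simp
    have "emeasure ?L A = (\<integral>\<^sup>+\<omega>. (if index_partition n (\<lambda>m. I m \<omega>) = \<pi> then 1 else 0) * indicator A (normalized J \<omega>) \<partial>M)"
      by (simp add: nn_integral_indicator[symmetric] nn_integral_distr nn_integral_density del: nn_integral_indicator)
    also have "\<dots> = (\<integral>\<^sup>+\<omega>. (\<integral>\<^sup>+i. e i \<omega> * indicator A (normalized J \<omega>) \<partial>count_space (index_maps n \<pi>)) \<partial>M)"
      unfolding ind_e by (intro nn_integral_cong nn_integral_multc[symmetric]) simp
    also have "\<dots> = (\<integral>\<^sup>+i. (\<integral>\<^sup>+\<omega>. e i \<omega> * indicator A (normalized J \<omega>) \<partial>M) \<partial>count_space (index_maps n \<pi>))"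
      by (rule nn_integral_count_space_nn_integral[OF countable_index_maps]) measurable
    also have "\<dots> = (\<integral>\<^sup>+i. (\<integral>\<^sup>+\<omega>. indicator A (normalized J \<omega>) * ennreal (\<Prod>m\<in>{1..n}. normalized J \<omega> (i m)) \<partial>M) \<partial>count_space (index_maps n \<pi>))"
    proof (rule nn_integral_cong)
      fix i
      have "(\<integral>\<^sup>+\<omega>. e i \<omega> * indicator A (normalized J \<omega>) \<partial>M) = (\<integral>\<^sup>+\<omega>. indicator {\<omega> \<in> space M. normalized J \<omega> \<in> A \<and> (\<forall>m\<in>{1..n}. I m \<omega> = i m)} \<omega> \<partial>M)"
        by (rule nn_integral_cong) (simp add: e_def indicator_def)
      also have "\<dots> = emeasure M {\<omega> \<in> space M. normalized J \<omega> \<in> A \<and> (\<forall>m\<in>{1..n}. I m \<omega> = i m)}"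
        by (rule nn_integral_indicator) measurable
      also have "\<dots> = (\<integral>\<^sup>+\<omega>. indicator A (normalized J \<omega>) * ennreal (\<Prod>m\<in>{1..n}. normalized J \<omega> (i m)) \<partial>M)"
        using I A unfolding iid_indices_given_def by blast
      finally show "(\<integral>\<^sup>+\<omega>. e i \<omega> * indicator A (normalized J \<omega>) \<partial>M) = (\<integral>\<^sup>+\<omega>. indicator A (normalized J \<omega>) * ennreal (\<Prod>m\<in>{1..n}. normalized J \<omega> (i m)) \<partial>M)" .
    qed
    also have "\<dots> = (\<integral>\<^sup>+\<omega>. (\<integral>\<^sup>+i. indicator A (normalized J \<omega>) * ennreal (\<Prod>m\<in>{1..n}. normalized J \<omega> (i m)) \<partial>count_space (index_maps n \<pi>)) \<partial>M)"
    proof (rule nn_integral_count_space_nn_integral[OF countable_index_maps, symmetric])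
      fix i :: "nat \<Rightarrow> nat"
      have [measurable]: "(\<lambda>\<omega>. normalized J \<omega> k) \<in> borel_measurable M" for k
        unfolding normalized_def by measurable
      show "(\<lambda>\<omega>. indicator A (normalized J \<omega>) * ennreal (\<Prod>m\<in>{1..n}. normalized J \<omega> (i m))) \<in> borel_measurable M" by measurable
    qed
    also have "\<dots> = (\<integral>\<^sup>+\<omega>. ennreal (partition_prob n \<pi> \<omega>) * indicator A (normalized J \<omega>) \<partial>M)"
    proof (rule nn_integral_cong_AE, use AE_normalized in eventually_elim)
      case (elim \<omega>)
      have nn: "0 \<le> normalized J \<omega> i" for i using elim unfolding P_infty_def by blast
      have "(\<integral>\<^sup>+i. indicator A (normalized J \<omega>) * ennreal (\<Prod>m\<in>{1..n}. normalized J \<omega> (i m)) \<partial>count_space (index_maps n \<pi>))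
          = indicator A (normalized J \<omega>) * (\<integral>\<^sup>+i. ennreal (\<Prod>m\<in>{1..n}. normalized J \<omega> (i m)) \<partial>count_space (index_maps n \<pi>))"
        by (rule nn_integral_cmult) simp
      also have "(\<integral>\<^sup>+i. ennreal (\<Prod>m\<in>{1..n}. normalized J \<omega> (i m)) \<partial>count_space (index_maps n \<pi>)) = ennreal (partition_prob n \<pi> \<omega>)"
        unfolding partition_prob_def pmf_partition_pmf[OF elim] by (simp only: prod_ennreal nn)
      finally show ?case by (simp only: mult.commute)
    qed
    also have "\<dots> = emeasure ?R A"
      by (simp add: nn_integral_indicator[symmetric] nn_integral_distr nn_integral_density del: nn_integral_indicator)
    finally show "emeasure ?L A = emeasure ?R A" .
  qed simp
  then have "(\<integral>\<^sup>+x. F x \<partial>?L) = (\<integral>\<^sup>+x. F x \<partial>?R)" by simp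
  then show ?thesis using F by (simp add: nn_integral_distr nn_integral_density measurable_compose[OF normalized_measurable F])
qed

lemma nn_integral_composed_time:
  assumes other: "stable_points M b J'" and \<beta>: "\<beta> = g * b"
    and fb: "stable_density b fb" and f\<beta>: "stable_density \<beta> f\<beta>"
    and Y: "\<And>j. 1 \<le> j \<Longrightarrow> j \<le> n \<Longrightarrow> Y_density f\<beta> \<beta> n j (h j)"
    and \<pi>: "\<pi> \<in> partitions n" and n: "1 \<le> n" and G [measurable]: "G \<in> borel_measurable borel"
    and I: "iid_indices_given M (normalized J) I"
    and indep: "independent_rvs M (seq_space \<Otimes>\<^sub>M count_space (Pow (Pow {1..n})))
       (\<lambda>\<omega>. (normalized J \<omega>, index_partition n (\<lambda>m. I m \<omega>))) seq_space (normalized J')"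
  shows "(\<integral>\<^sup>+\<omega>. (if index_partition n (\<lambda>m. I m \<omega>) = \<pi> then 1 else 0) * G (composed_time g J J' \<omega>) \<partial>M) =
    (\<integral>\<^sup>+y. ennreal (partition_weight g \<pi> * Gamma (real (card \<pi>)) / (g * Gamma (real n)) *
        (\<Sum>j=1..card \<pi>. blocks_prob (PD_law M J') (card \<pi>) j * h j y)) * G y \<partial>lborel)"
proof -
  interpret B: stable_points M b J' by fact
  note [measurable] = stable_densityD(2)[OF fb]
  have recB [measurable]: "B.recover \<in> borel_measurable seq_space" by (rule B.recover_measurable)
  note [measurable] = recover_measurable
  \<comment> \<open>Both totals are expressed by \<open>recover\<close>, so \<open>F\<close> depends
    only on the two independent arguments named in \<open>indep\<close>.\<close>
  define F where "F z = (if snd (fst z) = \<pi> then 1 else 0) * G (recover (fst (fst z)) * B.recover (snd z) powr (1 / g))" for z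
  have F: "F \<in> borel_measurable ((seq_space \<Otimes>\<^sub>M count_space (Pow (Pow {1..n}))) \<Otimes>\<^sub>M seq_space)"
    unfolding F_def[abs_def] by measurable
  have "(\<integral>\<^sup>+\<omega>. (if index_partition n (\<lambda>m. I m \<omega>) = \<pi> then 1 else 0) * G (composed_time g J J' \<omega>) \<partial>M)
      = (\<integral>\<^sup>+\<omega>. F ((normalized J \<omega>, index_partition n (\<lambda>m. I m \<omega>)), normalized J' \<omega>) \<partial>M)"
    by (rule nn_integral_cong_AE, use AE_recover B.AE_recover in eventually_elim) (simp add: F_def composed_time_def)
  also have "\<dots> = (\<integral>\<^sup>+\<omega>'. (\<integral>\<^sup>+\<omega>. F ((normalized J \<omega>, index_partition n (\<lambda>m. I m \<omega>)), normalized J' \<omega>') \<partial>M) \<partial>M)"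
    by (rule nn_integral_independent_rvs[OF indep F])
  also have "\<dots> = (\<integral>\<^sup>+\<omega>'. (\<integral>\<^sup>+\<omega>. ennreal (partition_prob n \<pi> \<omega>) * G (T \<omega> * B.T \<omega>' powr (1 / g)) \<partial>M) \<partial>M)"
  proof (rule nn_integral_cong_AE, use B.AE_recover in eventually_elim)
    case (elim \<omega>')
    have "(\<integral>\<^sup>+\<omega>. F ((normalized J \<omega>, index_partition n (\<lambda>m. I m \<omega>)), normalized J' \<omega>') \<partial>M)
        = (\<integral>\<^sup>+\<omega>. ennreal (partition_prob n \<pi> \<omega>) * G (recover (normalized J \<omega>) * B.T \<omega>' powr (1 / g)) \<partial>M)"
      unfolding F_def fst_conv snd_conv elim
      by (rule nn_integral_index_partition[OF I]) measurable
    also have "\<dots> = (\<integral>\<^sup>+\<omega>. ennreal (partition_prob n \<pi> \<omega>) * G (T \<omega> * B.T \<omega>' powr (1 / g)) \<partial>M)"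
      by (rule nn_integral_cong_AE, use AE_recover in eventually_elim) simp
    finally show ?case .
  qed
  also have "\<dots> = (\<integral>\<^sup>+u. (\<integral>\<^sup>+\<omega>. ennreal (partition_prob n \<pi> \<omega>) * G (T \<omega> * u powr (1 / g)) \<partial>M) \<partial>distr M borel B.T)"
    by (subst nn_integral_distr) auto
  also have "\<dots> = (\<integral>\<^sup>+u. (\<integral>\<^sup>+\<omega>. ennreal (fb u) * (ennreal (partition_prob n \<pi> \<omega>) * G (T \<omega> * u powr (1 / g))) \<partial>M) \<partial>lborel)"
    unfolding B.distr_T_density[OF fb] by (subst nn_integral_density) (auto simp: nn_integral_cmult)
  also have "\<dots> = (\<integral>\<^sup>+\<omega>. (\<integral>\<^sup>+u. ennreal (fb u) * (ennreal (partition_prob n \<pi> \<omega>) * G (T \<omega> * u powr (1 / g))) \<partial>lborel) \<partial>M)"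
  proof -
    interpret LM: pair_sigma_finite lborel M ..
    show ?thesis by (rule LM.Fubini'[symmetric]) measurable
  qed
  also have "\<dots> = (\<integral>\<^sup>+\<omega>. ennreal (partition_prob n \<pi> \<omega>) * (\<integral>\<^sup>+u. ennreal (fb u) * G (T \<omega> * u powr (1 / g)) \<partial>lborel) \<partial>M)"
    by (intro nn_integral_cong) (simp add: mult.left_commute[of "ennreal (fb _)"] nn_integral_cmult)
  also have "\<dots> = (\<integral>\<^sup>+y. ennreal (partition_weight g \<pi> * Gamma (real (card \<pi>)) / (g * Gamma (real n)) *
        (\<Sum>j=1..card \<pi>. blocks_prob (PD_law M J') (card \<pi>) j * h j y)) * G y \<partial>lborel)"
    by (rule composite_law[OF other \<beta> fb f\<beta> Y \<pi> n G])
  finally show ?thesis .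
qed

lemma composed_time_laplace:
  assumes other: "stable_points M b J'" and I: "iid_indices_given M (normalized J) I"
    and indep: "independent_rvs M (seq_space \<Otimes>\<^sub>M count_space (Pow (Pow {1..n})))
       (\<lambda>\<omega>. (normalized J \<omega>, index_partition n (\<lambda>m. I m \<omega>))) seq_space (normalized J')"
    and l: "0 < l"
  shows "(\<integral>\<^sup>+\<omega>. ennreal (exp (- l * composed_time g J J' \<omega>)) \<partial>M) = ennreal (exp (- (l powr (g * b))))"
proof -
  interpret B: stable_points M b J' by fact
  have recB [measurable]: "B.recover \<in> borel_measurable seq_space" by (rule B.recover_measurable)
  note [measurable] = recover_measurable
  define F where "F z = ennreal (exp (- l * (recover (fst (fst z)) * B.recover (snd z) powr (1 / g))))" for z :: "((nat \<Rightarrow> real) \<times> nat set set) \<times> (nat \<Rightarrow> real)"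
  have F: "F \<in> borel_measurable ((seq_space \<Otimes>\<^sub>M count_space (Pow (Pow {1..n}))) \<Otimes>\<^sub>M seq_space)"
    unfolding F_def[abs_def] by measurable
  have "(\<integral>\<^sup>+\<omega>. ennreal (exp (- l * composed_time g J J' \<omega>)) \<partial>M)
      = (\<integral>\<^sup>+\<omega>. F ((normalized J \<omega>, index_partition n (\<lambda>m. I m \<omega>)), normalized J' \<omega>) \<partial>M)"
    by (rule nn_integral_cong_AE, use AE_recover B.AE_recover in eventually_elim) (simp add: F_def composed_time_def)
  also have "\<dots> = (\<integral>\<^sup>+\<omega>'. (\<integral>\<^sup>+\<omega>. F ((normalized J \<omega>, index_partition n (\<lambda>m. I m \<omega>)), normalized J' \<omega>') \<partial>M) \<partial>M)"
    by (rule nn_integral_independent_rvs[OF indep F])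
  also have "\<dots> = (\<integral>\<^sup>+\<omega>'. ennreal (exp (- (l powr g) * B.T \<omega>')) \<partial>M)"
  proof (rule nn_integral_cong_AE, use B.AE_recover B.AE_good in eventually_elim)
    case (elim \<omega>')
    have T': "0 < B.T \<omega>'" by (rule B.good_T_pos[OF elim(2)])
    have "(\<integral>\<^sup>+\<omega>. F ((normalized J \<omega>, index_partition n (\<lambda>m. I m \<omega>)), normalized J' \<omega>') \<partial>M)
        = (\<integral>\<^sup>+\<omega>. ennreal (exp (- (l * B.T \<omega>' powr (1 / g)) * T \<omega>)) \<partial>M)"
      by (rule nn_integral_cong_AE, use AE_recover in eventually_elim) (simp add: F_def elim mult_ac)
    also have "\<dots> = ennreal (exp (- ((l * B.T \<omega>' powr (1 / g)) powr g)))"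
      using l T' by (intro T_laplace) simp
    also have "(l * B.T \<omega>' powr (1 / g)) powr g = l powr g * B.T \<omega>'"
      using l T' g by (simp add: powr_mult powr_powr)
    finally show ?case by simp
  qed
  also have "\<dots> = ennreal (exp (- ((l powr g) powr b)))"
    using l by (intro B.T_laplace) simp
  finally show ?thesis by (simp add: powr_powr)
qed

end

section \<open>Subordination of stable processes\<close>

lemma stable_subordinatorD:
  assumes "stable_subordinator \<gamma> N X"
  shows "prob_space N" "0 \<le> t \<Longrightarrow> X t \<in> borel_measurable N"
    "\<omega> \<in> space N \<Longrightarrow> 0 \<le> t \<Longrightarrow> 0 \<le> X t \<omega>"
    "\<omega> \<in> space N \<Longrightarrow> 0 \<le> t \<Longrightarrow> continuous (at_right t) (\<lambda>t. X t \<omega>)"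
    "0 \<le> t \<Longrightarrow> 0 \<le> l \<Longrightarrow> (\<integral>\<^sup>+\<omega>. ennreal (exp (- l * X t \<omega>)) \<partial>N) = ennreal (exp (- t * l powr \<gamma>))"
proof -
  show "prob_space N" using assms by (simp add: stable_subordinator_def)
  then interpret prob_space N .
  show m: "X t \<in> borel_measurable N" if "0 \<le> t" for t using assms that by (simp add: stable_subordinator_def)
  have path: "X 0 \<omega> = 0 \<and> mono_on {0..} (\<lambda>t. X t \<omega>) \<and> (\<forall>t\<ge>0. continuous (at_right t) (\<lambda>t. X t \<omega>))" if "\<omega> \<in> space N" for \<omega>
    using assms that unfolding stable_subordinator_def by blast
  show nn: "0 \<le> X t \<omega>" if "\<omega> \<in> space N" "0 \<le> t" for \<omega> t
    using path[OF that(1)] mono_onD[of "{0..}" "\<lambda>t. X t \<omega>" 0 t] that(2) by auto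
  show "continuous (at_right t) (\<lambda>t. X t \<omega>)" if "\<omega> \<in> space N" "0 \<le> t" for \<omega> t
    using path[OF that(1)] that(2) by blast
  show "(\<integral>\<^sup>+\<omega>. ennreal (exp (- l * X t \<omega>)) \<partial>N) = ennreal (exp (- t * l powr \<gamma>))" if tl: "0 \<le> t" "0 \<le> l"
  proof -
    have lt: "\<forall>s t l. 0 \<le> s \<longrightarrow> s \<le> t \<longrightarrow> 0 \<le> l \<longrightarrow> (\<integral>\<omega>. exp (- l * (X t \<omega> - X s \<omega>)) \<partial>N) = exp (- (t - s) * l powr \<gamma>)"
      using assms unfolding stable_subordinator_def by blast
    have "(\<integral>\<omega>. exp (- l * X t \<omega>) \<partial>N) = (\<integral>\<omega>. exp (- l * (X t \<omega> - X 0 \<omega>)) \<partial>N)"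
      by (rule Bochner_Integration.integral_cong) (use path in auto)
    also have "\<dots> = exp (- (t - 0) * l powr \<gamma>)" using lt[rule_format, of 0 t l] tl by blast
    finally have E: "(\<integral>\<omega>. exp (- l * X t \<omega>) \<partial>N) = exp (- t * l powr \<gamma>)" by simp
    have "integrable N (\<lambda>\<omega>. exp (- l * X t \<omega>))"
    proof (rule integrable_const_bound[of _ 1])
      show "AE \<omega> in N. norm (exp (- l * X t \<omega>)) \<le> 1" using nn tl by (intro AE_I2) simp
    qed (use m[OF tl(1)] in measurable)
    then show ?thesis using E by (subst nn_integral_eq_integral) auto
  qed
qed

text \<open>Right continuity of the paths lets the random time be approximated from the right on dyadic grids,
  where independence can be applied one grid point at a time.\<close>

lemma subordination_laplace:
  assumes X: "stable_subordinator \<alpha> N X" and Z: "stable_subordinator b N Z"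
    and ind: "independent_rvs N (\<Pi>\<^sub>M t\<in>{0..}. borel) (\<lambda>\<omega>. \<lambda>t\<in>{0..}. X t \<omega>) (\<Pi>\<^sub>M t\<in>{0..}. borel) (\<lambda>\<omega>. \<lambda>t\<in>{0..}. Z t \<omega>)"
  shows "(\<lambda>\<omega>. X (Z 1 \<omega>) \<omega>) \<in> borel_measurable N"
    and "0 < l \<Longrightarrow> (\<integral>\<^sup>+\<omega>. ennreal (exp (- l * X (Z 1 \<omega>) \<omega>)) \<partial>N) = ennreal (exp (- (l powr (\<alpha> * b))))"
proof -
  interpret prob_space N by (rule stable_subordinatorD(1)[OF X])
  have Z1 [measurable]: "Z 1 \<in> borel_measurable N" by (rule stable_subordinatorD(2)[OF Z]) simp
  have Z0: "0 \<le> Z 1 \<omega>" if "\<omega> \<in> space N" for \<omega> by (rule stable_subordinatorD(3)[OF Z that]) simp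
  \<comment> \<open>\<open>q m z\<close> is the first dyadic of level \<open>m\<close> strictly
    above \<open>z\<close>. Being strictly larger it approaches \<open>z\<close> from the right, and
    it takes countably many values, which gives measurability of the process at this random
    time.\<close>
  define grid :: "nat \<Rightarrow> nat \<Rightarrow> real" where "grid m i = (real i + 1) / 2 ^ m" for m i
  define idx where "idx m z = nat \<lfloor>2 ^ m * z\<rfloor>" for m and z :: real
  define q where "q m z = grid m (idx m z)" for m z
  have grid0: "0 \<le> grid m i" for m i by (simp add: grid_def)
  have idx_m [measurable]: "idx m \<in> borel \<rightarrow>\<^sub>M count_space UNIV" for m unfolding idx_def by measurable
  have q_m [measurable]: "q m \<in> borel_measurable borel" for m unfolding q_def grid_def by measurable
  have q_bounds: "z < q m z \<and> q m z \<le> z + 1 / 2 ^ m" if "0 \<le> z" for m z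
  proof -
    have "real (nat \<lfloor>2 ^ m * z\<rfloor>) = of_int \<lfloor>2 ^ m * z\<rfloor>" using that by simp
    then have "2 ^ m * z < real (idx m z) + 1" "real (idx m z) \<le> 2 ^ m * z" unfolding idx_def by linarith+
    then show ?thesis by (simp add: q_def grid_def field_simps)
  qed
  have q_lim: "(\<lambda>m. q m z) \<longlonglongrightarrow> z" if "0 \<le> z" for z
  proof (rule tendsto_sandwich[where f = "\<lambda>_. z" and h = "\<lambda>m. z + 1 / 2 ^ m"])
    have "(\<lambda>m. z + (1 / 2) ^ m) \<longlonglongrightarrow> z + 0" by (intro tendsto_intros) auto
    then show "(\<lambda>m. z + 1 / 2 ^ m) \<longlonglongrightarrow> z" by (simp add: power_divide)
    show "\<forall>\<^sub>F m in sequentially. z \<le> q m z"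
      by (rule always_eventually, rule allI, rule less_imp_le) (use q_bounds[OF that] in blast)
    show "\<forall>\<^sub>F m in sequentially. q m z \<le> z + 1 / 2 ^ m"
      by (rule always_eventually, rule allI) (use q_bounds[OF that] in blast)
  qed simp
  define Y where "Y m \<omega> = X (q m (Z 1 \<omega>)) \<omega>" for m \<omega>
  have Ym [measurable]: "Y m \<in> borel_measurable N" for m
  proof -
    have "(\<lambda>\<omega>. X (grid m i) \<omega>) \<in> borel_measurable N" for i by (rule stable_subordinatorD(2)[OF X grid0])
    moreover have "(\<lambda>\<omega>. idx m (Z 1 \<omega>)) \<in> N \<rightarrow>\<^sub>M count_space UNIV" by measurable
    ultimately show ?thesis
      unfolding Y_def[abs_def] q_def by (rule measurable_compose_countable)
  qed
  have Ylim: "(\<lambda>m. Y m \<omega>) \<longlonglongrightarrow> X (Z 1 \<omega>) \<omega>" if "\<omega> \<in> space N" for \<omega>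
  proof -
    have "filterlim (\<lambda>m. q m (Z 1 \<omega>)) (at_right (Z 1 \<omega>)) sequentially"
      unfolding filterlim_at using q_lim[OF Z0[OF that]] q_bounds[OF Z0[OF that]] by (auto intro!: always_eventually simp: less_imp_neq[symmetric])
    moreover have "((\<lambda>t. X t \<omega>) \<longlongrightarrow> X (Z 1 \<omega>) \<omega>) (at_right (Z 1 \<omega>))"
      using stable_subordinatorD(4)[OF X that Z0[OF that]] by (simp add: continuous_within)
    ultimately show ?thesis unfolding Y_def by (rule filterlim_compose[rotated])
  qed
  show meas: "(\<lambda>\<omega>. X (Z 1 \<omega>) \<omega>) \<in> borel_measurable N"
    by (rule borel_measurable_LIMSEQ_real[OF Ylim Ym])
  assume l: "0 < l"
  \<comment> \<open>Once \<open>Z\<close> is frozen the time is deterministic, and the transform of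
    \<open>X\<close> there is linear in the time in the exponent. In the limit this becomes the
    transform of \<open>Z 1\<close> at \<open>l powr \<alpha>\<close>.\<close>
  have EY: "(\<integral>\<^sup>+\<omega>. ennreal (exp (- l * Y m \<omega>)) \<partial>N) = (\<integral>\<^sup>+\<omega>. ennreal (exp (- q m (Z 1 \<omega>) * l powr \<alpha>)) \<partial>N)" for m
  proof -
    let ?S = "\<Pi>\<^sub>M t\<in>{0::real..}. borel :: real measure"
    define F where "F p = ennreal (exp (- l * fst p (grid m (idx m (snd p 1)))))" for p :: "(real \<Rightarrow> real) \<times> (real \<Rightarrow> real)"
    have comp: "(\<lambda>x. x t) \<in> borel_measurable ?S" if "0 \<le> t" for t
      using that by (intro measurable_component_singleton) auto
    have "(\<lambda>p. fst p (grid m i)) \<in> borel_measurable (?S \<Otimes>\<^sub>M ?S)" for i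
      by (rule measurable_compose[OF measurable_fst comp[OF grid0]])
    moreover have "(\<lambda>p. idx m (snd p 1)) \<in> (?S \<Otimes>\<^sub>M ?S) \<rightarrow>\<^sub>M count_space UNIV"
      by (rule measurable_compose[OF measurable_compose[OF measurable_snd comp] idx_m]) simp
    ultimately have "(\<lambda>p. fst p (grid m (idx m (snd p 1)))) \<in> borel_measurable (?S \<Otimes>\<^sub>M ?S)"
      by (rule measurable_compose_countable)
    then have F: "F \<in> borel_measurable (?S \<Otimes>\<^sub>M ?S)" unfolding F_def[abs_def] by measurable
    have "(\<integral>\<^sup>+\<omega>. ennreal (exp (- l * Y m \<omega>)) \<partial>N) = (\<integral>\<^sup>+\<omega>. F (\<lambda>t\<in>{0..}. X t \<omega>, \<lambda>t\<in>{0..}. Z t \<omega>) \<partial>N)"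
      by (simp add: F_def Y_def q_def grid0)
    also have "\<dots> = (\<integral>\<^sup>+\<omega>'. (\<integral>\<^sup>+\<omega>. F (\<lambda>t\<in>{0..}. X t \<omega>, \<lambda>t\<in>{0..}. Z t \<omega>') \<partial>N) \<partial>N)"
      by (rule nn_integral_independent_rvs[OF ind F])
    also have "\<dots> = (\<integral>\<^sup>+\<omega>'. (\<integral>\<^sup>+\<omega>. ennreal (exp (- l * X (q m (Z 1 \<omega>')) \<omega>)) \<partial>N) \<partial>N)"
      by (simp add: F_def q_def grid0)
    also have "\<dots> = (\<integral>\<^sup>+\<omega>. ennreal (exp (- q m (Z 1 \<omega>) * l powr \<alpha>)) \<partial>N)"
      using l by (intro nn_integral_cong stable_subordinatorD(5)[OF X]) (auto simp: q_def grid0)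
    finally show ?thesis .
  qed
  have q0: "0 \<le> q m z" for m z by (simp add: q_def grid0)
  have "(\<lambda>m. \<integral>\<^sup>+\<omega>. ennreal (exp (- l * Y m \<omega>)) \<partial>N) \<longlonglongrightarrow> (\<integral>\<^sup>+\<omega>. ennreal (exp (- l * X (Z 1 \<omega>) \<omega>)) \<partial>N)"
  proof (rule nn_integral_dominated_convergence[where w = "\<lambda>_. 1"])
    show "AE \<omega> in N. (\<lambda>m. ennreal (exp (- l * Y m \<omega>))) \<longlonglongrightarrow> ennreal (exp (- l * X (Z 1 \<omega>) \<omega>))"
      by (intro AE_I2 tendsto_ennrealI tendsto_exp tendsto_mult tendsto_const Ylim)
    show "AE \<omega> in N. ennreal (exp (- l * Y m \<omega>)) \<le> 1" for m
      using stable_subordinatorD(3)[OF X _ q0] l by (intro AE_I2) (simp add: Y_def)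
    show "(\<lambda>\<omega>. ennreal (exp (- l * X (Z 1 \<omega>) \<omega>))) \<in> borel_measurable N" using meas by measurable
  qed (auto simp: emeasure_space_1)
  moreover have "(\<lambda>m. \<integral>\<^sup>+\<omega>. ennreal (exp (- q m (Z 1 \<omega>) * l powr \<alpha>)) \<partial>N) \<longlonglongrightarrow> (\<integral>\<^sup>+\<omega>. ennreal (exp (- Z 1 \<omega> * l powr \<alpha>)) \<partial>N)"
  proof (rule nn_integral_dominated_convergence[where w = "\<lambda>_. 1"])
    show "AE \<omega> in N. (\<lambda>m. ennreal (exp (- q m (Z 1 \<omega>) * l powr \<alpha>))) \<longlonglongrightarrow> ennreal (exp (- Z 1 \<omega> * l powr \<alpha>))"
      by (intro AE_I2 tendsto_ennrealI tendsto_exp tendsto_mult tendsto_minus tendsto_const q_lim Z0)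
    show "AE \<omega> in N. ennreal (exp (- q m (Z 1 \<omega>) * l powr \<alpha>)) \<le> 1" for m
      using q0 by (intro AE_I2) simp
  qed (auto simp: emeasure_space_1)
  ultimately have "(\<integral>\<^sup>+\<omega>. ennreal (exp (- l * X (Z 1 \<omega>) \<omega>)) \<partial>N) = (\<integral>\<^sup>+\<omega>. ennreal (exp (- Z 1 \<omega> * l powr \<alpha>)) \<partial>N)"
    unfolding EY by (rule LIMSEQ_unique)
  also have "\<dots> = (\<integral>\<^sup>+\<omega>. ennreal (exp (- (l powr \<alpha>) * Z 1 \<omega>)) \<partial>N)" by (simp add: mult.commute)
  also have "\<dots> = ennreal (exp (- 1 * (l powr \<alpha>) powr b))" by (rule stable_subordinatorD(5)[OF Z]) simp_all
  finally show "(\<integral>\<^sup>+\<omega>. ennreal (exp (- l * X (Z 1 \<omega>) \<omega>)) \<partial>N) = ennreal (exp (- (l powr (\<alpha> * b))))"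
    by (simp add: powr_powr)
qed

section \<open>Conditioning on the total\<close>

context stable_points
begin

text \<open>The inner integral over \<open>\<kappa> s\<close> is a version of the conditional
  probability of \<open>\<pi>\<close> given \<open>T = s\<close>. Since
  \<open>regular_cond_law\<close> speaks of rectangles only, the passage to integrals goes through
  measures: for each event \<open>B\<close> of \<open>T\<close> the restricted law of the normalized
  points is a mixture of \<open>\<kappa>\<close>.\<close>

lemma conditional_partition_prob:
  assumes \<kappa>: "regular_cond_law M seq_space (normalized J) T \<kappa>" and f: "stable_density g f"
    and G [measurable]: "G \<in> borel_measurable borel"
  shows "(\<lambda>s. \<integral>\<^sup>+P. ennreal (pmf (partition_pmf n P) \<pi>) \<partial>\<kappa> s) \<in> borel_measurable borel"
    and "(\<integral>\<^sup>+\<omega>. ennreal (partition_prob n \<pi> \<omega>) * G (T \<omega>) \<partial>M) =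
      (\<integral>\<^sup>+s. ennreal (f s) * (\<integral>\<^sup>+P. ennreal (pmf (partition_pmf n P) \<pi>) \<partial>\<kappa> s) * G s \<partial>lborel)"
proof -
  note [measurable] = stable_densityD(2)[OF f] normalized_measurable
  have \<kappa>m: "\<kappa> \<in> borel \<rightarrow>\<^sub>M subprob_algebra seq_space"
    using \<kappa> by (intro measurable_prob_algebraD) (simp add: regular_cond_law_def)
  have pm: "(\<lambda>P. ennreal (pmf (partition_pmf n P) \<pi>)) \<in> borel_measurable seq_space" by measurable
  define \<Phi> where "\<Phi> s = (\<integral>\<^sup>+P. ennreal (pmf (partition_pmf n P) \<pi>) \<partial>\<kappa> s)" for s
  have \<Phi>m [measurable]: "\<Phi> \<in> borel_measurable borel"
    unfolding \<Phi>_def[abs_def] by (rule measurable_compose[OF \<kappa>m nn_integral_measurable_subprob_algebra[OF pm]])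
  then show "(\<lambda>s. \<integral>\<^sup>+P. ennreal (pmf (partition_pmf n P) \<pi>) \<partial>\<kappa> s) \<in> borel_measurable borel"
    by (simp add: \<Phi>_def[abs_def])
  have "distr (density M (\<lambda>\<omega>. ennreal (partition_prob n \<pi> \<omega>))) borel T = density (distr M borel T) \<Phi>" (is "?L = ?R")
  proof (rule measure_eqI)
    fix B assume "B \<in> sets ?L"
    then have B [measurable]: "B \<in> sets borel" by simp
    \<comment> \<open>The law of the normalized points on the event that \<open>T\<close> lies in
      \<open>B\<close>; \<open>DB\<close> is the corresponding restriction of the law of
      \<open>T\<close>.\<close>
    define LB where "LB = distr (density M (\<lambda>\<omega>. indicator B (T \<omega>))) seq_space (normalized J)"
    define DB where "DB = density (distr M borel T) (indicator B)"
    have DB: "sets DB = sets borel" "space DB \<noteq> {}" by (simp_all add: DB_def)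
    have \<kappa>D: "\<kappa> \<in> DB \<rightarrow>\<^sub>M subprob_algebra seq_space" using \<kappa>m by (simp add: measurable_cong_sets[OF DB(1) refl])
    have "LB = DB \<bind> \<kappa>"
    proof (rule measure_eqI)
      show "sets LB = sets (DB \<bind> \<kappa>)"
        using sets_bind[of DB \<kappa> seq_space] sets_kernel[OF \<kappa>D] DB by (simp add: LB_def)
      fix A assume "A \<in> sets LB"
      then have A [measurable]: "A \<in> sets seq_space" by (simp add: LB_def)
      have "emeasure LB A = (\<integral>\<^sup>+\<omega>. indicator B (T \<omega>) * indicator A (normalized J \<omega>) \<partial>M)"
        unfolding LB_def by (simp add: nn_integral_indicator[symmetric] nn_integral_distr nn_integral_density del: nn_integral_indicator)
      also have "\<dots> = (\<integral>\<^sup>+\<omega>. indicator {\<omega> \<in> space M. normalized J \<omega> \<in> A \<and> T \<omega> \<in> B} \<omega> \<partial>M)"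
        by (intro nn_integral_cong) (auto simp: indicator_def)
      also have "\<dots> = emeasure M {\<omega> \<in> space M. normalized J \<omega> \<in> A \<and> T \<omega> \<in> B}"
        by (rule nn_integral_indicator) measurable
      also have "\<dots> = (\<integral>\<^sup>+t. indicator B t * emeasure (\<kappa> t) A \<partial>distr M borel T)"
        using \<kappa> A B unfolding regular_cond_law_def by blast
      also have "\<dots> = (\<integral>\<^sup>+t. emeasure (\<kappa> t) A \<partial>DB)"
        unfolding DB_def using measurable_emeasure_kernel[OF \<kappa>m A] by (subst nn_integral_density) auto
      also have "\<dots> = emeasure (DB \<bind> \<kappa>) A" by (rule emeasure_bind[OF DB(2) \<kappa>D A, symmetric])
      finally show "emeasure LB A = emeasure (DB \<bind> \<kappa>) A" .
    qed
    then have "(\<integral>\<^sup>+P. ennreal (pmf (partition_pmf n P) \<pi>) \<partial>LB) = (\<integral>\<^sup>+P. ennreal (pmf (partition_pmf n P) \<pi>) \<partial>(DB \<bind> \<kappa>))" by simp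
    also have "\<dots> = (\<integral>\<^sup>+t. \<Phi> t \<partial>DB)" unfolding \<Phi>_def by (rule nn_integral_bind[OF pm \<kappa>D])
    also have "\<dots> = emeasure ?R B" unfolding DB_def
      by (subst nn_integral_density) (auto simp: emeasure_density mult.commute)
    also have "(\<integral>\<^sup>+P. ennreal (pmf (partition_pmf n P) \<pi>) \<partial>LB) = (\<integral>\<^sup>+\<omega>. indicator B (T \<omega>) * ennreal (partition_prob n \<pi> \<omega>) \<partial>M)"
    proof -
      have pmJ: "(\<lambda>\<omega>. ennreal (pmf (partition_pmf n (normalized J \<omega>)) \<pi>)) \<in> borel_measurable M"
        by (rule measurable_compose[OF normalized_measurable pm])
      have "(\<integral>\<^sup>+P. ennreal (pmf (partition_pmf n P) \<pi>) \<partial>LB) = (\<integral>\<^sup>+\<omega>. ennreal (pmf (partition_pmf n (normalized J \<omega>)) \<pi>) \<partial>density M (\<lambda>\<omega>. indicator B (T \<omega>)))"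
        unfolding LB_def by (rule nn_integral_distr) (use pm normalized_measurable in simp_all)
      also have "\<dots> = (\<integral>\<^sup>+\<omega>. indicator B (T \<omega>) * ennreal (partition_prob n \<pi> \<omega>) \<partial>M)"
        unfolding partition_prob_def by (rule nn_integral_density) (use pmJ in measurable)
      finally show ?thesis .
    qed
    also have "\<dots> = emeasure ?L B"
      by (simp add: nn_integral_indicator[symmetric] nn_integral_distr nn_integral_density mult.commute del: nn_integral_indicator)
    finally show "emeasure ?L B = emeasure ?R B" .
  qed simp
  then have "(\<integral>\<^sup>+s. G s \<partial>?L) = (\<integral>\<^sup>+s. G s \<partial>?R)" by simp
  moreover have "(\<integral>\<^sup>+s. G s \<partial>?L) = (\<integral>\<^sup>+\<omega>. ennreal (partition_prob n \<pi> \<omega>) * G (T \<omega>) \<partial>M)"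
    by (simp add: nn_integral_distr nn_integral_density)
  moreover have "(\<integral>\<^sup>+s. G s \<partial>?R) = (\<integral>\<^sup>+s. ennreal (f s) * \<Phi> s * G s \<partial>lborel)"
    unfolding distr_T_density[OF f] by (simp add: nn_integral_density mult.assoc)
  ultimately show "(\<integral>\<^sup>+\<omega>. ennreal (partition_prob n \<pi> \<omega>) * G (T \<omega>) \<partial>M) =
      (\<integral>\<^sup>+s. ennreal (f s) * (\<integral>\<^sup>+P. ennreal (pmf (partition_pmf n P) \<pi>) \<partial>\<kappa> s) * G s \<partial>lborel)"
    by (simp add: \<Phi>_def)
qed

text \<open>Comparing integrals identifies the two sides as functions of \<open>y\<close> only almost everywhere;
  both are continuous, the left one by dominated convergence because \<open>u * f u\<close> is bounded.\<close>

lemma nn_integral_conditional_density: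
  assumes other: "stable_points M' b J'" and \<beta>: "\<beta> = g * b"
    and fg: "stable_density g fg" and fb: "stable_density b fb" and f\<beta>: "stable_density \<beta> f\<beta>"
    and Y: "\<And>j. 1 \<le> j \<Longrightarrow> j \<le> n \<Longrightarrow> Y_density f\<beta> \<beta> n j (h j)"
    and \<pi>: "\<pi> \<in> partitions n" and n: "1 \<le> n"
    and \<kappa>: "regular_cond_law M seq_space (normalized J) T \<kappa>" and y: "0 < y"
  shows "(\<integral>\<^sup>+s. ennreal (fg s) * (\<integral>\<^sup>+P. ennreal (pmf (partition_pmf n P) \<pi>) \<partial>\<kappa> s) *
      ennreal (1 / y * (g * (y / s) powr g * fb ((y / s) powr g))) \<partial>lborel) =
    ennreal (partition_weight g \<pi> * Gamma (real (card \<pi>)) / (g * Gamma (real n)) *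
        (\<Sum>j=1..card \<pi>. blocks_prob (PD_law M' J') (card \<pi>) j * h j y))"
proof -
  interpret B: stable_points M' b J' by fact
  note [measurable] = stable_densityD(2)[OF fg] stable_densityD(2)[OF fb]
  define \<Phi> where "\<Phi> s = (\<integral>\<^sup>+P. ennreal (pmf (partition_pmf n P) \<pi>) \<partial>\<kappa> s)" for s
  have \<Phi>m [measurable]: "\<Phi> \<in> borel_measurable borel"
    unfolding \<Phi>_def[abs_def] by (rule conditional_partition_prob(1)[OF \<kappa> fg borel_measurable_const])
  have cond: "(\<integral>\<^sup>+\<omega>. ennreal (partition_prob n \<pi> \<omega>) * G (T \<omega>) \<partial>M) = (\<integral>\<^sup>+s. ennreal (fg s) * \<Phi> s * G s \<partial>lborel)"
    if "G \<in> borel_measurable borel" for G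
    unfolding \<Phi>_def by (rule conditional_partition_prob(2)[OF \<kappa> fg that])
  define H where "H y = partition_weight g \<pi> * Gamma (real (card \<pi>)) / (g * Gamma (real n)) *
        (\<Sum>j=1..card \<pi>. blocks_prob (PD_law M' J') (card \<pi>) j * h j y)" for y
  have hp: "pos_density (h j)" if "j \<in> {1..card \<pi>}" for j
    using Y[of j] that card_partition_le[OF \<pi>] by (auto simp: Y_density_def)
  have H0: "0 \<le> H y" for y
    unfolding H_def using partition_weight_pos[OF g, of \<pi>] g card_partition_pos[OF \<pi> n] n pos_density_nonneg[OF hp]
    by (intro mult_nonneg_nonneg divide_nonneg_nonneg sum_nonneg less_imp_le[OF Gamma_real_pos]) (auto simp: blocks_prob_def)
  have Hm [measurable]: "H \<in> borel_measurable borel" unfolding H_def[abs_def]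
    by (intro borel_measurable_times borel_measurable_sum borel_measurable_const pos_density_measurable[OF hp])
  have Hneg: "H y = 0" if "y \<le> 0" for y unfolding H_def using pos_density_eq_0[OF hp that] by simp
  have Hcont: "continuous_on {0<..} H" unfolding H_def[abs_def]
    using hp unfolding pos_density_def by (intro continuous_intros) auto
  \<comment> \<open>If \<open>u\<close> has density \<open>fb\<close>, then
    \<open>s * u powr (1 / g)\<close> has density \<open>\<psi> (y / s) / y\<close> at
    \<open>y\<close>. Apart from the factor \<open>g\<close>, \<open>\<psi>\<close> is of the form
    \<open>w * fb w\<close>, so \<open>stable_density_bounded\<close> bounds it.\<close>
  define \<psi> where "\<psi> v = g * v powr g * fb (v powr g)" for v
  have \<psi>m [measurable]: "\<psi> \<in> borel_measurable borel" unfolding \<psi>_def[abs_def] by measurable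
  have \<psi>0: "0 \<le> \<psi> v" for v using g stable_densityD(3)[OF fb] by (simp add: \<psi>_def)
  obtain C where C: "\<And>u. 0 < u \<Longrightarrow> u * fb u \<le> C" using B.stable_density_bounded[OF fb] by blast
  have \<psi>C: "\<psi> v \<le> g * C" if "0 < v" for v
    unfolding \<psi>_def mult.assoc using g C[of "v powr g"] that by (intro mult_left_mono) auto
  have \<psi>cont: "continuous_on {0<..} \<psi>"
  proof -
    have "continuous_on {0<..} (\<lambda>v. fb (v powr g))"
      by (rule continuous_on_compose2[of "{0<..}" fb]) (use stable_densityD(1)[OF fb] in \<open>auto simp: pos_density_def intro!: continuous_intros\<close>)
    then show ?thesis unfolding \<psi>_def[abs_def] by (intro continuous_intros) auto
  qed
  \<comment> \<open>The law of \<open>T\<close> weighted by the conditional probability of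
    \<open>\<pi>\<close>. Its total mass is the probability of \<open>\<pi>\<close>, so constants
    are integrable and can dominate.\<close>
  define \<rho> where "\<rho> = density lborel (\<lambda>s. ennreal (fg s) * \<Phi> s)"
  have [measurable_cong]: "sets \<rho> = sets borel" by (simp add: \<rho>_def)
  have \<rho>fin: "finite_measure \<rho>"
  proof (rule finite_measureI)
    have "emeasure \<rho> (space \<rho>) = (\<integral>\<^sup>+s. ennreal (fg s) * \<Phi> s * 1 \<partial>lborel)"
      by (simp add: \<rho>_def emeasure_density)
    also have "\<dots> = (\<integral>\<^sup>+\<omega>. ennreal (partition_prob n \<pi> \<omega>) * 1 \<partial>M)" by (rule cond[symmetric]) simp
    also have "\<dots> \<noteq> \<infinity>" by (simp add: partition_prob_expectation[OF \<pi> n])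
    finally show "emeasure \<rho> (space \<rho>) \<noteq> \<infinity>" .
  qed
  interpret \<rho>: finite_measure \<rho> by (rule \<rho>fin)
  have \<rho>pos: "AE s in \<rho>. 0 < s"
    unfolding \<rho>_def
  proof (subst AE_density, simp, intro AE_I2 impI)
    fix s assume "0 < ennreal (fg s) * \<Phi> s"
    then show "0 < s" using stable_densityD(4)[OF fg, of s] by (cases "s \<le> 0") auto
  qed
  define K where "K y = 1 / y * (LINT s|\<rho>. \<psi> (y / s))" for y
  have bnd: "AE s in \<rho>. norm (\<psi> (y / s)) \<le> g * C" if "0 < y" for y
    using \<rho>pos by eventually_elim (use \<psi>C \<psi>0 that in simp)
  have int: "integrable \<rho> (\<lambda>s. \<psi> (y / s))" if "0 < y" for y
    by (rule \<rho>.integrable_const_bound[OF bnd[OF that]]) measurable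
  have K: "(\<integral>\<^sup>+s. ennreal (fg s) * \<Phi> s * ennreal (1 / y * \<psi> (y / s)) \<partial>lborel) = ennreal (K y)" if "0 < y" for y
  proof -
    have "(\<integral>\<^sup>+s. ennreal (fg s) * \<Phi> s * ennreal (1 / y * \<psi> (y / s)) \<partial>lborel) = (\<integral>\<^sup>+s. ennreal (1 / y * \<psi> (y / s)) \<partial>\<rho>)"
      unfolding \<rho>_def by (subst nn_integral_density) auto
    also have "\<dots> = ennreal (LINT s|\<rho>. 1 / y * \<psi> (y / s))"
      using int[OF that] that \<psi>0 by (intro nn_integral_eq_integral) auto
    finally show ?thesis by (simp add: K_def)
  qed
  have K0: "0 \<le> K y" if "0 < y" for y unfolding K_def using that \<psi>0 by (intro mult_nonneg_nonneg integral_nonneg_AE) auto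
  have Km [measurable]: "K \<in> borel_measurable borel" unfolding K_def[abs_def] by measurable
  have Kcont: "continuous_on {0<..} K"
    unfolding K_def[abs_def]
  proof (rule continuous_on_mult)
    show "continuous_on {0<..} (\<lambda>y. LINT s|\<rho>. \<psi> (y / s))"
      unfolding continuous_on_sequentially comp_def
    proof (intro allI ballI impI)
      fix x :: "nat \<Rightarrow> real" and a :: real
      assume a: "a \<in> {0<..}" and x: "(\<forall>m. x m \<in> {0<..}) \<and> x \<longlonglongrightarrow> a"
      note xa = a x
      show "(\<lambda>m. LINT s|\<rho>. \<psi> (x m / s)) \<longlonglongrightarrow> (LINT s|\<rho>. \<psi> (a / s))"
      proof (rule integral_dominated_convergence[where w = "\<lambda>_. g * C"])
        show "AE s in \<rho>. (\<lambda>m. \<psi> (x m / s)) \<longlonglongrightarrow> \<psi> (a / s)"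
          using \<rho>pos
        proof eventually_elim
          case (elim s)
          show ?case
            by (rule continuous_on_tendsto_compose[OF \<psi>cont]) (use xa elim in \<open>auto intro!: tendsto_divide\<close>)
        qed
        show "AE s in \<rho>. norm (\<psi> (x m / s)) \<le> g * C" for m using bnd xa by auto
        show "integrable \<rho> (\<lambda>_. g * C)" by simp
      qed measurable
    qed
  qed (auto intro!: continuous_intros)
  have subst: "(\<integral>\<^sup>+u. ennreal (fb u) * G (s * u powr (1 / g)) \<partial>lborel) = (\<integral>\<^sup>+y. indicator {0<..} y * ennreal (1 / y * \<psi> (y / s)) * G y \<partial>lborel)"
    if s: "0 < s" and [measurable]: "G \<in> borel_measurable borel" for s and G :: "real \<Rightarrow> ennreal"
  proof -
    have "(\<integral>\<^sup>+u. ennreal (fb u) * G (s * u powr (1 / g)) \<partial>lborel) = (\<integral>\<^sup>+u. indicator {0<..} u * (ennreal (fb u) * G (s * u powr (1 / g))) \<partial>lborel)"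
      using stable_densityD(4)[OF fb] by (intro nn_integral_cong) (auto simp: indicator_def not_less)
    also have "\<dots> = (\<integral>\<^sup>+x. indicator {0<..} x * ennreal (g * x powr (g - 1)) * (ennreal (fb (x powr g)) * G (s * (x powr g) powr (1 / g))) \<partial>lborel)"
      by (rule nn_integral_powr_subst[OF g(1)]) measurable
    also have "\<dots> = ennreal \<bar>1 / s\<bar> * (\<integral>\<^sup>+y. indicator {0<..} (0 + 1 / s * y) * ennreal (g * (0 + 1 / s * y) powr (g - 1)) *
        (ennreal (fb ((0 + 1 / s * y) powr g)) * G (s * ((0 + 1 / s * y) powr g) powr (1 / g))) \<partial>lborel)"
      using s by (intro nn_integral_real_affine) auto
    also have "\<dots> = (\<integral>\<^sup>+y. ennreal \<bar>1 / s\<bar> * (indicator {0<..} (0 + 1 / s * y) * ennreal (g * (0 + 1 / s * y) powr (g - 1)) *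
        (ennreal (fb ((0 + 1 / s * y) powr g)) * G (s * ((0 + 1 / s * y) powr g) powr (1 / g)))) \<partial>lborel)"
      by (rule nn_integral_cmult[symmetric]) measurable
    also have "\<dots> = (\<integral>\<^sup>+y. indicator {0<..} y * ennreal (1 / y * \<psi> (y / s)) * G y \<partial>lborel)"
    proof (rule nn_integral_cong)
      fix y :: real
      show "ennreal \<bar>1 / s\<bar> * (indicator {0<..} (0 + 1 / s * y) * ennreal (g * (0 + 1 / s * y) powr (g - 1)) *
          (ennreal (fb ((0 + 1 / s * y) powr g)) * G (s * ((0 + 1 / s * y) powr g) powr (1 / g))))
        = indicator {0<..} y * ennreal (1 / y * \<psi> (y / s)) * G y"
      proof (cases "0 < y")
        case True
        define v where "v = y / s"
        have v: "0 < v" "0 + 1 / s * y = v" "y = s * v" using True s by (simp_all add: v_def)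
        have "v powr (g - 1) = v powr g / v" using v(1) by (simp add: powr_diff)
        then have "1 / s * (g * v powr (g - 1) * fb (v powr g)) = 1 / y * \<psi> v"
          using s v(1) by (simp add: \<psi>_def v(3))
        then have "ennreal \<bar>1 / s\<bar> * (ennreal (g * v powr (g - 1)) * ennreal (fb (v powr g))) = ennreal (1 / y * \<psi> v)"
          using s g stable_densityD(3)[OF fb] by (simp flip: ennreal_mult)
        moreover have "s * (v powr g) powr (1 / g) = y" using v g by (simp add: powr_powr)
        moreover have "0 < 0 + 1 / s * y" using v by simp
        ultimately show ?thesis
          unfolding v(2) using True v(1) by (simp add: v_def[symmetric] mult.assoc[symmetric])
      next
        case False
        then have "\<not> 0 < 0 + 1 / s * y" using s by (simp add: zero_less_divide_iff)
        then show ?thesis using False by (simp add: indicator_def)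
      qed
    qed
    finally show ?thesis .
  qed
  \<comment> \<open>\<open>composite_law\<close> is unfolded by conditioning on \<open>T = s\<close>
    and then substituting for \<open>u\<close>. After an exchange of integrals the left side of the
    claim, \<open>K\<close>, appears as a density.\<close>
  have integrals: "(\<integral>\<^sup>+y. indicator {0<..} y * ennreal (K y) * G y \<partial>lborel) = (\<integral>\<^sup>+y. ennreal (H y) * G y \<partial>lborel)"
    if [measurable]: "G \<in> borel_measurable borel" for G
  proof -
    have "(\<integral>\<^sup>+y. ennreal (H y) * G y \<partial>lborel) = (\<integral>\<^sup>+\<omega>. ennreal (partition_prob n \<pi> \<omega>) * (\<integral>\<^sup>+u. ennreal (fb u) * G (T \<omega> * u powr (1 / g)) \<partial>lborel) \<partial>M)"
      unfolding H_def by (rule composite_law[OF other \<beta> fb f\<beta> Y \<pi> n that, symmetric])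
    also have "\<dots> = (\<integral>\<^sup>+s. ennreal (fg s) * \<Phi> s * (\<integral>\<^sup>+u. ennreal (fb u) * G (s * u powr (1 / g)) \<partial>lborel) \<partial>lborel)"
      by (rule cond) measurable
    also have "\<dots> = (\<integral>\<^sup>+s. (\<integral>\<^sup>+y. ennreal (fg s) * \<Phi> s * (indicator {0<..} y * ennreal (1 / y * \<psi> (y / s)) * G y) \<partial>lborel) \<partial>lborel)"
    proof (rule nn_integral_cong)
      fix s :: real
      show "ennreal (fg s) * \<Phi> s * (\<integral>\<^sup>+u. ennreal (fb u) * G (s * u powr (1 / g)) \<partial>lborel) =
        (\<integral>\<^sup>+y. ennreal (fg s) * \<Phi> s * (indicator {0<..} y * ennreal (1 / y * \<psi> (y / s)) * G y) \<partial>lborel)"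
      proof (cases "0 < s")
        case True
        show ?thesis unfolding subst[OF True that] by (rule nn_integral_cmult[symmetric]) measurable
      qed (use stable_densityD(4)[OF fg, of s] in simp)
    qed
    also have "\<dots> = (\<integral>\<^sup>+y. (\<integral>\<^sup>+s. ennreal (fg s) * \<Phi> s * (indicator {0<..} y * ennreal (1 / y * \<psi> (y / s)) * G y) \<partial>lborel) \<partial>lborel)"
      by (rule lborel_pair.Fubini'[symmetric]) measurable
    also have "\<dots> = (\<integral>\<^sup>+y. indicator {0<..} y * ennreal (K y) * G y \<partial>lborel)"
    proof (rule nn_integral_cong)
      fix y :: real
      have "(\<integral>\<^sup>+s. ennreal (fg s) * \<Phi> s * (indicator {0<..} y * ennreal (1 / y * \<psi> (y / s)) * G y) \<partial>lborel)
          = (\<integral>\<^sup>+s. (indicator {0<..} y * G y) * (ennreal (fg s) * \<Phi> s * ennreal (1 / y * \<psi> (y / s))) \<partial>lborel)"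
        by (simp only: mult_ac)
      also have "\<dots> = (indicator {0<..} y * G y) * (\<integral>\<^sup>+s. ennreal (fg s) * \<Phi> s * ennreal (1 / y * \<psi> (y / s)) \<partial>lborel)"
        by (rule nn_integral_cmult) measurable
      finally show "(\<integral>\<^sup>+s. ennreal (fg s) * \<Phi> s * (indicator {0<..} y * ennreal (1 / y * \<psi> (y / s)) * G y) \<partial>lborel)
          = indicator {0<..} y * ennreal (K y) * G y"
        using K[of y] by (cases "0 < y") (simp_all add: mult.commute)
    qed
    finally show ?thesis ..
  qed
  have "density lborel (\<lambda>y. indicator {0<..} y * ennreal (K y)) = density lborel (\<lambda>y. ennreal (H y))"
  proof (rule measure_eqI)
    fix A assume "A \<in> sets (density lborel (\<lambda>y. indicator {0<..} y * ennreal (K y)))"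
    then have [measurable]: "A \<in> sets borel" by simp
    show "emeasure (density lborel (\<lambda>y. indicator {0<..} y * ennreal (K y))) A = emeasure (density lborel (\<lambda>y. ennreal (H y))) A"
      using integrals[of "indicator A"] by (simp add: emeasure_density)
  qed simp
  then have "AE y in lborel. indicator {0<..} y * ennreal (K y) = ennreal (H y)"
    by (subst (asm) sigma_finite_measure.density_unique_iff[OF sigma_finite_lborel]) auto
  then have eq: "AE y in lborel. 0 < y \<longrightarrow> K y = H y"
  proof eventually_elim
    case (elim y)
    show ?case
    proof
      assume "0 < y"
      then have "ennreal (K y) = ennreal (H y)" using elim by simp
      then show "K y = H y" using K0[OF \<open>0 < y\<close>] H0[of y] by (simp add: ennreal_inj)
    qed
  qed
  \<comment> \<open>Equality at the given \<open>y\<close> is obtained from two one-sided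
    comparisons of continuous functions.\<close>
  have KH: "AE y in lborel. 0 < y \<longrightarrow> K y - H y \<le> 0" using eq by eventually_elim simp
  have HK: "AE y in lborel. 0 < y \<longrightarrow> H y - K y \<le> 0" using eq by eventually_elim simp
  have "K y - H y \<le> 0" "H y - K y \<le> 0"
    by (rule AE_nonpos_imp_nonpos[OF continuous_on_diff[OF Kcont Hcont] KH y])
      (rule AE_nonpos_imp_nonpos[OF continuous_on_diff[OF Hcont Kcont] HK y])
  then have "K y = H y" by simp
  then show ?thesis using K[OF y] unfolding \<Phi>_def \<psi>_def H_def by simp
qed

end

section \<open>Assembly of the four claims\<close>

text \<open>The blocks are the singletons of \<open>1\<close> to \<open>k - 1\<close> and the set
  \<open>{k..n}\<close>. The existence of some partition with \<open>k\<close> blocks is what makes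
  the conditioning event in the theorem have positive probability.\<close>

lemma card_index_partition_min:
  assumes "1 \<le> k" "k \<le> n"
  shows "card (index_partition n (\<lambda>m. min m k)) = k"
proof -
  define c where "c a = {m \<in> {1..n}. min m k = a}" for a
  have mem: "a \<in> c a" if "a \<in> {1..k}" for a
    using that assms unfolding c_def by simp
  have inj: "inj_on c {1..k}"
  proof (rule inj_onI)
    fix a a' assume a: "a \<in> {1..k}" "a' \<in> {1..k}" "c a = c a'"
    then have "a \<in> c a'" using mem[of a] by metis
    then show "a = a'" using a(1) unfolding c_def by simp
  qed
  have img: "(\<lambda>m. min m k) ` {1..n} = {1..k}"
  proof (intro equalityI subsetI)
    fix m assume "m \<in> {1..k}"
    then have "m = min m k" "m \<in> {1..n}" using assms by simp_all
    then show "m \<in> (\<lambda>m. min m k) ` {1..n}" by (rule image_eqI)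
  next
    fix m assume "m \<in> (\<lambda>m. min m k) ` {1..n}"
    then show "m \<in> {1..k}" using assms by force
  qed
  have "index_partition n (\<lambda>m. min m k) = c ` ((\<lambda>m. min m k) ` {1..n})"
    unfolding index_partition_def c_def image_image ..
  then show ?thesis unfolding img using card_image[OF inj] by simp
qed

theorem theorem4p1:
  fixes \<alpha> \<beta> y :: real
    and f :: "real \<Rightarrow> real \<Rightarrow> real"
    and g :: "nat \<Rightarrow> nat \<Rightarrow> real \<Rightarrow> real"
    and M :: "'a measure"
    and J J' :: "nat \<Rightarrow> 'a \<Rightarrow> real"
    and I :: "nat \<Rightarrow> 'a \<Rightarrow> nat"
    and \<kappa> :: "real \<Rightarrow> (nat \<Rightarrow> real) measure"
  assumes params: "0 < \<beta>" "\<beta> < \<alpha>" "\<alpha> < 1" "0 < y"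
    and f: "\<And>\<gamma>. 0 < \<gamma> \<Longrightarrow> \<gamma> < 1 \<Longrightarrow> stable_density \<gamma> (f \<gamma>)"
    and g: "\<And>n j. 1 \<le> j \<Longrightarrow> j \<le> n \<Longrightarrow> Y_density (f \<beta>) \<beta> n j (g n j)"
    and J: "ranked_stable_points \<alpha> M J"
    and J': "ranked_stable_points (\<beta> / \<alpha>) M J'"
    and \<kappa>: "regular_cond_law M seq_space (normalized J) (inv_local_time J) \<kappa>"
    and I: "iid_indices_given M (normalized J) I"
    and indep: "\<And>n. independent_rvs M
       (seq_space \<Otimes>\<^sub>M count_space (Pow (Pow {1..n})))
       (\<lambda>\<omega>. (normalized J \<omega>, index_partition n (\<lambda>m. I m \<omega>)))
       seq_space (normalized J')"
  shows "(is_EPPF (PD_mix f \<kappa> \<alpha> \<beta> y)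
           (\<lambda>ns. let k = length ns; n = sum_list ns in
              (\<Sum>j=1..k. blocks_prob (PD_law M J') k j * (g n j y / f \<beta> y)) * p_PD \<alpha> ns))
    \<and> (\<forall>n k. 1 \<le> k \<longrightarrow> k \<le> n \<longrightarrow>
           distributed
             (uniform_measure M {\<omega> \<in> space M. card (index_partition n (\<lambda>m. I m \<omega>)) = k})
             lborel (composed_time \<alpha> J J')
             (\<lambda>t. ennreal (\<Sum>j=1..k. blocks_prob (PD_law M J') k j * g n j t)))
    \<and> (\<forall>(N :: 'b measure) X Z.
           stable_subordinator \<alpha> N X \<longrightarrow> stable_subordinator (\<beta> / \<alpha>) N Z \<longrightarrow>
           independent_rvs N (\<Pi>\<^sub>M t\<in>{0..}. borel) (\<lambda>\<omega>. \<lambda>t\<in>{0..}. X t \<omega>)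
             (\<Pi>\<^sub>M t\<in>{0..}. borel) (\<lambda>\<omega>. \<lambda>t\<in>{0..}. Z t \<omega>) \<longrightarrow>
           distr N borel (\<lambda>\<omega>. X (Z 1 \<omega>) \<omega>) = distr M borel (composed_time \<alpha> J J'))
    \<and> (\<forall>(N :: 'c measure) L.
           ranked_stable_points \<beta> N L \<longrightarrow>
           distr N borel (inv_local_time L) = distr M borel (composed_time \<alpha> J J'))"
proof -
  define b where "b = \<beta> / \<alpha>"
  have \<beta>: "\<beta> = \<alpha> * b" using params by (simp add: b_def)
  have b: "0 < b" "b < 1" using params by (simp_all add: b_def)
  have \<alpha>: "0 < \<alpha>" "\<beta> < 1" using params by simp_all
  have prob: "prob_space M" using J by (simp add: ranked_stable_points_def)
  interpret A: stable_points M \<alpha> J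
    using prob J \<alpha> params by (simp add: stable_points_def stable_points_axioms_def)
  have other: "stable_points M b J'"
    using prob J' b by (simp add: stable_points_def stable_points_axioms_def b_def)
  interpret B: stable_points M b J' by (rule other)
  have fs: "stable_density \<alpha> (f \<alpha>)" "stable_density b (f b)" "stable_density \<beta> (f \<beta>)"
    using f \<alpha> b params by simp_all
  have comp_m [measurable]: "composed_time \<alpha> J J' \<in> borel_measurable M"
    unfolding composed_time_def[abs_def] by measurable
  have comp_pos: "AE \<omega> in M. 0 \<le> composed_time \<alpha> J J' \<omega>"
    using A.AE_good by eventually_elim (simp add: composed_time_def less_imp_le[OF A.good_T_pos])
  \<comment> \<open>The composed time involves only the normalized sequences, so independence is
    invoked with the trivial partition of the empty set.\<close>
  have comp_lap: "(\<integral>\<^sup>+\<omega>. ennreal (exp (- l * composed_time \<alpha> J J' \<omega>)) \<partial>M) = ennreal (exp (- (l powr \<beta>)))" if "0 < l" for l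
    using A.composed_time_laplace[OF other I indep[of 0] that] by (simp add: \<beta>)
  define bp where "bp k j = blocks_prob (PD_law M J') k j" for k j
  define p where "p n \<pi> = partition_weight \<alpha> \<pi> * Gamma (real (card \<pi>)) / (\<alpha> * Gamma (real n))" for n :: nat and \<pi> :: "nat set set"
  have p_pos: "0 < p n \<pi>" if "\<pi> \<in> partitions n" "1 \<le> n" for n \<pi>
    unfolding p_def using partition_weight_pos[OF A.g, of \<pi>] \<alpha> card_partition_pos[OF that] that(2)
    by (intro divide_pos_pos mult_pos_pos Gamma_real_pos) auto
  have gp: "pos_density (g n j)" if "1 \<le> j" "j \<le> n" for n j :: nat using g[OF that] by (simp add: Y_density_def)

  have "is_EPPF (PD_mix f \<kappa> \<alpha> \<beta> y)
      (\<lambda>ns. let k = length ns; n = sum_list ns in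
        (\<Sum>j=1..k. blocks_prob (PD_law M J') k j * (g n j y / f \<beta> y)) * p_PD \<alpha> ns)"
    unfolding is_EPPF_def
  proof (intro allI impI)
    fix n :: nat and As :: "nat set list"
    assume n: "1 \<le> n" and As: "distinct As" "partition_on {1..n} (set As)"
    define \<pi> where "\<pi> = set As"
    have \<pi>: "\<pi> \<in> partitions n" using As by (simp add: partitions_def \<pi>_def)
    define k where "k = card \<pi>"
    have len: "length (map card As) = k" using distinct_card[OF As(1)] by (simp add: k_def \<pi>_def)
    have sum: "sum_list (map card As) = n"
    proof -
      obtain Bs where Bs: "distinct Bs" "set Bs = \<pi>" "sum_list (map card Bs) = n" using \<pi> by (rule partitions_listE)
      have "sum_list (map card As) = (\<Sum>A\<in>set As. card A)" using As(1) by (rule sum_list_distinct_conv_sum_set)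
      also have "\<dots> = sum_list (map card Bs)" using Bs by (simp add: \<pi>_def sum_list_distinct_conv_sum_set)
      finally show ?thesis using Bs(3) by simp
    qed
    have k: "1 \<le> k" "k \<le> n" unfolding k_def using card_partition_pos[OF \<pi> n] card_partition_le[OF \<pi>] by auto
    have "As \<noteq> []" using len k by auto
    then have pPD: "p_PD \<alpha> (map card As) = p n \<pi>"
      using p_PD_partition_weight[OF As(1), of \<alpha>] \<alpha> len sum by (simp add: p_def \<pi>_def k_def)
    define w where "w s = ennreal (indicator {0<..} s * omega f \<alpha> \<beta> y s * f \<alpha> s)" for s
    define \<Phi> where "\<Phi> s = (\<integral>\<^sup>+P. ennreal (pmf (partition_pmf n P) \<pi>) \<partial>\<kappa> s)" for s
    have fa_m: "f \<alpha> \<in> borel_measurable borel" by (rule stable_densityD(2)[OF fs(1)])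
    have fb_m: "(\<lambda>s. f b ((y / s) powr \<alpha>)) \<in> borel_measurable borel"
      by (rule measurable_compose[OF _ stable_densityD(2)[OF fs(2)]]) measurable
    have powr_m: "(\<lambda>s. s powr \<alpha>) \<in> borel_measurable borel" "(\<lambda>s. (y / s) powr \<alpha>) \<in> borel_measurable borel"
      by measurable
    have \<Phi>m: "\<Phi> \<in> borel_measurable borel"
      unfolding \<Phi>_def[abs_def] by (rule A.conditional_partition_prob(1)[OF \<kappa> fs(1) borel_measurable_const])
    have wm [measurable]: "w \<in> borel_measurable borel"
      unfolding w_def[abs_def] omega_def b_def[symmetric]
      by (intro measurable_compose[OF _ measurable_ennreal] borel_measurable_times borel_measurable_divide
        borel_measurable_indicator borel_measurable_const fa_m fb_m powr_m) simp
    have \<kappa>m: "\<kappa> \<in> density lborel w \<rightarrow>\<^sub>M subprob_algebra seq_space"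
      using \<kappa> by (intro measurable_prob_algebraD) (simp add: regular_cond_law_def)
    have mix: "PD_mix f \<kappa> \<alpha> \<beta> y = density lborel w \<bind> \<kappa>" by (simp add: PD_mix_def w_def[abs_def])
    have sets: "sets (PD_mix f \<kappa> \<alpha> \<beta> y) = sets seq_space"
      unfolding mix by (rule sets_bind) (use sets_kernel[OF \<kappa>m] in auto)
    have "emeasure (partition_law (PD_mix f \<kappa> \<alpha> \<beta> y) n) {\<pi>} = (\<integral>\<^sup>+P. ennreal (pmf (partition_pmf n P) \<pi>) \<partial>PD_mix f \<kappa> \<alpha> \<beta> y)"
      using \<pi> by (simp add: emeasure_partition_law[OF sets])
    also have "\<dots> = (\<integral>\<^sup>+s. \<Phi> s \<partial>density lborel w)"
      unfolding mix \<Phi>_def by (rule nn_integral_bind[OF _ \<kappa>m]) measurable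
    also have "\<dots> = (\<integral>\<^sup>+s. w s * \<Phi> s \<partial>lborel)"
      using \<Phi>m by (subst nn_integral_density) auto
    also have "\<dots> = (\<integral>\<^sup>+s. ennreal (1 / f \<beta> y) * (ennreal (f \<alpha> s) * \<Phi> s *
        ennreal (1 / y * (\<alpha> * (y / s) powr \<alpha> * f b ((y / s) powr \<alpha>)))) \<partial>lborel)"
    proof (rule nn_integral_cong)
      fix s :: real
      show "w s * \<Phi> s = ennreal (1 / f \<beta> y) * (ennreal (f \<alpha> s) * \<Phi> s *
          ennreal (1 / y * (\<alpha> * (y / s) powr \<alpha> * f b ((y / s) powr \<alpha>))))"
      proof (cases "0 < s")
        case True
        \<comment> \<open>This splits off \<open>1 / f \<beta> y\<close> from the density at
          \<open>y\<close> of \<open>s * u powr (1 / \<alpha>)\<close>, where \<open>u\<close> has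
          density \<open>f b\<close>. That is the form in which
          \<open>nn_integral_conditional_density\<close> is stated.\<close>
        have "omega f \<alpha> \<beta> y s = 1 / f \<beta> y * (1 / y * (\<alpha> * (y / s) powr \<alpha> * f b ((y / s) powr \<alpha>)))"
          using True \<open>0 < y\<close> by (simp add: omega_def b_def powr_divide powr_diff)
        then have "w s = ennreal (1 / f \<beta> y * (1 / y * (\<alpha> * (y / s) powr \<alpha> * f b ((y / s) powr \<alpha>))) * f \<alpha> s)"
          using True by (simp add: w_def)
        also have "\<dots> = ennreal (1 / f \<beta> y) * ennreal (1 / y * (\<alpha> * (y / s) powr \<alpha> * f b ((y / s) powr \<alpha>))) * ennreal (f \<alpha> s)"
          using stable_densityD(3)[OF fs(1), of s] stable_densityD(3)[OF fs(2), of "(y / s) powr \<alpha>"]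
            stable_densityD(3)[OF fs(3), of y] \<alpha> \<open>0 < y\<close>
          by (subst ennreal_mult, simp_all, subst ennreal_mult[symmetric], simp_all)
        finally show ?thesis by (simp only: mult_ac)
      next
        case False
        then show ?thesis using stable_densityD(4)[OF fs(1), of s] by (simp add: w_def)
      qed
    qed
    also have "\<dots> = ennreal (1 / f \<beta> y) * (\<integral>\<^sup>+s. ennreal (f \<alpha> s) * \<Phi> s *
        ennreal (1 / y * (\<alpha> * (y / s) powr \<alpha> * f b ((y / s) powr \<alpha>))) \<partial>lborel)"
    proof (rule nn_integral_cmult)
      have "(\<lambda>s. 1 / y * (\<alpha> * (y / s) powr \<alpha> * f b ((y / s) powr \<alpha>))) \<in> borel_measurable borel"
        by (intro borel_measurable_times borel_measurable_const fb_m powr_m)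
      then show "(\<lambda>s. ennreal (f \<alpha> s) * \<Phi> s * ennreal (1 / y * (\<alpha> * (y / s) powr \<alpha> * f b ((y / s) powr \<alpha>)))) \<in> borel_measurable lborel"
        using \<Phi>m fa_m by simp
    qed
    also have "(\<integral>\<^sup>+s. ennreal (f \<alpha> s) * \<Phi> s * ennreal (1 / y * (\<alpha> * (y / s) powr \<alpha> * f b ((y / s) powr \<alpha>))) \<partial>lborel)
        = ennreal (p n \<pi> * (\<Sum>j=1..k. bp k j * g n j y))"
      unfolding \<Phi>_def p_def bp_def k_def
      by (rule A.nn_integral_conditional_density[OF other \<beta> fs g \<pi> n \<kappa> \<open>0 < y\<close>])
    also have "ennreal (1 / f \<beta> y) * \<dots> = ennreal (1 / f \<beta> y * (p n \<pi> * (\<Sum>j=1..k. bp k j * g n j y)))"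
      using stable_densityD(3)[OF fs(3), of y] by (intro ennreal_mult'[symmetric]) simp
    finally have "emeasure (partition_law (PD_mix f \<kappa> \<alpha> \<beta> y) n) {\<pi>} = ennreal (1 / f \<beta> y * (p n \<pi> * (\<Sum>j=1..k. bp k j * g n j y)))" .
    moreover have "0 \<le> 1 / f \<beta> y * (p n \<pi> * (\<Sum>j=1..k. bp k j * g n j y))"
      using stable_densityD(3)[OF fs(3), of y] p_pos[OF \<pi> n] pos_density_nonneg[OF gp] k
      by (intro mult_nonneg_nonneg sum_nonneg) (auto simp: bp_def blocks_prob_def)
    ultimately have "measure (partition_law (PD_mix f \<kappa> \<alpha> \<beta> y) n) {\<pi>} = 1 / f \<beta> y * (p n \<pi> * (\<Sum>j=1..k. bp k j * g n j y))"
      by (simp add: measure_def)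
    also have "\<dots> = (\<Sum>j=1..k. bp k j * (g n j y / f \<beta> y)) * p n \<pi>"
      by (simp add: sum_distrib_left sum_distrib_right sum_divide_distrib mult_ac)
    finally show "measure (partition_law (PD_mix f \<kappa> \<alpha> \<beta> y) n) {set As} =
        (let k = length (map card As); n = sum_list (map card As) in
          (\<Sum>j=1..k. blocks_prob (PD_law M J') k j * (g n j y / f \<beta> y)) * p_PD \<alpha> (map card As))"
      unfolding Let_def len sum pPD bp_def \<pi>_def .
  qed
  moreover have "distributed (uniform_measure M {\<omega> \<in> space M. card (index_partition n (\<lambda>m. I m \<omega>)) = k})
      lborel (composed_time \<alpha> J J') (\<lambda>t. ennreal (\<Sum>j=1..k. blocks_prob (PD_law M J') k j * g n j t))"
    if k: "1 \<le> k" "k \<le> n" for n k :: nat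
  proof -
    have n: "1 \<le> n" using k by simp
    define part where "part \<omega> = index_partition n (\<lambda>m. I m \<omega>)" for \<omega>
    have "(\<lambda>\<omega>. (normalized J \<omega>, part \<omega>)) \<in> M \<rightarrow>\<^sub>M seq_space \<Otimes>\<^sub>M count_space (Pow (Pow {1..n}))"
      using indep[of n] unfolding independent_rvs_def part_def by blast
    from measurable_compose[OF this measurable_snd]
    have part_m [measurable]: "part \<in> M \<rightarrow>\<^sub>M count_space (Pow (Pow {1..n}))" by simp
    define E where "E = {\<omega> \<in> space M. card (part \<omega>) = k}"
    have E [measurable]: "E \<in> sets M" unfolding E_def by measurable
    define H where "H t = (\<Sum>j=1..k. bp k j * g n j t)" for t
    have Hm [measurable]: "H \<in> borel_measurable borel" unfolding H_def[abs_def]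
      using k by (intro borel_measurable_sum borel_measurable_times borel_measurable_const pos_density_measurable[OF gp]) auto
    have H0: "0 \<le> H t" for t unfolding H_def using pos_density_nonneg[OF gp] k
      by (intro sum_nonneg mult_nonneg_nonneg) (auto simp: bp_def blocks_prob_def)
    \<comment> \<open>The event of \<open>k\<close> blocks is the disjoint union over these
      partitions; \<open>q\<close> is its probability.\<close>
    define Q where "Q = {\<pi> \<in> partitions n. card \<pi> = k}"
    have finQ [simp]: "finite Q" unfolding Q_def by simp
    have Q: "\<pi> \<in> partitions n" "card \<pi> = k" if "\<pi> \<in> Q" for \<pi> using that by (simp_all add: Q_def)
    define q where "q = (\<Sum>\<pi>\<in>Q. p n \<pi>)"
    have "index_partition n (\<lambda>m. min m k) \<in> Q"
      unfolding Q_def using index_partition_in_partitions card_index_partition_min[OF k] by blast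
    then have "Q \<noteq> {}" by blast
    then have q: "0 < q" unfolding q_def by (intro sum_pos finQ p_pos[OF Q(1) n])
    \<comment> \<open>Given a partition of \<open>Q\<close>, the density of the composed time is
      \<open>H\<close>, which depends on the partition only through its number of blocks. The
      probabilities \<open>p n \<pi>\<close> therefore factor out and add up to
      \<open>q\<close>.\<close>
    have main: "(\<integral>\<^sup>+\<omega>. indicator E \<omega> * G (composed_time \<alpha> J J' \<omega>) \<partial>M) = ennreal q * (\<integral>\<^sup>+t. ennreal (H t) * G t \<partial>lborel)"
      if [measurable]: "G \<in> borel_measurable borel" for G
    proof -
      have "(\<integral>\<^sup>+\<omega>. indicator E \<omega> * G (composed_time \<alpha> J J' \<omega>) \<partial>M) = (\<integral>\<^sup>+\<omega>. (\<Sum>\<pi>\<in>Q. (if part \<omega> = \<pi> then 1 else 0) * G (composed_time \<alpha> J J' \<omega>)) \<partial>M)"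
      proof (rule nn_integral_cong)
        fix \<omega> assume "\<omega> \<in> space M"
        have "part \<omega> \<in> partitions n" unfolding part_def by (rule index_partition_in_partitions)
        then have "indicator E \<omega> = (\<Sum>\<pi>\<in>Q. if part \<omega> = \<pi> then 1 else (0 :: ennreal))"
          using \<open>\<omega> \<in> space M\<close> by (simp add: E_def Q_def indicator_def)
        then show "indicator E \<omega> * G (composed_time \<alpha> J J' \<omega>) = (\<Sum>\<pi>\<in>Q. (if part \<omega> = \<pi> then 1 else 0) * G (composed_time \<alpha> J J' \<omega>))"
          by (simp only: sum_distrib_right)
      qed
      also have "\<dots> = (\<Sum>\<pi>\<in>Q. \<integral>\<^sup>+\<omega>. (if part \<omega> = \<pi> then 1 else 0) * G (composed_time \<alpha> J J' \<omega>) \<partial>M)"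
        by (rule nn_integral_sum) measurable
      also have "\<dots> = (\<Sum>\<pi>\<in>Q. ennreal (p n \<pi>) * (\<integral>\<^sup>+t. ennreal (H t) * G t \<partial>lborel))"
      proof (intro sum.cong refl)
        fix \<pi> assume "\<pi> \<in> Q"
        note \<pi> = Q[OF this]
        have "(\<integral>\<^sup>+\<omega>. (if part \<omega> = \<pi> then 1 else 0) * G (composed_time \<alpha> J J' \<omega>) \<partial>M) = (\<integral>\<^sup>+t. ennreal (p n \<pi> * H t) * G t \<partial>lborel)"
          unfolding part_def p_def H_def bp_def \<pi>(2)[symmetric]
          by (rule A.nn_integral_composed_time[OF other \<beta> fs(2,3) g \<pi>(1) n that I indep])
        also have "\<dots> = (\<integral>\<^sup>+t. ennreal (p n \<pi>) * (ennreal (H t) * G t) \<partial>lborel)"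
          using p_pos[OF \<pi>(1) n] by (simp add: ennreal_mult' mult.assoc)
        also have "\<dots> = ennreal (p n \<pi>) * (\<integral>\<^sup>+t. ennreal (H t) * G t \<partial>lborel)"
          by (rule nn_integral_cmult) measurable
        finally show "(\<integral>\<^sup>+\<omega>. (if part \<omega> = \<pi> then 1 else 0) * G (composed_time \<alpha> J J' \<omega>) \<partial>M) = ennreal (p n \<pi>) * (\<integral>\<^sup>+t. ennreal (H t) * G t \<partial>lborel)" .
      qed
      also have "\<dots> = ennreal q * (\<integral>\<^sup>+t. ennreal (H t) * G t \<partial>lborel)"
        unfolding q_def sum_distrib_right[symmetric] using p_pos[OF Q(1) n] by (subst sum_ennreal) (auto intro: less_imp_le)
      finally show ?thesis .
    qed
    \<comment> \<open>Computed from the sampling probabilities directly; setting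
      \<open>G = 1\<close> in \<open>main\<close> would leave the total mass of \<open>H\<close> to
      be determined.\<close>
    have emE: "emeasure M E = ennreal q"
    proof -
      have "emeasure M E = (\<Sum>\<pi>\<in>Q. \<integral>\<^sup>+\<omega>. (if part \<omega> = \<pi> then 1 else 0) * 1 \<partial>M)"
      proof -
        have "indicator E \<omega> = (\<Sum>\<pi>\<in>Q. (if part \<omega> = \<pi> then 1 else (0 :: ennreal)) * 1)" if "\<omega> \<in> space M" for \<omega>
        proof -
          have "part \<omega> \<in> partitions n" unfolding part_def by (rule index_partition_in_partitions)
          then show ?thesis using that by (simp add: E_def Q_def indicator_def)
        qed
        then have "(\<integral>\<^sup>+\<omega>. indicator E \<omega> \<partial>M) = (\<integral>\<^sup>+\<omega>. (\<Sum>\<pi>\<in>Q. (if part \<omega> = \<pi> then 1 else 0) * 1) \<partial>M)"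
          by (rule nn_integral_cong)
        also have "\<dots> = (\<Sum>\<pi>\<in>Q. \<integral>\<^sup>+\<omega>. (if part \<omega> = \<pi> then 1 else 0) * 1 \<partial>M)" by (rule nn_integral_sum) measurable
        finally show ?thesis by simp
      qed
      also have "\<dots> = (\<Sum>\<pi>\<in>Q. ennreal (p n \<pi>))"
      proof (intro sum.cong refl)
        fix \<pi> assume "\<pi> \<in> Q"
        have "(\<integral>\<^sup>+\<omega>. (if part \<omega> = \<pi> then 1 else 0) * 1 \<partial>M) = (\<integral>\<^sup>+\<omega>. ennreal (A.partition_prob n \<pi> \<omega>) * 1 \<partial>M)"
          unfolding part_def by (rule A.nn_integral_index_partition[OF I, where F = "\<lambda>_. 1"]) simp
        then show "(\<integral>\<^sup>+\<omega>. (if part \<omega> = \<pi> then 1 else 0) * 1 \<partial>M) = ennreal (p n \<pi>)"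
          by (simp only: mult_1_right A.partition_prob_expectation[OF Q(1)[OF \<open>\<pi> \<in> Q\<close>] n] p_def)
      qed
      also have "\<dots> = ennreal q" unfolding q_def using p_pos[OF Q(1) n] by (intro sum_ennreal) (auto intro: less_imp_le)
      finally show ?thesis .
    qed
    have "distr (uniform_measure M E) lborel (composed_time \<alpha> J J') = density lborel (\<lambda>t. ennreal (H t))"
    proof (rule measure_eqI)
      fix S assume "S \<in> sets (distr (uniform_measure M E) lborel (composed_time \<alpha> J J'))"
      then have [measurable]: "S \<in> sets borel" by simp
      have "emeasure (distr (uniform_measure M E) lborel (composed_time \<alpha> J J')) S
          = emeasure M (E \<inter> (composed_time \<alpha> J J' -` S \<inter> space M)) / emeasure M E"
        by (subst emeasure_distr) (simp_all add: emeasure_uniform_measure)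
      also have "emeasure M (E \<inter> (composed_time \<alpha> J J' -` S \<inter> space M)) = (\<integral>\<^sup>+\<omega>. indicator E \<omega> * indicator S (composed_time \<alpha> J J' \<omega>) \<partial>M)"
      proof -
        have "emeasure M (E \<inter> (composed_time \<alpha> J J' -` S \<inter> space M)) = (\<integral>\<^sup>+\<omega>. indicator (E \<inter> (composed_time \<alpha> J J' -` S \<inter> space M)) \<omega> \<partial>M)"
          by (rule nn_integral_indicator[symmetric]) measurable
        also have "\<dots> = (\<integral>\<^sup>+\<omega>. indicator E \<omega> * indicator S (composed_time \<alpha> J J' \<omega>) \<partial>M)"
          by (rule nn_integral_cong) (auto simp: indicator_def)
        finally show ?thesis .
      qed
      also have "\<dots> = ennreal q * (\<integral>\<^sup>+t. ennreal (H t) * indicator S t \<partial>lborel)" by (rule main) simp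
      also have "\<dots> / emeasure M E = (\<integral>\<^sup>+t. ennreal (H t) * indicator S t \<partial>lborel)"
      proof -
        have "ennreal q \<noteq> 0" "ennreal q \<noteq> top" using q by simp_all
        then show ?thesis unfolding emE mult.commute[of "ennreal q"] by (rule ennreal_mult_divide_eq)
      qed
      also have "\<dots> = emeasure (density lborel (\<lambda>t. ennreal (H t))) S" by (simp add: emeasure_density)
      finally show "emeasure (distr (uniform_measure M E) lborel (composed_time \<alpha> J J')) S = emeasure (density lborel (\<lambda>t. ennreal (H t))) S" .
    qed simp
    then show ?thesis
      unfolding distributed_def E_def part_def H_def[abs_def] bp_def[symmetric]
      using Hm[unfolded H_def[abs_def]] comp_m by (simp add: measurable_cong_sets[OF sets_uniform_measure refl])
  qed
  moreover have "distr N borel (\<lambda>\<omega>. X (Z 1 \<omega>) \<omega>) = distr M borel (composed_time \<alpha> J J')"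
    if X: "stable_subordinator \<alpha> N X" and Z: "stable_subordinator (\<beta> / \<alpha>) N Z"
      and ind: "independent_rvs N (\<Pi>\<^sub>M t\<in>{0..}. borel) (\<lambda>\<omega>. \<lambda>t\<in>{0..}. X t \<omega>) (\<Pi>\<^sub>M t\<in>{0..}. borel) (\<lambda>\<omega>. \<lambda>t\<in>{0..}. Z t \<omega>)"
    for N :: "'b measure" and X Z
  \<comment> \<open>This is a claim about laws only, with \<open>N\<close> unrelated to
    \<open>M\<close>: the subordinated process at its random time and the composed time both have
    the transform \<open>exp (- (l powr \<beta>))\<close>.\<close>
  proof (rule distr_eqI_laplace[OF _ comp_m _ comp_pos _ comp_lap])
    show "(\<lambda>\<omega>. X (Z 1 \<omega>) \<omega>) \<in> borel_measurable N" by (rule subordination_laplace(1)[OF X Z ind])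
    show "AE \<omega> in N. 0 \<le> X (Z 1 \<omega>) \<omega>"
      using stable_subordinatorD(3)[OF X _ stable_subordinatorD(3)[OF Z]] by (intro AE_I2) auto
    show "(\<integral>\<^sup>+\<omega>. ennreal (exp (- l * X (Z 1 \<omega>) \<omega>)) \<partial>N) = ennreal (exp (- (l powr \<beta>)))" if "0 < l" for l
      using subordination_laplace(2)[OF X Z ind that] \<alpha> by simp
  qed
  moreover have "distr N borel (inv_local_time L) = distr M borel (composed_time \<alpha> J J')"
    if L: "ranked_stable_points \<beta> N L" for N :: "'c measure" and L
  proof -
    interpret L: stable_points N \<beta> L
      using L params \<alpha> by (simp add: stable_points_def stable_points_axioms_def ranked_stable_points_def)
    show ?thesis
    proof (rule distr_eqI_laplace[OF L.T_measurable comp_m _ comp_pos L.T_laplace comp_lap])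
      show "AE \<omega> in N. 0 \<le> L.T \<omega>" using L.AE_good by eventually_elim (rule less_imp_le[OF L.good_T_pos])
    qed
  qed
  ultimately show ?thesis by blast
qed

end
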